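(* Let $1\le t<n$ and $\varepsilon,\delta\in(0,1]$. Let $\rho$ be an $n$-qubit (possibly mixed) quantum state such that $$\min_{\sigma_t\in\mathcal{G}_t}d_{\mathrm{tr}}(\rho,\sigma_t)\le\frac{\varepsilon^2}{4(n-t)},$$ where $\mathcal{G}_t$ is the set of possibly mixed $t$-compressible states. Then there exists a learning algorithm which, utilizing $$N=\mathcal{O}\left(\frac{n^5}{\varepsilon^4}\log\left(\frac{n^2}{\delta}\right)\right)+N_{\mathrm{tom}}\left(t,\tfrac{\varepsilon}{4},\tfrac{\delta}{2}\right)$$ single-copy measurements (each on one copy of $\rho$), yields a classical representation of a state $\hat\rho$ satisfying $d_{\mathrm{tr}}(\hat\rho,\rho)\le\varepsilon$ with probability at least $1-\delta$.
   Context: On $n$ qubits with Pauli operators $X_k,Y_k,Z_k$, the Majorana operators are $\gamma_{2k-1}:=(\prod_{j=1}^{k-1}Z_j)X_k$ and $\gamma_{2k}:=(\prod_{j=1}^{k-1}Z_j)Y_k$, $k\in\{1,\dots,n\}$. A Gaussian unitary is a unitary $G$ for which there is $O\in\mathrm{O}(2n)$ with $G^\dagger\gamma_\mu G=\sum_{\nu}O_{\mu,\nu}\gamma_\nu$ for all $\mu$. A possibly mixed $n$-qubit state is $t$-compressible if it equals $G(\sigma\otimes|0^{n-t}\rangle\langle0^{n-t}|)G^\dagger$ with $G$ a Gaussian unitary and $\sigma$ a (possibly mixed) state on the first $t$ qubits. $d_{\mathrm{tr}}(\rho,\sigma)=\frac12\|\rho-\sigma\|_1$. $N_{\mathrm{tom}}(t,\varepsilon',\delta')$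 denotes the number of copies sufficient for a fixed full-state tomography routine, using single-copy measurements, to output a description of an unknown mixed $t$-qubit state to trace-distance accuracy $\varepsilon'$ with failure probability at most $\delta'$. The learner does not know $\rho$ beyond the stated promise; it knows $n,t,\varepsilon,\delta$. *)

theory Defs
  imports
    "HOL-Probability.Probability"
    "Jordan_Normal_Form.Char_Poly"
    "Jordan_Normal_Form.Schur_Decomposition"
begin

text \<open>A system of \<open>n\<close> qubits is described by complex matrices of dimension \<open>2 ^ n\<close>; qubits are
  numbered from 1, and qubit 1 is the leftmost tensor factor.\<close>

definition kron_mat :: "complex mat \<Rightarrow> complex mat \<Rightarrow> complex mat" (infixr \<open>\<otimes>\<^sub>m\<close> 75) where
  "A \<otimes>\<^sub>m B = mat (dim_row A * dim_row B) (dim_col A * dim_col B)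
     (\<lambda>(i, j). A $$ (i div dim_row B, j div dim_col B) * B $$ (i mod dim_row B, j mod dim_col B))"

definition trace_mat :: "complex mat \<Rightarrow> complex" where
  "trace_mat A = (\<Sum>i<dim_row A. A $$ (i, i))"

definition unitary_mat :: "nat \<Rightarrow> complex mat \<Rightarrow> bool" where
  "unitary_mat d U \<longleftrightarrow> U \<in> carrier_mat d d \<and> mat_adjoint U * U = 1\<^sub>m d \<and> U * mat_adjoint U = 1\<^sub>m d"

definition orthogonal_group :: "nat \<Rightarrow> real mat set" where
  "orthogonal_group m = {Q \<in> carrier_mat m m. transpose_mat Q * Q = 1\<^sub>m m \<and> Q * transpose_mat Q = 1\<^sub>m m}"

definition psd_mat :: "nat \<Rightarrow> complex mat \<Rightarrow> bool" where
  "psd_mat d A \<longleftrightarrow> A \<in> carrier_mat d d \<and> mat_adjoint A = A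
     \<and> (\<forall>v \<in> carrier_vec d. 0 \<le> Re ((A *\<^sub>v v) \<bullet>c v))"

definition qstate :: "nat \<Rightarrow> complex mat \<Rightarrow> bool" where
  "qstate n \<rho> \<longleftrightarrow> psd_mat (2 ^ n) \<rho> \<and> trace_mat \<rho> = 1"

text \<open>The trace norm is the sum of the singular values, that is, of the square roots of the
  eigenvalues of \<open>A\<^sup>\<dagger>A\<close> counted with multiplicity.\<close>

definition trace_norm :: "complex mat \<Rightarrow> real" where
  "trace_norm A = (\<Sum>x \<in># proots (char_poly (mat_adjoint A * A)). sqrt (Re x))"

definition trace_dist :: "complex mat \<Rightarrow> complex mat \<Rightarrow> real" where
  "trace_dist \<rho> \<sigma> = trace_norm (\<rho> - \<sigma>) / 2"

definition pauli_X :: "complex mat" where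
  "pauli_X = mat_of_rows_list 2 [[0, 1], [1, 0]]"

definition pauli_Y :: "complex mat" where
  "pauli_Y = mat_of_rows_list 2 [[0, - \<i>], [\<i>, 0]]"

definition pauli_Z :: "complex mat" where
  "pauli_Z = mat_of_rows_list 2 [[1, 0], [0, - 1]]"

definition on_qubit :: "nat \<Rightarrow> nat \<Rightarrow> complex mat \<Rightarrow> complex mat" where
  "on_qubit n k P = 1\<^sub>m (2 ^ (k - 1)) \<otimes>\<^sub>m P \<otimes>\<^sub>m 1\<^sub>m (2 ^ (n - k))"

text \<open>For \<open>\<mu> \<in> {1..2*n}\<close>; the index \<open>k\<close> satisfies \<open>\<mu> = 2*k - 1\<close> or \<open>\<mu> = 2*k\<close>.\<close>

definition majorana :: "nat \<Rightarrow> nat \<Rightarrow> complex mat" where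
  "majorana n \<mu> = (let k = (\<mu> + 1) div 2 in
     foldr (\<lambda>j B. on_qubit n j pauli_Z * B) [1..<k]
       (on_qubit n k (if odd \<mu> then pauli_X else pauli_Y)))"

text \<open>Majorana indices start at 1 and matrix indices at 0.\<close>

definition gaussian_unitary :: "nat \<Rightarrow> complex mat \<Rightarrow> bool" where
  "gaussian_unitary n G \<longleftrightarrow> unitary_mat (2 ^ n) G \<and>
     (\<exists>Q \<in> orthogonal_group (2 * n). \<forall>\<mu> \<in> {1..2 * n}.
        mat_adjoint G * majorana n \<mu> * G =
        mat (2 ^ n) (2 ^ n)
          (\<lambda>(i, j). \<Sum>\<nu> = 1..2 * n. complex_of_real (Q $$ (\<mu> - 1, \<nu> - 1)) * majorana n \<nu> $$ (i, j)))"

definition zero_proj :: "nat \<Rightarrow> complex mat" where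
  "zero_proj m = mat (2 ^ m) (2 ^ m) (\<lambda>(i, j). if i = 0 \<and> j = 0 then 1 else 0)"

definition compressible_states :: "nat \<Rightarrow> nat \<Rightarrow> complex mat set" where
  "compressible_states n t =
     {G * (\<sigma> \<otimes>\<^sub>m zero_proj (n - t)) * mat_adjoint G | G \<sigma>. gaussian_unitary n G \<and> qstate t \<sigma>}"

definition povm :: "nat \<Rightarrow> complex mat list \<Rightarrow> bool" where
  "povm d Es \<longleftrightarrow> (\<forall>E \<in> set Es. psd_mat d E) \<and> foldr (+) Es (0\<^sub>m d d) = 1\<^sub>m d"

text \<open>Born rule; for a POVM and a state these weights are nonnegative and sum to 1, as \<open>embed_pmf\<close> requires.\<close>

definition outcome_pmf :: "complex mat list \<Rightarrow> complex mat \<Rightarrow> nat pmf" where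
  "outcome_pmf Es \<rho> =
     embed_pmf (\<lambda>i. if i < length Es then Re (trace_mat (Es ! i * \<rho>)) else 0)"

text \<open>Adaptive single-copy procedures as decision trees: \<open>Measure Es k\<close> takes a fresh copy of the
  unknown state, performs the measurement \<open>Es\<close> on it, and continues with \<open>k i\<close> upon outcome \<open>i\<close>;
  \<open>Toss p k\<close> draws internal classical randomness; \<open>Output r\<close> stops and returns \<open>r\<close>.
  The tree itself never refers to the unknown state.\<close>

datatype 'r protocol =
    Output 'r
  | Toss "nat pmf" "nat \<Rightarrow> 'r protocol"
  | Measure "complex mat list" "nat \<Rightarrow> 'r protocol"

primrec run :: "complex mat \<Rightarrow> 'r protocol \<Rightarrow> 'r pmf" where
  "run \<rho> (Output r) = return_pmf r"
| "run \<rho> (Toss p k) = bind_pmf p (\<lambda>i. run \<rho> (k i))"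
| "run \<rho> (Measure Es k) = bind_pmf (outcome_pmf Es \<rho>) (\<lambda>i. run \<rho> (k i))"

primrec uses_at_most :: "'r protocol \<Rightarrow> nat \<Rightarrow> bool" where
  "uses_at_most (Output r) N \<longleftrightarrow> True"
| "uses_at_most (Toss p k) N \<longleftrightarrow> (\<forall>i \<in> set_pmf p. uses_at_most (k i) N)"
| "uses_at_most (Measure Es k) N \<longleftrightarrow> 0 < N \<and> (\<forall>i < length Es. uses_at_most (k i) (N - 1))"

text \<open>On every branch the measurements are legitimate \<open>n\<close>-qubit measurements and the returned
  matrix is an \<open>n\<close>-qubit state.\<close>

primrec state_learner :: "nat \<Rightarrow> complex mat protocol \<Rightarrow> bool" where
  "state_learner n (Output \<rho>) \<longleftrightarrow> qstate n \<rho>"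
| "state_learner n (Toss p k) \<longleftrightarrow> (\<forall>i \<in> set_pmf p. state_learner n (k i))"
| "state_learner n (Measure Es k) \<longleftrightarrow> povm (2 ^ n) Es \<and> (\<forall>i < length Es. state_learner n (k i))"

definition learns_within :: "complex mat protocol \<Rightarrow> complex mat \<Rightarrow> real \<Rightarrow> real \<Rightarrow> bool" where
  "learns_within A \<rho> \<epsilon> \<delta> \<longleftrightarrow>
     measure_pmf.prob (run \<rho> A) {\<rho>'. trace_dist \<rho>' \<rho> \<le> \<epsilon>} \<ge> 1 - \<delta>"

text \<open>\<open>N\<^sub>t\<^sub>o\<^sub>m t \<epsilon> \<delta>\<close> copies suffice for the routine \<open>tom\<close> on every unknown \<open>t\<close>-qubit state.\<close>

definition tomography_routine ::
  "(nat \<Rightarrow> real \<Rightarrow> real \<Rightarrow> complex mat protocol) \<Rightarrow> (nat \<Rightarrow> real \<Rightarrow> real \<Rightarrow> nat) \<Rightarrow> bool" where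
  "tomography_routine tom N\<^sub>t\<^sub>o\<^sub>m \<longleftrightarrow>
     (\<forall>t \<ge> 1. \<forall>\<epsilon> \<in> {0<..1}. \<forall>\<delta> \<in> {0<..1}.
        state_learner t (tom t \<epsilon> \<delta>) \<and> uses_at_most (tom t \<epsilon> \<delta>) (N\<^sub>t\<^sub>o\<^sub>m t \<epsilon> \<delta>) \<and>
        (\<forall>\<rho>. qstate t \<rho> \<longrightarrow> learns_within (tom t \<epsilon> \<delta>) \<rho> \<epsilon> \<delta>))"

end

theory Submission
  imports Defs
begin

text \<open>Let \<open>\<gamma>\<^sub>\<mu>\<close> be the Majorana operators and \<open>h\<^sub>\<mu>\<^sub>\<nu> = Re tr (-i \<gamma>\<^sub>\<mu> \<gamma>\<^sub>\<nu> \<rho>)\<close>. If \<open>G\<close> is Gaussian with orthogonal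
  matrix \<open>Q\<close>, then \<open>G Z\<^sub>k G\<^sup>\<dagger>\<close> is a quadratic form in the \<open>\<gamma>\<^sub>\<mu>\<close>, so the score \<open>\<Sum>\<^sub>k\<^sub>>\<^sub>t tr (G Z\<^sub>k G\<^sup>\<dagger> \<rho>)\<close> is a linear
  functional of \<open>h\<close> whose coefficient matrix has Frobenius norm \<open>sqrt (n - t)\<close>. By Cauchy-Schwarz, entrywise
  accuracy of order \<open>\<epsilon>\<^sup>2 / n\<^bsup>3/2\<^esup>\<close> in \<open>h\<close> gives the score of every \<open>G\<close> up to \<open>\<epsilon>\<^sup>2 / 50\<close>, and Hoeffding's inequality
  provides it from \<open>O(n\<^sup>3 / \<epsilon>\<^sup>4 log (n\<^sup>2 / \<delta>))\<close> copies for each of the \<open>4 n\<^sup>2\<close> entries, measured one at a time.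

  Closeness to a compressible state yields some \<open>G\<close> of score at least \<open>n - t - 0.52 \<epsilon>\<^sup>2\<close>; the learner picks any \<open>G\<close>
  whose estimated score exceeds \<open>n - t - 0.54 \<epsilon>\<^sup>2\<close>. A union bound over the last \<open>n - t\<close> qubits then shows that
  \<open>G\<^sup>\<dagger> \<rho> G\<close> has weight \<open>q \<le> 0.28 \<epsilon>\<^sup>2\<close> outside \<open>|0\<dots>0\<rangle>\<close> on these qubits. No postselection is needed: tomography is
  run on the reduced state of the first \<open>t\<close> qubits, and the distance of \<open>G\<^sup>\<dagger> \<rho> G\<close> to this reduced state tensored
  with \<open>|0\<dots>0\<rangle>\<langle>0\<dots>0|\<close> is at most \<open>sqrt (q (1 - q)) + q \<le> 3 \<epsilon> / 4\<close>, which leaves \<open>\<epsilon> / 4\<close> for the tomography error.\<close>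

text \<open>The budget, in units of \<epsilon>^2: a distance d to a compressible state costs each of
  the n - t expectation values at most 2 d, so the promise costs 0.50 in the score; 0.02 pays for
  the infimum, whose attainment is not shown, and 0.02 for each of the two passages between true and
  estimated scores, one for the good G and one for the selected G. The total 0.56 is halved because
  the outside weight is bounded by a sum of terms (1 - <Z_k>) / 2. The margin is thin: for q = 0.28
  and \<epsilon> = 1 the sum sqrt (q (1 - q)) + q is about 0.73, whereas 2 sqrt q would exceed 1.
  Postselection would leave tomography with a random number of copies; reducing uses every copy, so
  the tomography count enters unchanged. For this a t-qubit measurement is pulled back along the
  partial trace, an operation on effects alone. The trace norm is given by roots of a characteristic
  polynomial. The estimates use its dual form, the maximum of |tr (W A)| over unitaries W, hence the
  spectral theorem below. Only measurements are counted, so G may be selected from the estimates by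
  an arbitrary choice.\<close>

unbundle no vec_syntax

section \<open>Adjoints, traces and positive semidefinite matrices\<close>

lemma adjoint_dim [simp]: "dim_row (mat_adjoint A) = dim_col A" "dim_col (mat_adjoint A) = dim_row A"
  by (auto simp: mat_adjoint_def)

lemma adjoint_carrier [simp, intro]: "A \<in> carrier_mat n m \<Longrightarrow> mat_adjoint A \<in> carrier_mat m n"
  by (auto intro!: carrier_matI)

lemma adjoint_index [simp]:
  fixes A :: "complex mat"
  shows "i < dim_col A \<Longrightarrow> j < dim_row A \<Longrightarrow> mat_adjoint A $$ (i, j) = cnj (A $$ (j, i))"
  unfolding mat_adjoint_def mat_of_rows_def by simp

lemma adjoint_adjoint [simp]:
  fixes A :: "complex mat"
  shows "mat_adjoint (mat_adjoint A) = A"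
  by (intro eq_matI) auto

lemma mult_index:
  fixes A :: "'a :: comm_semiring_0 mat"
  assumes "A \<in> carrier_mat n m" "B \<in> carrier_mat m k" "i < n" "j < k"
  shows "(A * B) $$ (i, j) = (\<Sum>l<m. A $$ (i, l) * B $$ (l, j))"
  using assms by (auto simp: scalar_prod_def lessThan_atLeast0 intro!: sum.cong)

lemma adjoint_mult:
  fixes A :: "complex mat"
  assumes "A \<in> carrier_mat n m" "B \<in> carrier_mat m k"
  shows "mat_adjoint (A * B) = mat_adjoint B * mat_adjoint A"
proof (rule eq_matI)
  fix i j assume ij: "i < dim_row (mat_adjoint B * mat_adjoint A)" "j < dim_col (mat_adjoint B * mat_adjoint A)"
  then have ij: "i < k" "j < n" using assms by auto
  have "mat_adjoint (A * B) $$ (i, j) = cnj ((A * B) $$ (j, i))"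
    using assms ij by (intro adjoint_index) auto
  also have "\<dots> = (\<Sum>l<m. mat_adjoint B $$ (i, l) * mat_adjoint A $$ (l, j))"
    using assms ij by (subst mult_index[OF assms]) (auto simp: mult.commute intro!: sum.cong)
  also have "\<dots> = (mat_adjoint B * mat_adjoint A) $$ (i, j)"
    using assms ij by (subst mult_index[of _ k m _ n]) auto
  finally show "mat_adjoint (A * B) $$ (i, j) = (mat_adjoint B * mat_adjoint A) $$ (i, j)" .
qed (use assms in auto)

text \<open>The side conditions of this rule and the next are equations between dimensions, which
  the simplifier discharges from carrier facts; long products are then normalised to right-nested
  form in one step.\<close>

lemma adjoint_mult':
  fixes A :: "complex mat"
  shows "dim_col A = dim_row B \<Longrightarrow> mat_adjoint (A * B) = mat_adjoint B * mat_adjoint A"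
  by (rule adjoint_mult[of _ "dim_row A" "dim_col A" _ "dim_col B"]) auto

lemma mult_assoc_dim:
  fixes A :: "complex mat"
  shows "dim_col A = dim_row B \<Longrightarrow> dim_col B = dim_row C \<Longrightarrow> A * B * C = A * (B * C)"
  by (rule assoc_mult_mat[of _ "dim_row A" "dim_col A" _ "dim_col B" _ "dim_col C"]) auto

lemma adjoint_add:
  fixes A :: "complex mat"
  assumes "A \<in> carrier_mat n m" "B \<in> carrier_mat n m"
  shows "mat_adjoint (A + B) = mat_adjoint A + mat_adjoint B"
  using assms by (intro eq_matI) auto

lemma adjoint_minus:
  fixes A :: "complex mat"
  assumes "A \<in> carrier_mat n m" "B \<in> carrier_mat n m"
  shows "mat_adjoint (A - B) = mat_adjoint A - mat_adjoint B"
  using assms by (intro eq_matI) auto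

lemma adjoint_smult:
  fixes A :: "complex mat"
  shows "mat_adjoint (c \<cdot>\<^sub>m A) = cnj c \<cdot>\<^sub>m mat_adjoint A"
  by (intro eq_matI) auto

lemma adjoint_one [simp]: "mat_adjoint (1\<^sub>m n :: complex mat) = 1\<^sub>m n"
  by (intro eq_matI) auto

lemma trace_mat_eq: "A \<in> carrier_mat n m \<Longrightarrow> trace_mat A = (\<Sum>i<n. A $$ (i, i))"
  by (simp add: trace_mat_def)

lemma trace_mult_comm:
  assumes "A \<in> carrier_mat n m" "B \<in> carrier_mat m n"
  shows "trace_mat (A * B) = trace_mat (B * A)"
proof -
  have "trace_mat (A * B) = (\<Sum>i<n. \<Sum>l<m. A $$ (i, l) * B $$ (l, i))"
    using assms by (simp add: trace_mat_def mult_index[OF assms] del: index_mult_mat(1))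
  also have "\<dots> = (\<Sum>l<m. \<Sum>i<n. B $$ (l, i) * A $$ (i, l))"
    by (subst sum.swap) (simp add: mult.commute)
  also have "\<dots> = trace_mat (B * A)"
    using assms by (simp add: trace_mat_def mult_index[OF assms(2,1)] del: index_mult_mat(1))
  finally show ?thesis .
qed

lemma trace_add:
  assumes "A \<in> carrier_mat n n" "B \<in> carrier_mat n n"
  shows "trace_mat (A + B) = trace_mat A + trace_mat B"
  using assms by (simp add: trace_mat_def sum.distrib)

lemma trace_minus:
  assumes "A \<in> carrier_mat n n" "B \<in> carrier_mat n n"
  shows "trace_mat (A - B) = trace_mat A - trace_mat B"
  using assms by (simp add: trace_mat_def sum_subtractf)

lemma trace_smult:
  assumes "A \<in> carrier_mat n n"
  shows "trace_mat (c \<cdot>\<^sub>m A) = c * trace_mat A"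
  using assms by (simp add: trace_mat_def sum_distrib_left)

lemma trace_adjoint:
  assumes "A \<in> carrier_mat n n"
  shows "trace_mat (mat_adjoint A) = cnj (trace_mat A)"
  using assms by (simp add: trace_mat_def)

lemma mult_vec_cscalar_adjoint:
  fixes X :: "complex mat"
  assumes "X \<in> carrier_mat m d" "w \<in> carrier_vec d" "v \<in> carrier_vec m"
  shows "(X *\<^sub>v w) \<bullet>c v = w \<bullet>c (mat_adjoint X *\<^sub>v v)"
proof -
  have "(X *\<^sub>v w) \<bullet>c v = (\<Sum>i<m. \<Sum>k<d. X $$ (i, k) * w $ k * cnj (v $ i))"
    using assms by (simp add: scalar_prod_def lessThan_atLeast0 sum_distrib_right)
  also have "\<dots> = (\<Sum>k<d. \<Sum>i<m. w $ k * (cnj (v $ i) * X $$ (i, k)))"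
    by (subst sum.swap) (simp add: mult_ac)
  also have "\<dots> = w \<bullet>c (mat_adjoint X *\<^sub>v v)"
    using assms by (simp add: scalar_prod_def lessThan_atLeast0 sum_distrib_left mult_ac)
  finally show ?thesis .
qed

lemma cscalar_self: "v \<in> carrier_vec d \<Longrightarrow> v \<bullet>c v = of_real (\<Sum>i<d. (cmod (v $ i))\<^sup>2)"
  by (simp add: scalar_prod_def lessThan_atLeast0 complex_norm_square[symmetric] del: of_real_power)

lemma psd_matD:
  assumes "psd_mat d A"
  shows "A \<in> carrier_mat d d" "mat_adjoint A = A"
  using assms by (auto simp: psd_mat_def)

lemma psd_gram:
  assumes X: "X \<in> carrier_mat m d"
  shows "psd_mat d (mat_adjoint X * X)"
  unfolding psd_mat_def
proof (intro conjI ballI)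
  fix v :: "complex vec" assume v: "v \<in> carrier_vec d"
  have "((mat_adjoint X * X) *\<^sub>v v) \<bullet>c v = (mat_adjoint X *\<^sub>v (X *\<^sub>v v)) \<bullet>c v"
    using X v by (subst assoc_mult_mat_vec[of _ d m _ d]) auto
  also have "\<dots> = (X *\<^sub>v v) \<bullet>c (X *\<^sub>v v)"
    using X v by (subst mult_vec_cscalar_adjoint[of _ d m]) auto
  also have "\<dots> = of_real (\<Sum>i<m. (cmod ((X *\<^sub>v v) $ i))\<^sup>2)"
    using X v by (intro cscalar_self) auto
  finally show "0 \<le> Re (((mat_adjoint X * X) *\<^sub>v v) \<bullet>c v)"
    by (simp add: sum_nonneg)
qed (use X in \<open>auto simp: adjoint_mult[of _ d m _ d]\<close>)

lemma psd_conj: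
  assumes A: "psd_mat d A" and X: "X \<in> carrier_mat m d"
  shows "psd_mat m (X * A * mat_adjoint X)"
  unfolding psd_mat_def
proof (intro conjI ballI)
  note Ac = psd_matD[OF A]
  show "mat_adjoint (X * A * mat_adjoint X) = X * A * mat_adjoint X"
    using X Ac by (simp add: adjoint_mult[of _ m d _ m] adjoint_mult[of _ d d _ m] assoc_mult_mat[of _ m d _ d _ m])
  fix v :: "complex vec" assume v: "v \<in> carrier_vec m"
  have "((X * A * mat_adjoint X) *\<^sub>v v) \<bullet>c v = (X *\<^sub>v (A *\<^sub>v (mat_adjoint X *\<^sub>v v))) \<bullet>c v"
    using X v Ac by (simp add: assoc_mult_mat_vec[of _ m d _ m] assoc_mult_mat_vec[of _ m d _ d] mult_mat_vec_carrier[of _ d m])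
  also have "\<dots> = (A *\<^sub>v (mat_adjoint X *\<^sub>v v)) \<bullet>c (mat_adjoint X *\<^sub>v v)"
    using X v Ac by (intro mult_vec_cscalar_adjoint[of _ m d] mult_mat_vec_carrier[of _ d d]
      mult_mat_vec_carrier[of _ d m]) auto
  finally show "0 \<le> Re (((X * A * mat_adjoint X) *\<^sub>v v) \<bullet>c v)"
    using A X v unfolding psd_mat_def by (auto intro!: mult_mat_vec_carrier)
qed (use psd_matD[OF A] X in auto)

lemma psd_add:
  assumes "psd_mat d A" "psd_mat d B"
  shows "psd_mat d (A + B)"
  using assms by (auto simp: psd_mat_def adjoint_add[of _ d d] add_mult_distrib_mat_vec[of _ d d] 
    add_scalar_prod_distrib[of _ d])

lemma psd_zero: "psd_mat d (0\<^sub>m d d)"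
  using psd_gram[of "0\<^sub>m d d" d d] by simp

lemma psd_diag:
  assumes A: "psd_mat d A" and i: "i < d"
  shows "0 \<le> Re (A $$ (i, i))" "Im (A $$ (i, i)) = 0"
proof -
  have c: "A \<in> carrier_mat d d" using psd_matD[OF A] by simp
  have "(A *\<^sub>v unit_vec d i) \<bullet>c unit_vec d i = A $$ (i, i)"
    using c i by (simp add: scalar_prod_def unit_vec_def if_distrib[of cnj] if_distrib[of "(*) _"] cong: if_cong)
  then show "0 \<le> Re (A $$ (i, i))"
    using A i unfolding psd_mat_def by (metis unit_vec_carrier)
  have "cnj (A $$ (i, i)) = A $$ (i, i)"
    using psd_matD[OF A] i by (metis adjoint_index carrier_matD)
  then show "Im (A $$ (i, i)) = 0" by (simp add: complex_eq_iff)
qed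

lemma psd_trace:
  assumes "psd_mat d A"
  shows "0 \<le> Re (trace_mat A)" "Im (trace_mat A) = 0"
  using psd_matD[OF assms] psd_diag[OF assms] by (auto simp: trace_mat_def intro!: sum_nonneg)

section \<open>Spectral theorem and duality for the trace norm\<close>

lemma mat_diag_dims [simp]: "dim_row (mat_diag d f) = d" "dim_col (mat_diag d f) = d"
  by (simp_all add: mat_diag_def)

lemma unitary_mult:
  assumes "unitary_mat d U" "unitary_mat d W"
  shows "unitary_mat d (U * W)"
proof -
  have c: "U \<in> carrier_mat d d" "W \<in> carrier_mat d d"
    and e: "mat_adjoint U * U = 1\<^sub>m d" "U * mat_adjoint U = 1\<^sub>m d"
      "mat_adjoint W * W = 1\<^sub>m d" "W * mat_adjoint W = 1\<^sub>m d"
    using assms by (auto simp: unitary_mat_def)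
  have "mat_adjoint W * mat_adjoint U * (U * W) = mat_adjoint W * (mat_adjoint U * U) * W"
    by (simp add: c[THEN carrier_matD(1)] c[THEN carrier_matD(2)] mult_assoc_dim)
  moreover have "U * W * (mat_adjoint W * mat_adjoint U) = U * (W * mat_adjoint W) * mat_adjoint U"
    by (simp add: c[THEN carrier_matD(1)] c[THEN carrier_matD(2)] mult_assoc_dim)
  ultimately show ?thesis
    using c e by (simp add: unitary_mat_def adjoint_mult[of _ d d _ d])
qed

lemma unitary_adjoint: "unitary_mat d U \<Longrightarrow> unitary_mat d (mat_adjoint U)"
  by (auto simp: unitary_mat_def)

lemma unitaryI:
  assumes U: "U \<in> carrier_mat d d" and "mat_adjoint U * U = 1\<^sub>m d"
  shows "unitary_mat d U"
  using mat_mult_left_right_inverse[OF adjoint_carrier[OF U] U] assms by (simp add: unitary_mat_def)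

text \<open>Deflation step for the spectral theorem: the fundamental theorem of algebra supplies an
  eigenvector, and Gram-Schmidt completes it to an orthogonal basis with that vector in front.
  Stating the eigenvector equation for column 0 of \<open>A * W\<close> allows direct multiplication
  by \<open>mat_adjoint W\<close>.\<close>

lemma unitary_with_eigenvector_column:
  fixes A :: "complex mat"
  assumes A: "A \<in> carrier_mat n n"
  and n: "0 < n"
  shows "\<exists>W e. unitary_mat n W \<and> (\<forall>i<n. (A * W) $$ (i, 0) = e * W $$ (i, 0))"
proof -
  have "degree (char_poly A) = n" using degree_monic_char_poly[OF A] n by simp
  then have "\<not> constant (poly (char_poly A))" using n by (simp add: constant_degree)
  from fundamental_theorem_of_algebra[OF this] obtain e where "poly (char_poly A) e = 0" by blast
  then have "eigenvalue A e" by (simp add: eigenvalue_root_char_poly[OF A])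
  then obtain v where v: "v \<in> carrier_vec n" "v \<noteq> 0\<^sub>v n" and Av: "A *\<^sub>v v = e \<cdot>\<^sub>v v"
    using A by (auto simp: eigenvalue_def eigenvector_def)
  interpret cof_vec_space n "TYPE(complex)" .
  define b where "b = basis_completion v"
  define ws where "ws = gram_schmidt n b"
  from basis_completion[OF v, folded b_def]
  have dist_b: "distinct b" and indep: "\<not> lin_dep (set b)" and b: "set b \<subseteq> carrier_vec n"
    and hdb: "hd b = v" and len_b: "length b = n" by auto
  from hdb len_b n obtain vs where bv: "b = v # vs" by (cases b) auto
  from gram_schmidt_result[OF b dist_b indep refl, folded ws_def]
  have ws: "set ws \<subseteq> carrier_vec n" "corthogonal ws" "length ws = n" by (auto simp: len_b)
  from gram_schmidt_hd[OF v(1), of vs, folded bv] have hdws: "hd ws = v" unfolding ws_def .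
  then have ws0: "ws ! 0 = v" using ws(3) n by (cases ws) auto
  have wsc: "ws ! i \<in> carrier_vec n" if "i < n" for i using ws that by auto
  define r where "r i = sqrt (\<Sum>k<n. (cmod (ws ! i $ k))\<^sup>2)" for i
  have orth: "(\<Sum>k<n. cnj (ws ! i $ k) * ws ! j $ k) = (if i = j then of_real ((r i)\<^sup>2) else 0)"
    if "i < n" "j < n" for i j
  proof -
    have "(\<Sum>k<n. cnj (ws ! i $ k) * ws ! j $ k) = ws ! j \<bullet>c ws ! i"
      using carrier_vecD[OF wsc[OF that(1)]] carrier_vecD[OF wsc[OF that(2)]]
      by (simp add: scalar_prod_def lessThan_atLeast0 mult.commute del: sum.op_ivl_Suc)
    moreover have "ws ! j \<bullet>c ws ! i = 0" if "i \<noteq> j"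
      using corthogonalD[OF ws(2), of j i] \<open>i < n\<close> \<open>j < n\<close> ws(3) that by simp
    moreover have "ws ! i \<bullet>c ws ! i = of_real ((r i)\<^sup>2)"
      unfolding r_def using that by (simp add: cscalar_self[OF wsc] sum_nonneg del: of_real_power)
    ultimately show ?thesis by auto
  qed
  have r: "r i \<noteq> 0" if i: "i < n" for i
  proof
    assume "r i = 0"
    then have "ws ! i \<bullet>c ws ! i = 0"
      using cscalar_self[OF wsc[OF i]] by (simp add: r_def)
    then show False using corthogonalD[OF ws(2), of i i] i ws(3) by simp
  qed
  \<comment> \<open>The Gram-Schmidt vectors are orthogonal but need not have unit length; dividing
    each column by its length keeps column 0 an eigenvector.\<close>
  define W where "W = mat n n (\<lambda>(i, j). ws ! j $ i / of_real (r j))"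
  have W: "W \<in> carrier_mat n n" by (simp add: W_def)
  have "mat_adjoint W * W = 1\<^sub>m n"
  proof (rule eq_matI)
    fix i j assume "i < dim_row (1\<^sub>m n)" "j < dim_col (1\<^sub>m n)"
    then have ij: "i < n" "j < n" by auto
    have "(mat_adjoint W * W) $$ (i, j) =
        (\<Sum>k<n. cnj (ws ! i $ k) * ws ! j $ k) / (of_real (r i) * of_real (r j))"
      using ij W unfolding sum_divide_distrib
      by (subst mult_index[of _ n n _ n]) (auto simp: W_def intro!: sum.cong)
    also have "\<dots> = 1\<^sub>m n $$ (i, j)"
      using ij r[of i] r[of j] by (simp add: orth power2_eq_square)
    finally show "(mat_adjoint W * W) $$ (i, j) = 1\<^sub>m n $$ (i, j)" .
  qed (use W in auto)
  then have "unitary_mat n W" by (rule unitaryI[OF W])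
  moreover have "(A * W) $$ (i, 0) = e * W $$ (i, 0)" if i: "i < n" for i
  proof -
    have "(A * W) $$ (i, 0) = (\<Sum>k<n. A $$ (i, k) * v $ k) / of_real (r 0)"
      using n i W A unfolding sum_divide_distrib
      by (subst mult_index[of _ n n _ n]) (auto simp: W_def ws0 intro!: sum.cong)
    also have "(\<Sum>k<n. A $$ (i, k) * v $ k) = (A *\<^sub>v v) $ i"
      using i A v by (simp add: scalar_prod_def lessThan_atLeast0)
    finally show ?thesis using n i v by (simp add: Av W_def ws0)
  qed
  ultimately show ?thesis by blast
qed

lemma mat_diag_four_block:
  "mat_diag (Suc d) f = four_block_mat (mat 1 1 (\<lambda>_. f 0)) (0\<^sub>m 1 d) (0\<^sub>m d 1) (mat_diag d (\<lambda>i. f (Suc i)))"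
  by (intro eq_matI) (auto simp: mat_diag_def less_Suc_eq_0_disj)

text \<open>Induction on the dimension. Conjugation by the unitary of
  \<open>unitary_with_eigenvector_column\<close> clears column 0 below the diagonal; the result is
  still Hermitian, so row 0 is cleared too, the corner entry is real, and the remaining block is
  Hermitian of smaller size.\<close>

lemma hermitian_diagonalization:
  fixes A :: "complex mat"
  assumes "A \<in> carrier_mat d d" "mat_adjoint A = A"
  shows "\<exists>U (f :: nat \<Rightarrow> real). unitary_mat d U \<and>
    A = U * mat_diag d (\<lambda>i. of_real (f i)) * mat_adjoint U"
  using assms
proof (induction d arbitrary: A)
  case 0
  then show ?case
    by (intro exI[of _ "1\<^sub>m 0"] exI) (auto simp: unitary_mat_def intro!: eq_matI)
next
  case (Suc d)
  let ?n = "Suc d"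
  note A = Suc.prems(1)
  obtain W e where W: "unitary_mat ?n W" and ev: "\<And>i. i < ?n \<Longrightarrow> (A * W) $$ (i, 0) = e * W $$ (i, 0)"
    using unitary_with_eigenvector_column[OF A] by auto
  have Wc: "W \<in> carrier_mat ?n ?n" and WW: "mat_adjoint W * W = 1\<^sub>m ?n" "W * mat_adjoint W = 1\<^sub>m ?n"
    using W by (auto simp: unitary_mat_def)
  define B where "B = mat_adjoint W * (A * W)"
  have B: "B \<in> carrier_mat ?n ?n" using Wc A by (auto simp: B_def)
  have Bh: "mat_adjoint B = B"
    using Suc.prems(2) unfolding B_def
    by (simp add: carrier_matD[OF Wc] carrier_matD[OF A] adjoint_mult' mult_assoc_dim)
  have B0: "B $$ (i, 0) = (if i = 0 then e else 0)" if i: "i < ?n" for i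
  proof -
    have "B $$ (i, 0) = (\<Sum>k<?n. mat_adjoint W $$ (i, k) * (e * W $$ (k, 0)))"
      unfolding B_def using i Wc A
      by (subst mult_index[of _ ?n ?n _ ?n]) (auto simp: ev simp del: index_mult_mat intro!: sum.cong)
    also have "\<dots> = e * (mat_adjoint W * W) $$ (i, 0)"
      using i Wc by (subst mult_index[of _ ?n ?n _ ?n]) (auto simp: sum_distrib_left mult_ac simp del: sum.lessThan_Suc)
    finally show ?thesis using i by (simp add: WW)
  qed
  have B0': "B $$ (0, i) = (if i = 0 then cnj e else 0)" if "i < ?n" for i
    using B0[OF that] B that adjoint_index[of 0 B i] by (simp add: Bh)
  have e: "cnj e = e" using B0[of 0] B0'[of 0] by simp
  define C where "C = mat d d (\<lambda>(i, j). B $$ (Suc i, Suc j))"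
  have C: "C \<in> carrier_mat d d" by (simp add: C_def)
  have "mat_adjoint C = C"
  proof (rule eq_matI)
    fix i j assume "i < dim_row C" "j < dim_col C"
    then have "i < d" "j < d" using C by auto
    then show "mat_adjoint C $$ (i, j) = C $$ (i, j)"
      using B C adjoint_index[of "Suc i" B "Suc j"] by (simp add: Bh) (simp add: C_def)
  qed (use C in auto)
  from Suc.IH[OF C this] obtain U f where U: "unitary_mat d U"
    and CU: "C = U * mat_diag d (\<lambda>i. of_real (f i)) * mat_adjoint U" by blast
  have Uc: "U \<in> carrier_mat d d" and UU: "mat_adjoint U * U = 1\<^sub>m d"
    using U by (auto simp: unitary_mat_def)
  define V where "V = four_block_mat (1\<^sub>m 1) (0\<^sub>m 1 d) (0\<^sub>m d 1) U"
  \<comment> \<open>The corner entry followed by the eigenvalues of the block; \<open>Re e\<close>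
    loses nothing because \<open>e\<close> equals its conjugate.\<close>
  define g where "g i = (case i of 0 \<Rightarrow> Re e | Suc j \<Rightarrow> f j)" for i
  have V: "V \<in> carrier_mat ?n ?n" using Uc four_block_carrier_mat[of "1\<^sub>m 1 :: complex mat" 1 1 U d d] by (simp add: V_def)
  have Va: "mat_adjoint V = four_block_mat (1\<^sub>m 1) (0\<^sub>m 1 d) (0\<^sub>m d 1) (mat_adjoint U)"
    using Uc by (intro eq_matI) (auto simp: V_def)
  have "mat_adjoint V * V = four_block_mat (1\<^sub>m 1) (0\<^sub>m 1 d) (0\<^sub>m d 1) (1\<^sub>m d)"
    using Uc UU unfolding Va unfolding V_def by (subst mult_four_block_mat[of _ 1 1 _ d _ d _ _ 1 _ d]) auto
  also have "\<dots> = 1\<^sub>m ?n" by (intro eq_matI) auto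
  finally have Vu: "unitary_mat ?n V" by (rule unitaryI[OF V])
  have "V * mat_diag ?n (\<lambda>i. of_real (g i)) * mat_adjoint V =
      four_block_mat (mat 1 1 (\<lambda>_. e)) (0\<^sub>m 1 d) (0\<^sub>m d 1) C"
  proof -
    let ?F = "\<lambda>a X. four_block_mat (mat 1 1 (\<lambda>_. a :: complex)) (0\<^sub>m 1 d) (0\<^sub>m d 1) X"
    have F: "?F a X * ?F b Y = ?F (a * b) (X * Y)" if "X \<in> carrier_mat d d" "Y \<in> carrier_mat d d" for a b X Y
    proof -
      have "mat 1 1 (\<lambda>_. a) * mat 1 1 (\<lambda>_. b) = mat 1 1 (\<lambda>_. a * b)"
        by (intro eq_matI) (auto simp: scalar_prod_def)
      then show ?thesis using that
        by (subst mult_four_block_mat[of _ 1 1 _ d _ d _ _ 1 _ d]) auto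
    qed
    have 1: "1\<^sub>m 1 = mat 1 1 (\<lambda>_. 1 :: complex)" by (intro eq_matI) auto
    have Re_e: "of_real (Re e) = e" using e by (simp add: complex_eq_iff)
    have "g 0 = Re e" "(\<lambda>i. g (Suc i)) = f" by (auto simp: g_def)
    then have "V * mat_diag ?n (\<lambda>i. of_real (g i)) * mat_adjoint V =
        ?F 1 U * ?F e (mat_diag d (\<lambda>i. of_real (f i))) * ?F 1 (mat_adjoint U)"
      unfolding Va mat_diag_four_block unfolding V_def 1 by (simp add: fun_eq_iff Re_e)
    also have "?F 1 U * ?F e (mat_diag d (\<lambda>i. of_real (f i))) = ?F (1 * e) (U * mat_diag d (\<lambda>i. of_real (f i)))"
      by (rule F[OF Uc]) simp
    also have "\<dots> * ?F 1 (mat_adjoint U) = ?F (1 * e * 1) C"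
      unfolding CU by (rule F) (use Uc mult_carrier_mat[OF Uc mat_diag_dim] in auto)
    finally show ?thesis by simp
  qed
  also have "\<dots> = B"
    using B by (intro eq_matI) (auto simp: B0 B0' C_def e)
  finally have BV: "B = V * mat_diag ?n (\<lambda>i. of_real (g i)) * mat_adjoint V" ..
  have "A = W * mat_adjoint W * A * (W * mat_adjoint W)" using A by (simp add: WW)
  also have "\<dots> = W * B * mat_adjoint W"
    by (simp add: carrier_matD[OF Wc] carrier_matD[OF A] B_def mult_assoc_dim)
  also have "\<dots> = (W * V) * mat_diag ?n (\<lambda>i. of_real (g i)) * mat_adjoint (W * V)"
    unfolding BV
    by (simp add: carrier_matD[OF Wc] carrier_matD[OF V] mult_assoc_dim adjoint_mult')
  finally show ?case using unitary_mult[OF W Vu] by blast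
qed

section \<open>The trace norm through eigenvalues and through unitaries\<close>

lemma proots_prod_linear:
  "proots (\<Prod>a \<leftarrow> as. [:- a, 1 :: complex:]) = mset as"
proof (induction as)
  case (Cons a as)
  have "(\<Prod>a \<leftarrow> as. [:- a, 1 :: complex:]) \<noteq> 0" by (auto simp: prod_list_zero_iff)
  with Cons show ?case by (simp add: proots_mult del: mult_pCons_left)
qed simp

text \<open>Bridge from the definition by polynomial roots: \<open>mat_adjoint A * A\<close> is
  similar to the diagonal matrix of the f_i^2, whose characteristic polynomial splits over these
  entries, and sqrt (f_i^2) = |f_i|.\<close>

lemma trace_norm_diag:
  assumes U: "unitary_mat d U" and A: "A = U * mat_diag d (\<lambda>i. of_real (f i)) * mat_adjoint U"
  shows "trace_norm A = (\<Sum>i<d. \<bar>f i\<bar>)"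
proof -
  let ?D = "mat_diag d (\<lambda>i. of_real (f i) :: complex)"
  let ?E = "mat_diag d (\<lambda>i. of_real ((f i)\<^sup>2) :: complex)"
  have D: "?D \<in> carrier_mat d d" and E: "?E \<in> carrier_mat d d" by auto
  have Da: "mat_adjoint ?D = ?D" by (intro eq_matI) (auto simp: mat_diag_def)
  have DD: "?D * ?D = ?E" by (simp add: mat_diag_diag power2_eq_square)
  have Uc: "U \<in> carrier_mat d d" and UU: "mat_adjoint U * U = 1\<^sub>m d" "U * mat_adjoint U = 1\<^sub>m d"
    using U by (auto simp: unitary_mat_def)
  have "mat_adjoint A * A = U * ?D * (mat_adjoint U * U) * ?D * mat_adjoint U"
    unfolding A
    by (simp add: carrier_matD[OF Uc] carrier_matD[OF D] adjoint_mult' Da mult_assoc_dim)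
  also have "\<dots> = U * ?E * mat_adjoint U"
    by (simp add: carrier_matD[OF Uc] carrier_matD[OF D] UU mult_assoc_dim power2_eq_square)
  finally have AA: "mat_adjoint A * A = U * ?E * mat_adjoint U" .
  have "similar_mat_wit (mat_adjoint A * A) ?E U (mat_adjoint U)"
    by (rule similar_mat_witI[of _ _ d]) (use Uc UU AA in auto)
  then have "char_poly (mat_adjoint A * A) = char_poly ?E"
    by (intro char_poly_similar) (auto simp: similar_mat_def)
  also have "\<dots> = (\<Prod>a \<leftarrow> diag_mat ?E. [:- a, 1:])"
    by (rule char_poly_upper_triangular[OF E]) (auto simp: mat_diag_def)
  finally have "trace_norm A = (\<Sum>x \<in># mset (diag_mat ?E). sqrt (Re x))"
    by (simp add: trace_norm_def proots_prod_linear)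
  also have "\<dots> = (\<Sum>i\<leftarrow>[0..<d]. \<bar>f i\<bar>)"
    unfolding diag_mat_def sum_mset_sum_list mset_map[symmetric] map_map 
    by (intro arg_cong[of _ _ sum_list] map_cong) (auto simp: mat_diag_def)
  finally show ?thesis by (simp add: interv_sum_list_conv_sum_set_nat lessThan_atLeast0)
qed

lemma trace_norm_nonneg:
  assumes "A \<in> carrier_mat d d" "mat_adjoint A = A"
  shows "0 \<le> trace_norm A"
  using hermitian_diagonalization[OF assms] trace_norm_diag by (metis abs_ge_zero sum_nonneg)

lemma isometry_column_norm:
  fixes X :: "complex mat"
  assumes X: "X \<in> carrier_mat m d" "mat_adjoint X * X = 1\<^sub>m d" and i: "i < d"
  shows "(\<Sum>k<m. (cmod (X $$ (k, i)))\<^sup>2) = 1"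
proof -
  have "of_real (\<Sum>k<m. (cmod (X $$ (k, i)))\<^sup>2) = (mat_adjoint X * X) $$ (i, i)"
    using X(1) i by (subst mult_index[of _ d m _ d]) 
      (auto simp: complex_norm_square mult.commute simp del: of_real_power intro!: sum.cong)
  also have "\<dots> = of_real 1" using X i by simp
  finally show ?thesis unfolding of_real_eq_iff .
qed

text \<open>One half of the duality. In the eigenbasis of A the trace is the sum of the f_i times
  the diagonal entries of \<open>mat_adjoint X * (W * X)\<close>, where \<open>X = V * U\<close> has
  orthonormal columns. The isometry V is included so that the same estimate shows that isometric
  embeddings do not increase the trace norm.\<close>

lemma trace_mult_le_trace_norm:
  fixes A :: "complex mat"
  assumes A: "A \<in> carrier_mat d d" "mat_adjoint A = A"
    and V: "V \<in> carrier_mat m d" "mat_adjoint V * V = 1\<^sub>m d" and W: "unitary_mat m W"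
  shows "cmod (trace_mat (W * (V * A * mat_adjoint V))) \<le> trace_norm A"
proof -
  obtain U f where U: "unitary_mat d U" and AU: "A = U * mat_diag d (\<lambda>i. of_real (f i)) * mat_adjoint U"
    using hermitian_diagonalization[OF A] by blast
  let ?D = "mat_diag d (\<lambda>i. of_real (f i) :: complex)"
  have D: "?D \<in> carrier_mat d d" by auto
  have Uc: "U \<in> carrier_mat d d" and UU: "mat_adjoint U * U = 1\<^sub>m d"
    using U by (auto simp: unitary_mat_def)
  have Wc: "W \<in> carrier_mat m m" and WW: "mat_adjoint W * W = 1\<^sub>m m"
    using W by (auto simp: unitary_mat_def)
  define X where "X = V * U"
  have X: "X \<in> carrier_mat m d" using V Uc by (simp add: X_def)
  have "mat_adjoint X * X = mat_adjoint U * (mat_adjoint V * V) * U"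
    by (simp add: carrier_matD[OF V(1)] carrier_matD[OF Uc] X_def adjoint_mult' mult_assoc_dim)
  then have XX: "mat_adjoint X * X = 1\<^sub>m d" using Uc UU by (simp add: V)
  have WX: "W * X \<in> carrier_mat m d" using Wc X by simp
  have WXX: "mat_adjoint (W * X) * (W * X) = 1\<^sub>m d"
  proof -
    have "mat_adjoint (W * X) * (W * X) = mat_adjoint X * (mat_adjoint W * W) * X"
    by (simp add: carrier_matD[OF Wc] carrier_matD[OF X] adjoint_mult' mult_assoc_dim)
    also have "mat_adjoint X * (mat_adjoint W * W) = mat_adjoint X"
      unfolding WW using X by (intro right_mult_one_mat[of _ d m]) auto
    finally show ?thesis unfolding XX .
  qed
  have Kc: "mat_adjoint X * (W * X) \<in> carrier_mat d d"
    by (rule mult_carrier_mat[OF adjoint_carrier[OF X] WX])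
  have "W * (V * A * mat_adjoint V) = (W * X * ?D) * mat_adjoint X"
    unfolding AU
    by (simp add: carrier_matD[OF V(1)] carrier_matD[OF Uc] carrier_matD[OF Wc] X_def adjoint_mult' mult_assoc_dim)
  also have "trace_mat \<dots> = trace_mat (mat_adjoint X * (W * X * ?D))"
    by (rule trace_mult_comm[OF mult_carrier_mat[OF WX mat_diag_dim] adjoint_carrier[OF X]])
  also have "mat_adjoint X * (W * X * ?D) = (mat_adjoint X * (W * X)) * ?D"
    by (simp add: carrier_matD[OF X] carrier_matD[OF Wc] mult_assoc_dim)
  also have "trace_mat (mat_adjoint X * (W * X) * ?D) = (\<Sum>i<d. (mat_adjoint X * (W * X)) $$ (i, i) * of_real (f i))"
    using Kc by (simp add: trace_mat_def mat_diag_mult_right del: index_mult_mat(1))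
  finally have tr: "trace_mat (W * (V * A * mat_adjoint V)) =
    (\<Sum>i<d. (mat_adjoint X * (W * X)) $$ (i, i) * of_real (f i))" .
  \<comment> \<open>A diagonal entry is the inner product of a column of X with a column of
    \<open>W * X\<close>, both of unit length, so the AM-GM inequality gives the bound 1.\<close>
  have K: "cmod ((mat_adjoint X * (W * X)) $$ (i, i)) \<le> 1" if i: "i < d" for i
  proof -
    have "(mat_adjoint X * (W * X)) $$ (i, i) = (\<Sum>k<m. cnj (X $$ (k, i)) * (W * X) $$ (k, i))"
      using X WX i by (subst mult_index[of _ d m _ d]) (auto simp del: index_mult_mat(1) intro!: sum.cong)
    also have "cmod \<dots> \<le> (\<Sum>k<m. cmod (X $$ (k, i)) * cmod ((W * X) $$ (k, i)))"
      by (rule order.trans[OF norm_sum]) (simp add: norm_mult)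
    also have "\<dots> \<le> (\<Sum>k<m. ((cmod (X $$ (k, i)))\<^sup>2 + (cmod ((W * X) $$ (k, i)))\<^sup>2) / 2)"
    proof (intro sum_mono)
      fix k
      show "cmod (X $$ (k, i)) * cmod ((W * X) $$ (k, i)) \<le>
          ((cmod (X $$ (k, i)))\<^sup>2 + (cmod ((W * X) $$ (k, i)))\<^sup>2) / 2"
        using sum_squares_bound[of "cmod (X $$ (k, i))" "cmod ((W * X) $$ (k, i))"] by simp
    qed
    also have "\<dots> = 1"
      unfolding sum_divide_distrib[symmetric] sum.distrib isometry_column_norm[OF X XX i]
        isometry_column_norm[OF WX WXX i] by simp
    finally show ?thesis .
  qed
  have "cmod (trace_mat (W * (V * A * mat_adjoint V))) \<le> (\<Sum>i<d. 1 * \<bar>f i\<bar>)"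
    unfolding tr
    by (rule order.trans[OF norm_sum]) (use K in \<open>auto simp: norm_mult mult_left_le_one_le intro!: sum_mono simp del: index_mult_mat\<close>)
  then show ?thesis by (simp add: trace_norm_diag[OF U AU])
qed

text \<open>Other half of the duality: the maximiser is the sign of A in its eigenbasis, with sign 1
  on the kernel so that it stays unitary.\<close>

lemma trace_norm_attained:
  fixes A :: "complex mat"
  assumes A: "A \<in> carrier_mat d d" "mat_adjoint A = A"
  shows "\<exists>S. unitary_mat d S \<and> trace_norm A = Re (trace_mat (S * A))"
proof -
  obtain U f where U: "unitary_mat d U" and AU: "A = U * mat_diag d (\<lambda>i. of_real (f i)) * mat_adjoint U"
    using hermitian_diagonalization[OF A] by blast
  let ?D = "mat_diag d (\<lambda>i. of_real (f i) :: complex)"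
  let ?s = "\<lambda>i. if f i < 0 then - 1 else 1 :: complex"
  let ?S = "mat_diag d ?s"
  have S: "unitary_mat d ?S"
  proof (rule unitaryI)
    have "mat_adjoint ?S = ?S" by (intro eq_matI) (auto simp: mat_diag_def)
    then show "mat_adjoint ?S * ?S = 1\<^sub>m d"
      by (simp add: mat_diag_diag) (auto simp: mat_diag_def intro!: eq_matI)
  qed auto
  have Uc: "U \<in> carrier_mat d d" and UU: "mat_adjoint U * U = 1\<^sub>m d"
    using U by (auto simp: unitary_mat_def)
  have "(U * ?S * mat_adjoint U) * A = U * ?S * (mat_adjoint U * U) * ?D * mat_adjoint U"
    unfolding AU
    by (simp add: carrier_matD[OF Uc] mult_assoc_dim)
  also have "\<dots> = U * ((?S * ?D) * mat_adjoint U)"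
    by (simp add: carrier_matD[OF Uc] UU mult_assoc_dim)
  also have "trace_mat \<dots> = trace_mat (((?S * ?D) * mat_adjoint U) * U)"
    using Uc by (intro trace_mult_comm[of _ d d]) auto
  also have "((?S * ?D) * mat_adjoint U) * U = (?S * ?D) * (mat_adjoint U * U)"
    by (simp add: carrier_matD[OF Uc] mult_assoc_dim)
  also have "\<dots> = mat_diag d (\<lambda>i. of_real \<bar>f i\<bar>)"
    unfolding UU mat_diag_diag by (subst right_mult_one_mat[of _ d d]) (auto simp: mat_diag_def intro!: eq_matI)
  also have "Re (trace_mat \<dots>) = trace_norm A"
    unfolding trace_norm_diag[OF U AU] by (subst trace_mat_eq[of _ d d]) (auto simp: mat_diag_def)
  finally show ?thesis
    using unitary_mult[OF unitary_mult[OF U S] unitary_adjoint[OF U]] by metis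
qed

section \<open>Matrix sums and the Cauchy-Schwarz inequality\<close>

text \<open>Matrices of all sizes form one type, so a sum over a possibly empty index set needs its
  dimensions as arguments.\<close>

definition msum :: "nat \<Rightarrow> nat \<Rightarrow> ('i \<Rightarrow> complex mat) \<Rightarrow> 'i set \<Rightarrow> complex mat" where
  "msum n m F I = mat n m (\<lambda>(i, j). \<Sum>k\<in>I. F k $$ (i, j))"

lemma msum_carrier [simp]: "msum n m F I \<in> carrier_mat n m"
  and msum_dim [simp]: "dim_row (msum n m F I) = n" "dim_col (msum n m F I) = m"
  by (simp_all add: msum_def)

lemma msum_index: "i < n \<Longrightarrow> j < m \<Longrightarrow> msum n m F I $$ (i, j) = (\<Sum>k\<in>I. F k $$ (i, j))"
  by (simp add: msum_def)

lemma msum_cong: "(\<And>k. k \<in> I \<Longrightarrow> F k = G k) \<Longrightarrow> msum n m F I = msum n m G I"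
  by (simp add: msum_def)

lemma msum_empty: "msum n m F {} = 0\<^sub>m n m"
  by (intro eq_matI) (auto simp: msum_def)

lemma msum_insert:
  assumes "finite I" "k \<notin> I" "F k \<in> carrier_mat n m"
  shows "msum n m F (insert k I) = F k + msum n m F I"
  using assms by (intro eq_matI) (auto simp: msum_def)

lemma trace_msum:
  assumes "\<And>k. k \<in> I \<Longrightarrow> F k \<in> carrier_mat n n"
  shows "trace_mat (msum n n F I) = (\<Sum>k\<in>I. trace_mat (F k))"
proof -
  have "trace_mat (msum n n F I) = (\<Sum>k\<in>I. \<Sum>i<n. F k $$ (i, i))"
    by (subst sum.swap) (simp add: trace_mat_def msum_index)
  also have "\<dots> = (\<Sum>k\<in>I. trace_mat (F k))"
    using assms by (intro sum.cong refl) (metis trace_mat_eq)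
  finally show ?thesis .
qed

lemma mult_msum:
  assumes A: "A \<in> carrier_mat l n" and F: "\<And>k. k \<in> I \<Longrightarrow> F k \<in> carrier_mat n m"
  shows "A * msum n m F I = msum l m (\<lambda>k. A * F k) I"
proof (rule eq_matI)
  fix i j assume "i < dim_row (msum l m (\<lambda>k. A * F k) I)" "j < dim_col (msum l m (\<lambda>k. A * F k) I)"
  then have ij: "i < l" "j < m" by auto
  have "(A * msum n m F I) $$ (i, j) = (\<Sum>r<n. \<Sum>k\<in>I. A $$ (i, r) * F k $$ (r, j))"
    using ij by (simp add: mult_index[OF A msum_carrier] msum_index sum_distrib_left del: index_mult_mat(1))
  also have "\<dots> = (\<Sum>k\<in>I. \<Sum>r<n. A $$ (i, r) * F k $$ (r, j))" by (rule sum.swap)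
  also have "\<dots> = msum l m (\<lambda>k. A * F k) I $$ (i, j)"
    using ij mult_index[OF A F] by (simp add: msum_index del: index_mult_mat(1))
  finally show "(A * msum n m F I) $$ (i, j) = msum l m (\<lambda>k. A * F k) I $$ (i, j)" .
qed (use A in auto)

lemma msum_mult:
  assumes A: "A \<in> carrier_mat m l" and F: "\<And>k. k \<in> I \<Longrightarrow> F k \<in> carrier_mat n m"
  shows "msum n m F I * A = msum n l (\<lambda>k. F k * A) I"
proof (rule eq_matI)
  fix i j assume "i < dim_row (msum n l (\<lambda>k. F k * A) I)" "j < dim_col (msum n l (\<lambda>k. F k * A) I)"
  then have ij: "i < n" "j < l" by auto
  have "(msum n m F I * A) $$ (i, j) = (\<Sum>r<m. \<Sum>k\<in>I. F k $$ (i, r) * A $$ (r, j))"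
    using ij by (simp add: mult_index[OF msum_carrier A] msum_index sum_distrib_right del: index_mult_mat(1))
  also have "\<dots> = (\<Sum>k\<in>I. \<Sum>r<m. F k $$ (i, r) * A $$ (r, j))" by (rule sum.swap)
  also have "\<dots> = msum n l (\<lambda>k. F k * A) I $$ (i, j)"
    using ij mult_index[OF F A] by (simp add: msum_index del: index_mult_mat(1))
  finally show "(msum n m F I * A) $$ (i, j) = msum n l (\<lambda>k. F k * A) I $$ (i, j)" .
qed (use A in auto)

lemma psd_msum:
  assumes "finite I" "\<And>k. k \<in> I \<Longrightarrow> psd_mat d (F k)"
  shows "psd_mat d (msum d d F I)"
  using assms by (induction I rule: finite_induct) (auto simp: msum_empty msum_insert psd_matD psd_zero psd_add)

text \<open>In an eigenbasis of E the trace is a sum of eigenvalues of E times diagonal entries of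
  the rotated R, all nonnegative. This makes the Born weights nonnegative.\<close>

lemma trace_psd_mult:
  assumes E: "psd_mat d E" and R: "psd_mat d R"
  shows "0 \<le> Re (trace_mat (E * R))"
proof -
  note Ec = psd_matD(1)[OF E] note Rc = psd_matD(1)[OF R]
  obtain U f where U: "unitary_mat d U" and EU: "E = U * mat_diag d (\<lambda>i. of_real (f i)) * mat_adjoint U"
    using hermitian_diagonalization[OF psd_matD[OF E]] by blast
  let ?D = "mat_diag d (\<lambda>i. of_real (f i) :: complex)"
  have Uc: "U \<in> carrier_mat d d" and UU: "mat_adjoint U * U = 1\<^sub>m d"
    using U by (auto simp: unitary_mat_def)
  note Ua = adjoint_carrier[OF Uc] and D = mat_diag_dim[of d "\<lambda>i. of_real (f i) :: complex"]
  note dims = carrier_matD[OF Uc] carrier_matD[OF Rc]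
  have "mat_adjoint U * E * U = (mat_adjoint U * U) * ?D * (mat_adjoint U * U)"
    unfolding EU by (simp add: dims mult_assoc_dim)
  also have "\<dots> = ?D" unfolding UU by simp
  finally have "psd_mat d ?D" using psd_conj[OF E Ua] by simp
  from psd_diag(1)[OF this] have f: "0 \<le> f i" if "i < d" for i
    using that by (simp add: mat_diag_def)
  have R': "psd_mat d (mat_adjoint U * R * U)" using psd_conj[OF R Ua] by simp
  have "trace_mat (E * R) = trace_mat (U * (?D * (mat_adjoint U * R)))"
    unfolding EU by (simp add: dims mult_assoc_dim)
  also have "\<dots> = trace_mat ((?D * (mat_adjoint U * R)) * U)"
    by (rule trace_mult_comm[OF Uc mult_carrier_mat[OF D mult_carrier_mat[OF Ua Rc]]])
  also have "\<dots> = trace_mat (?D * (mat_adjoint U * R * U))" by (simp add: dims mult_assoc_dim)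
  also have "\<dots> = (\<Sum>i<d. of_real (f i) * (mat_adjoint U * R * U) $$ (i, i))"
    using psd_matD(1)[OF R'] by (simp add: trace_mat_def mat_diag_mult_left del: index_mult_mat(1))
  finally show ?thesis
    using f psd_diag(1)[OF R'] by (auto intro!: sum_nonneg simp del: index_mult_mat)
qed

text \<open>Discriminant argument in the shape delivered by \<open>trace_cauchy_schwarz\<close>,
  where r is the modulus of the mixed trace. For b > 0 the minimiser s = 1 / b gives the
  bound.\<close>

lemma le_sqrt_mult_if_quadratic_nonneg:
  fixes a b r :: real
  assumes q: "\<And>s. 0 \<le> a - 2 * s * r\<^sup>2 + s\<^sup>2 * r\<^sup>2 * b" and "0 \<le> a" "0 \<le> b" "0 \<le> r"
  shows "r \<le> sqrt (a * b)"
proof (cases "b = 0")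
  case True
  have "r = 0"
  proof (rule ccontr)
    assume "r \<noteq> 0"
    \<comment> \<open>For b = 0 the expression is affine in s; at this s it equals - a - 2, which is
      negative.\<close>
    then show False using q[of "(a + 1) / r\<^sup>2"] True \<open>0 \<le> a\<close> by simp
  qed
  then show ?thesis using assms by simp
next
  case False
  then have b: "0 < b" using assms by simp
  have "0 \<le> a - r\<^sup>2 / b" using q[of "1 / b"] b by (simp add: power2_eq_square field_simps)
  then have "r\<^sup>2 \<le> a * b" using b by (simp add: field_simps)
  then show ?thesis using \<open>0 \<le> r\<close> real_le_rsqrt by blast
qed

lemma smult_smult_mat: "a \<cdot>\<^sub>m (b \<cdot>\<^sub>m A) = (a * b) \<cdot>\<^sub>m (A :: complex mat)"
  by (intro eq_matI) auto

text \<open>The map (X, Y) to tr (X R Y^\<dagger>) is a positive semidefinite sesquilinear form,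
  because X R X^\<dagger> is positive semidefinite; this is its Cauchy-Schwarz inequality.\<close>

lemma trace_cauchy_schwarz:
  assumes R: "psd_mat d R" and X: "X \<in> carrier_mat m d" and Y: "Y \<in> carrier_mat m d"
  shows "cmod (trace_mat (X * R * mat_adjoint Y)) \<le>
    sqrt (Re (trace_mat (X * R * mat_adjoint X)) * Re (trace_mat (Y * R * mat_adjoint Y)))"
proof (rule le_sqrt_mult_if_quadratic_nonneg)
  note Rc = psd_matD(1)[OF R]
  let ?z = "trace_mat (X * R * mat_adjoint Y)"
  have c: "A * R * mat_adjoint B \<in> carrier_mat m m" if "A \<in> carrier_mat m d" "B \<in> carrier_mat m d" for A B
    by (rule mult_carrier_mat[OF mult_carrier_mat[OF that(1) Rc] adjoint_carrier[OF that(2)]])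
  note cs = c[OF X X] c[OF X Y] c[OF Y X] c[OF Y Y]
  note dims = carrier_matD[OF X] carrier_matD[OF Y]
    carrier_matD[OF Rc]
  have "trace_mat (mat_adjoint (X * R * mat_adjoint Y)) = cnj ?z"
    by (rule trace_adjoint[OF cs(2)])
  moreover have "mat_adjoint (X * R * mat_adjoint Y) = Y * R * mat_adjoint X"
    by (simp add: dims adjoint_mult' psd_matD(2)[OF R] mult_assoc_dim)
  ultimately have z': "trace_mat (Y * R * mat_adjoint X) = cnj ?z" by simp
  fix s :: real
  \<comment> \<open>Giving c the phase of the mixed trace makes both cross terms the same real
    number, so a real parameter s suffices.\<close>
  define c where "c = of_real s * ?z"
  have zz: "of_real ((cmod ?z)\<^sup>2) = ?z * cnj ?z" by (rule complex_norm_square)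
  have cY: "c \<cdot>\<^sub>m Y \<in> carrier_mat m d" using Y by simp
  have XY: "X - c \<cdot>\<^sub>m Y \<in> carrier_mat m d" by (rule minus_carrier_mat[OF cY])
  have "(X - c \<cdot>\<^sub>m Y) * R * mat_adjoint (X - c \<cdot>\<^sub>m Y) =
     (X * R - c \<cdot>\<^sub>m (Y * R)) * (mat_adjoint X - cnj c \<cdot>\<^sub>m mat_adjoint Y)"
    using minus_mult_distrib_mat[OF X cY Rc] Y Rc by (simp add: adjoint_minus[OF X cY] adjoint_smult mult_smult_assoc_mat[OF Y Rc])
  also have "\<dots> = X * R * mat_adjoint X - cnj c \<cdot>\<^sub>m (X * R * mat_adjoint Y)
      - (c \<cdot>\<^sub>m (Y * R * mat_adjoint X) - (c * cnj c) \<cdot>\<^sub>m (Y * R * mat_adjoint Y))"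
  proof -
    note XR = mult_carrier_mat[OF X Rc] note YR = mult_carrier_mat[OF Y Rc]
    note Xa = adjoint_carrier[OF X] note Ya = adjoint_carrier[OF Y]
    have s: "c \<cdot>\<^sub>m (Y * R) \<in> carrier_mat m d" "cnj c \<cdot>\<^sub>m mat_adjoint Y \<in> carrier_mat d m"
      using YR Ya by auto
    have d: "mat_adjoint X - cnj c \<cdot>\<^sub>m mat_adjoint Y \<in> carrier_mat d m" by (rule minus_carrier_mat[OF s(2)])
    show ?thesis
      unfolding minus_mult_distrib_mat[OF XR s(1) d] mult_minus_distrib_mat[OF XR Xa s(2)]
        mult_minus_distrib_mat[OF s(1) Xa s(2)] mult_smult_distrib[OF XR Ya] mult_smult_distrib[OF s(1) Ya]
        mult_smult_assoc_mat[OF YR Xa] mult_smult_assoc_mat[OF YR Ya]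
      by (simp add: smult_smult_mat mult.commute)
  qed
  finally have "trace_mat ((X - c \<cdot>\<^sub>m Y) * R * mat_adjoint (X - c \<cdot>\<^sub>m Y)) =
     trace_mat (X * R * mat_adjoint X) - cnj c * ?z - (c * cnj ?z - c * cnj c * trace_mat (Y * R * mat_adjoint Y))"
    using cs z' by (simp add: trace_minus[of _ m] trace_smult[of _ m] minus_carrier_mat[of _ m m])
  also have "cnj c * ?z = of_real (s * (cmod ?z)\<^sup>2)" using zz by (simp add: c_def mult_ac del: of_real_power)
  also have "c * cnj ?z = of_real (s * (cmod ?z)\<^sup>2)" using zz by (simp add: c_def mult_ac del: of_real_power)
  also have "c * cnj c = of_real (s\<^sup>2 * (cmod ?z)\<^sup>2)"
    using zz by (simp add: c_def mult_ac power2_eq_square[of s] del: of_real_power)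
  finally have "Re (trace_mat ((X - c \<cdot>\<^sub>m Y) * R * mat_adjoint (X - c \<cdot>\<^sub>m Y))) =
    Re (trace_mat (X * R * mat_adjoint X)) - 2 * s * (cmod ?z)\<^sup>2
      + s\<^sup>2 * (cmod ?z)\<^sup>2 * Re (trace_mat (Y * R * mat_adjoint Y))"
    by (simp del: of_real_mult of_real_power)
  with psd_trace(1)[OF psd_conj[OF R XY]]
  show "0 \<le> Re (trace_mat (X * R * mat_adjoint X)) - 2 * s * (cmod ?z)\<^sup>2
      + s\<^sup>2 * (cmod ?z)\<^sup>2 * Re (trace_mat (Y * R * mat_adjoint Y))" by simp
next
  show "0 \<le> Re (trace_mat (X * R * mat_adjoint X))" by (rule psd_trace(1)[OF psd_conj[OF R X]])
  show "0 \<le> Re (trace_mat (Y * R * mat_adjoint Y))" by (rule psd_trace(1)[OF psd_conj[OF R Y]])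
qed simp

text \<open>Cauchy-Schwarz with X = S and Y = 1, where both factors under the root equal tr
  K.\<close>

lemma trace_unitary_psd:
  assumes S: "unitary_mat d S" and K: "psd_mat d K"
  shows "cmod (trace_mat (S * K)) \<le> Re (trace_mat K)"
proof -
  have Sc: "S \<in> carrier_mat d d" and SS: "mat_adjoint S * S = 1\<^sub>m d" using S by (auto simp: unitary_mat_def)
  note Kc = psd_matD(1)[OF K] note Sa = adjoint_carrier[OF Sc]
  have "trace_mat (S * K * mat_adjoint S) = trace_mat (mat_adjoint S * (S * K))"
    by (rule trace_mult_comm[OF mult_carrier_mat[OF Sc Kc] Sa])
  also have "mat_adjoint S * (S * K) = K"
    unfolding assoc_mult_mat[OF Sa Sc Kc, symmetric] SS using Kc by simp
  finally have "trace_mat (S * K * mat_adjoint S) = trace_mat K" .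
  moreover have "1\<^sub>m d * K * mat_adjoint (1\<^sub>m d) = K" "S * K * mat_adjoint (1\<^sub>m d) = S * K"
    using Kc Sc by (simp_all add: right_mult_one_mat[OF mult_carrier_mat[OF Sc Kc]])
  ultimately show ?thesis
    using trace_cauchy_schwarz[OF K Sc one_carrier_mat] psd_trace(1)[OF K] by simp
qed

section \<open>Kronecker products and Majorana operators\<close>

lemma kron_dim [simp]: "dim_row (A \<otimes>\<^sub>m B) = dim_row A * dim_row B" "dim_col (A \<otimes>\<^sub>m B) = dim_col A * dim_col B"
  by (simp_all add: kron_mat_def)

lemma kron_carrier:
  assumes "A \<in> carrier_mat n m" "B \<in> carrier_mat k l"
  shows "A \<otimes>\<^sub>m B \<in> carrier_mat (n * k) (m * l)"
  by (rule carrier_matI) (simp_all add: assms[THEN carrier_matD(1)] assms[THEN carrier_matD(2)])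

lemma kron_index:
  "i < dim_row A * dim_row B \<Longrightarrow> j < dim_col A * dim_col B \<Longrightarrow>
   (A \<otimes>\<^sub>m B) $$ (i, j) = A $$ (i div dim_row B, j div dim_col B) * B $$ (i mod dim_row B, j mod dim_col B)"
  by (simp add: kron_mat_def)

lemma sum_mult_split:
  fixes f :: "nat \<Rightarrow> 'a :: comm_monoid_add"
  shows "(\<Sum>l<a * b. f l) = (\<Sum>x<a. \<Sum>y<b. f (x * b + y))"
proof -
  have "(\<Sum>l<a * b. f l) = (\<Sum>x<a. sum f {x * b..<x * b + b})"
    by (simp add: sum.nat_group)
  also have "\<dots> = (\<Sum>x<a. \<Sum>y<b. f (x * b + y))"
  proof (rule sum.cong[OF refl])
    fix x
    show "sum f {x * b..<x * b + b} = (\<Sum>y<b. f (x * b + y))"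
      using sum.shift_bounds_nat_ivl[of f 0 "x * b" b] by (simp add: lessThan_atLeast0 add.commute)
  qed
  finally show ?thesis .
qed

lemma div_less_of_less_mult: "i < a * b \<Longrightarrow> i div b < (a :: nat)"
  by (rule less_mult_imp_div_less)

lemma mod_less_of_less_mult: "i < a * b \<Longrightarrow> i mod b < (b :: nat)"
  by (metis gr0I less_zeroE mod_less_divisor mult_0_right)

lemma kron_mult:
  assumes A: "A \<in> carrier_mat n1 m1" and B: "B \<in> carrier_mat n2 m2"
    and C: "C \<in> carrier_mat m1 k1" and D: "D \<in> carrier_mat m2 k2"
  shows "(A \<otimes>\<^sub>m B) * (C \<otimes>\<^sub>m D) = (A * C) \<otimes>\<^sub>m (B * D)"
proof (rule eq_matI)
  note dims = carrier_matD[OF A] carrier_matD[OF B]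
    carrier_matD[OF C] carrier_matD[OF D]
  fix i j assume "i < dim_row ((A * C) \<otimes>\<^sub>m (B * D))" "j < dim_col ((A * C) \<otimes>\<^sub>m (B * D))"
  then have ij: "i < n1 * n2" "j < k1 * k2" by (simp_all add: dims)
  note ij' = div_less_of_less_mult[OF ij(1)] mod_less_of_less_mult[OF ij(1)]
    div_less_of_less_mult[OF ij(2)] mod_less_of_less_mult[OF ij(2)]
  have lt: "x * m2 + y < m1 * m2" if "x < m1" "y < m2" for x y
  proof -
    have "x * m2 + y < Suc x * m2" using that by simp
    also have "\<dots> \<le> m1 * m2" using that by (intro mult_le_mono1) simp
    finally show ?thesis .
  qed
  have "((A \<otimes>\<^sub>m B) * (C \<otimes>\<^sub>m D)) $$ (i, j) = (\<Sum>l<m1 * m2. (A \<otimes>\<^sub>m B) $$ (i, l) * (C \<otimes>\<^sub>m D) $$ (l, j))"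
    by (rule mult_index[OF kron_carrier[OF A B] kron_carrier[OF C D] ij])
  also have "\<dots> = (\<Sum>x<m1. \<Sum>y<m2. (A \<otimes>\<^sub>m B) $$ (i, x * m2 + y) * (C \<otimes>\<^sub>m D) $$ (x * m2 + y, j))"
    by (rule sum_mult_split)
  also have "\<dots> = (\<Sum>x<m1. \<Sum>y<m2. (A $$ (i div n2, x) * C $$ (x, j div k2)) * (B $$ (i mod n2, y) * D $$ (y, j mod k2)))"
    using ij lt by (intro sum.cong refl) (simp add: kron_index dims mult_ac)
  also have "\<dots> = (\<Sum>x<m1. A $$ (i div n2, x) * C $$ (x, j div k2)) * (\<Sum>y<m2. B $$ (i mod n2, y) * D $$ (y, j mod k2))"
    by (simp add: sum_product)
  also have "\<dots> = (A * C) $$ (i div n2, j div k2) * (B * D) $$ (i mod n2, j mod k2)"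
    using ij' by (simp add: mult_index[OF A C] mult_index[OF B D] del: index_mult_mat(1))
  also have "\<dots> = ((A * C) \<otimes>\<^sub>m (B * D)) $$ (i, j)"
    using ij by (simp add: kron_index dims del: index_mult_mat(1))
  finally show "((A \<otimes>\<^sub>m B) * (C \<otimes>\<^sub>m D)) $$ (i, j) = ((A * C) \<otimes>\<^sub>m (B * D)) $$ (i, j)" .
qed simp_all

lemma kron_adjoint: "mat_adjoint (A \<otimes>\<^sub>m B) = mat_adjoint A \<otimes>\<^sub>m mat_adjoint B"
proof (rule eq_matI)
  fix i j assume "i < dim_row (mat_adjoint A \<otimes>\<^sub>m mat_adjoint B)" "j < dim_col (mat_adjoint A \<otimes>\<^sub>m mat_adjoint B)"
  then have ij: "i < dim_col A * dim_col B" "j < dim_row A * dim_row B" by simp_all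
  note ij' = div_less_of_less_mult[OF ij(1)] mod_less_of_less_mult[OF ij(1)]
    div_less_of_less_mult[OF ij(2)] mod_less_of_less_mult[OF ij(2)]
  show "mat_adjoint (A \<otimes>\<^sub>m B) $$ (i, j) = (mat_adjoint A \<otimes>\<^sub>m mat_adjoint B) $$ (i, j)"
    using ij ij' by (simp add: kron_index)
qed simp_all

lemma kron_one: "1\<^sub>m n \<otimes>\<^sub>m 1\<^sub>m k = 1\<^sub>m (n * k)"
proof (rule eq_matI)
  fix i j assume "i < dim_row (1\<^sub>m (n * k) :: complex mat)" "j < dim_col (1\<^sub>m (n * k) :: complex mat)"
  then have ij: "i < n * k" "j < n * k" by auto
  note ij' = div_less_of_less_mult[OF ij(1)] mod_less_of_less_mult[OF ij(1)]
    div_less_of_less_mult[OF ij(2)] mod_less_of_less_mult[OF ij(2)]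
  have "i = j" if "i div k = j div k" "i mod k = j mod k" using that by (metis div_mult_mod_eq)
  then show "(1\<^sub>m n \<otimes>\<^sub>m 1\<^sub>m k) $$ (i, j) = (1\<^sub>m (n * k) :: complex mat) $$ (i, j)"
    using ij ij' by (auto simp: kron_index)
qed simp_all

lemma kron_smult_left: "(c \<cdot>\<^sub>m A) \<otimes>\<^sub>m B = c \<cdot>\<^sub>m (A \<otimes>\<^sub>m B)"
  and kron_smult_right: "A \<otimes>\<^sub>m (c \<cdot>\<^sub>m B) = c \<cdot>\<^sub>m (A \<otimes>\<^sub>m B)"
proof -
  have "((c \<cdot>\<^sub>m A) \<otimes>\<^sub>m B) $$ (i, j) = (c \<cdot>\<^sub>m (A \<otimes>\<^sub>m B)) $$ (i, j)"
    "(A \<otimes>\<^sub>m (c \<cdot>\<^sub>m B)) $$ (i, j) = (c \<cdot>\<^sub>m (A \<otimes>\<^sub>m B)) $$ (i, j)"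
    if ij: "i < dim_row A * dim_row B" "j < dim_col A * dim_col B" for i j
    using ij div_less_of_less_mult[OF ij(1)] mod_less_of_less_mult[OF ij(1)]
      div_less_of_less_mult[OF ij(2)] mod_less_of_less_mult[OF ij(2)] by (simp_all add: kron_index)
  then show "(c \<cdot>\<^sub>m A) \<otimes>\<^sub>m B = c \<cdot>\<^sub>m (A \<otimes>\<^sub>m B)" "A \<otimes>\<^sub>m (c \<cdot>\<^sub>m B) = c \<cdot>\<^sub>m (A \<otimes>\<^sub>m B)"
    by (intro eq_matI; simp)+
qed

section \<open>Operators on one qubit and Jordan-Wigner strings\<close>

lemma qubit_dim: "1 \<le> k \<Longrightarrow> k \<le> n \<Longrightarrow> 2 ^ (k - Suc 0) * (2 * 2 ^ (n - k)) = (2 ^ n :: nat)"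
proof -
  assume "1 \<le> k" "k \<le> n"
  then have "n = k - Suc 0 + Suc (n - k)" by simp
  then have "(2 :: nat) ^ n = 2 ^ (k - Suc 0 + Suc (n - k))" by (rule arg_cong)
  then show ?thesis by (simp add: power_add)
qed

lemma on_qubit_carrier:
  assumes "1 \<le> k" "k \<le> n" "P \<in> carrier_mat 2 2"
  shows "on_qubit n k P \<in> carrier_mat (2 ^ n) (2 ^ n)"
  using kron_carrier[OF one_carrier_mat kron_carrier[OF assms(3) one_carrier_mat], of "2 ^ (k - 1)" "2 ^ (n - k)"]
  by (simp add: on_qubit_def qubit_dim[OF assms(1,2)])

lemma on_qubit_mult:
  assumes P: "P \<in> carrier_mat 2 2" and R: "R \<in> carrier_mat 2 2"
  shows "on_qubit n k P * on_qubit n k R = on_qubit n k (P * R)"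
  unfolding on_qubit_def
  by (simp add: kron_mult[OF one_carrier_mat kron_carrier[OF P one_carrier_mat] one_carrier_mat kron_carrier[OF R one_carrier_mat]]
    kron_mult[OF P one_carrier_mat R one_carrier_mat])

lemma on_qubit_unitary:
  assumes "1 \<le> k" "k \<le> n" and P: "unitary_mat 2 P"
  shows "unitary_mat (2 ^ n) (on_qubit n k P)"
proof (rule unitaryI)
  have Pc: "P \<in> carrier_mat 2 2" and PP: "mat_adjoint P * P = 1\<^sub>m 2" using P by (auto simp: unitary_mat_def)
  show "on_qubit n k P \<in> carrier_mat (2 ^ n) (2 ^ n)" by (rule on_qubit_carrier[OF assms(1,2) Pc])
  have "mat_adjoint (on_qubit n k P) = on_qubit n k (mat_adjoint P)"
    by (simp add: on_qubit_def kron_adjoint)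
  then show "mat_adjoint (on_qubit n k P) * on_qubit n k P = 1\<^sub>m (2 ^ n)"
    unfolding on_qubit_mult[OF adjoint_carrier[OF Pc] Pc, symmetric] 
    by (simp add: on_qubit_mult[OF adjoint_carrier[OF Pc] Pc] PP)
       (simp add: on_qubit_def kron_one qubit_dim[OF assms(1,2)])
qed

lemma on_qubit_smult: "on_qubit n k (c \<cdot>\<^sub>m P) = c \<cdot>\<^sub>m on_qubit n k P"
  by (simp add: on_qubit_def kron_smult_left kron_smult_right)

text \<open>Qubit 1 is the leftmost factor, so qubit k is the bit of weight 2^(n - k) of a basis
  index. All other bits of row and column must agree: those above are compared by
  \<open>div\<close>, those below by \<open>mod\<close>.\<close>

lemma on_qubit_index:
  assumes k: "1 \<le> k" "k \<le> n" and P: "P \<in> carrier_mat 2 2" and ij: "i < 2 ^ n" "j < 2 ^ n"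
  shows "on_qubit n k P $$ (i, j) =
    (if i div 2 ^ Suc (n - k) = j div 2 ^ Suc (n - k) \<and> i mod 2 ^ (n - k) = j mod 2 ^ (n - k)
     then P $$ (i div 2 ^ (n - k) mod 2, j div 2 ^ (n - k) mod 2) else 0)"
proof -
  let ?m = "2 ^ (n - k) :: nat"
  note d = carrier_matD[OF P]
  have ij': "i < 2 ^ (k - 1) * (2 * ?m)" "j < 2 ^ (k - 1) * (2 * ?m)"
    using ij by (simp_all add: qubit_dim[OF k])
  have e: "x mod (2 * ?m) div ?m = x div ?m mod 2" "x mod (2 * ?m) mod ?m = x mod ?m" for x
    by (simp_all add: mod_mult2_eq[of x ?m 2] mult.commute[of 2 ?m])
  have lt: "x mod (2 * ?m) < 2 * ?m" for x by (rule mod_less_divisor) simp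
  show ?thesis
    using ij' div_less_of_less_mult[OF ij'(1)] div_less_of_less_mult[OF ij'(2)]
    by (simp add: on_qubit_def kron_index d e lt)
qed

text \<open>Eigenvalue of Z_k on the basis vector i: the bit of qubit k decides the sign.\<close>

definition z_sign :: "nat \<Rightarrow> nat \<Rightarrow> nat \<Rightarrow> complex" where
  "z_sign n k i = (if even (i div 2 ^ (n - k)) then 1 else - 1)"

lemma pauli_carrier [simp]: "pauli_X \<in> carrier_mat 2 2" "pauli_Y \<in> carrier_mat 2 2" "pauli_Z \<in> carrier_mat 2 2"
  by (simp_all add: pauli_X_def pauli_Y_def pauli_Z_def mat_of_rows_list_def numeral_2_eq_2)

lemma mat2_eqI:
  assumes "A \<in> carrier_mat 2 2" "B \<in> carrier_mat 2 2" "A $$ (0, 0) = B $$ (0, 0)" "A $$ (0, 1) = B $$ (0, 1)"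
    "A $$ (1, 0) = B $$ (1, 0)" "A $$ (1, 1) = B $$ (1, 1)"
  shows "A = B"
proof (rule eq_matI)
  fix i j assume "i < dim_row B" "j < dim_col B"
  then have "i = 0 \<or> i = 1" "j = 0 \<or> j = 1" using assms(2) by auto
  then show "A $$ (i, j) = B $$ (i, j)" using assms by auto
qed (use assms in auto)

lemma mult2_index:
  fixes A :: "complex mat"
  assumes "A \<in> carrier_mat 2 2" "B \<in> carrier_mat 2 2" "i < 2" "j < 2"
  shows "(A * B) $$ (i, j) = A $$ (i, 0) * B $$ (0, j) + A $$ (i, 1) * B $$ (1, j)"
  unfolding mult_index[OF assms] by (simp add: numeral_2_eq_2)

lemma pauli_index:
  "pauli_X $$ (0, 0) = 0" "pauli_X $$ (0, 1) = 1" "pauli_X $$ (1, 0) = 1" "pauli_X $$ (1, 1) = 0"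
  "pauli_Y $$ (0, 0) = 0" "pauli_Y $$ (0, 1) = - \<i>" "pauli_Y $$ (1, 0) = \<i>" "pauli_Y $$ (1, 1) = 0"
  "pauli_Z $$ (0, 0) = 1" "pauli_Z $$ (0, 1) = 0" "pauli_Z $$ (1, 0) = 0" "pauli_Z $$ (1, 1) = - 1"
  by (simp_all add: pauli_X_def pauli_Y_def pauli_Z_def mat_of_rows_list_def)

lemma pauli_adjoint: "mat_adjoint pauli_X = pauli_X" "mat_adjoint pauli_Y = pauli_Y"
proof -
  have dims: "dim_row pauli_X = 2" "dim_col pauli_X = 2" "dim_row pauli_Y = 2" "dim_col pauli_Y = 2"
    using carrier_matD[OF pauli_carrier(1)]
      carrier_matD[OF pauli_carrier(2)] by auto
  show "mat_adjoint pauli_X = pauli_X"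
    by (rule mat2_eqI) (simp_all add: dims pauli_index del: One_nat_def)
  show "mat_adjoint pauli_Y = pauli_Y"
    by (rule mat2_eqI) (simp_all add: dims pauli_index del: One_nat_def)
qed

lemma pauli_mult: "pauli_X * pauli_X = 1\<^sub>m 2" "pauli_Y * pauli_Y = 1\<^sub>m 2" "pauli_X * pauli_Y = \<i> \<cdot>\<^sub>m pauli_Z"
proof -
  have dims: "dim_row pauli_Z = 2" "dim_col pauli_Z = 2"
    using carrier_matD[OF pauli_carrier(3)] by auto
  show "pauli_X * pauli_X = 1\<^sub>m 2"
    by (rule mat2_eqI[OF mult_carrier_mat[OF pauli_carrier(1) pauli_carrier(1)]])
      (simp_all add: mult2_index pauli_index del: index_mult_mat(1) One_nat_def)
  show "pauli_Y * pauli_Y = 1\<^sub>m 2"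
    by (rule mat2_eqI[OF mult_carrier_mat[OF pauli_carrier(2) pauli_carrier(2)]])
      (simp_all add: mult2_index pauli_index del: index_mult_mat(1) One_nat_def)
  show "pauli_X * pauli_Y = \<i> \<cdot>\<^sub>m pauli_Z"
    by (rule mat2_eqI[OF mult_carrier_mat[OF pauli_carrier(1) pauli_carrier(2)]])
      (simp_all add: mult2_index pauli_index dims del: index_mult_mat(1) One_nat_def)
qed

lemma pauli_unitary: "unitary_mat 2 pauli_X" "unitary_mat 2 pauli_Y"
  by (simp_all add: unitary_mat_def pauli_adjoint pauli_mult)

lemma on_qubit_Z:
  assumes "1 \<le> k" "k \<le> n"
  shows "on_qubit n k pauli_Z = mat_diag (2 ^ n) (z_sign n k)"
proof (rule eq_matI)
  fix i j assume "i < dim_row (mat_diag (2 ^ n) (z_sign n k))" "j < dim_col (mat_diag (2 ^ n) (z_sign n k))"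
  then have ij: "i < 2 ^ n" "j < 2 ^ n" by auto
  let ?m = "2 ^ (n - k) :: nat"
  have Z: "pauli_Z $$ (a, b) = (if a = b then if a = 0 then 1 else - 1 else 0)" if "a < 2" "b < 2" for a b
    using that by (auto simp: pauli_index[unfolded One_nat_def] numeral_2_eq_2 less_Suc_eq)
  have div: "x div (2 * ?m) = x div ?m div 2" for x
    by (simp add: div_mult2_eq mult.commute[of 2])
  have eq: "i div (2 * ?m) = j div (2 * ?m) \<and> i mod ?m = j mod ?m \<and> i div ?m mod 2 = j div ?m mod 2 \<longleftrightarrow> i = j"
    unfolding div by (metis div_mult_mod_eq)
  show "on_qubit n k pauli_Z $$ (i, j) = mat_diag (2 ^ n) (z_sign n k) $$ (i, j)"
  proof (cases "i = j")
    case True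
    then show ?thesis
      using ij unfolding on_qubit_index[OF assms pauli_carrier(3) ij]
      by (simp add: Z z_sign_def mat_diag_def) presburger
  next
    case False
    with eq have "\<not> (i div 2 ^ Suc (n - k) = j div 2 ^ Suc (n - k) \<and> i mod ?m = j mod ?m
      \<and> i div ?m mod 2 = j div ?m mod 2)" by simp
    then have "on_qubit n k pauli_Z $$ (i, j) = 0"
      unfolding on_qubit_index[OF assms pauli_carrier(3) ij] by (subst Z) auto
    then show ?thesis using False ij by (simp add: mat_diag_def)
  qed
qed (use on_qubit_carrier[OF assms pauli_carrier(3)] in auto)

text \<open>The Z factors are diagonal, so the string collapses to one diagonal matrix of sign
  products; its square and its interplay with a flip of qubit k can be read off these signs.\<close>

lemma jordan_wigner_string:
  assumes "set js \<subseteq> {1..n}" "M \<in> carrier_mat (2 ^ n) (2 ^ n)"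
  shows "foldr (\<lambda>j B. on_qubit n j pauli_Z * B) js M = mat_diag (2 ^ n) (\<lambda>i. \<Prod>j\<leftarrow>js. z_sign n j i) * M"
  using assms(1)
proof (induction js)
  case (Cons j js)
  then have j: "on_qubit n j pauli_Z = mat_diag (2 ^ n) (z_sign n j)" by (intro on_qubit_Z) auto
  show ?case
    using Cons by (simp add: j assoc_mult_mat[OF mat_diag_dim mat_diag_dim assms(2), symmetric])
qed (use assms(2) in auto)

lemma z_sign_square: "z_sign n k i * z_sign n k i = 1" and z_sign_real: "cnj (z_sign n k i) = z_sign n k i"
  by (simp_all add: z_sign_def)

lemma prod_list_z_sign_square: "(\<Prod>j\<leftarrow>js. z_sign n j i) * (\<Prod>j\<leftarrow>js. z_sign n j i) = 1"
proof (induction js)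
  case (Cons k js)
  have "(\<Prod>j\<leftarrow>k # js. z_sign n j i) * (\<Prod>j\<leftarrow>k # js. z_sign n j i) =
      (z_sign n k i * z_sign n k i) * ((\<Prod>j\<leftarrow>js. z_sign n j i) * (\<Prod>j\<leftarrow>js. z_sign n j i))"
    by (simp only: list.map prod_list.Cons mult_ac)
  then show ?case by (simp only: Cons z_sign_square mult_1)
qed simp

lemma prod_list_z_sign_real: "cnj (\<Prod>j\<leftarrow>js. z_sign n j i) = (\<Prod>j\<leftarrow>js. z_sign n j i)"
  by (induction js) (simp_all add: z_sign_real)

lemma majorana_eq:
  assumes k: "1 \<le> k" "k \<le> n"
  shows "majorana n (2 * k - 1) = mat_diag (2 ^ n) (\<lambda>i. \<Prod>j\<leftarrow>[1..<k]. z_sign n j i) * on_qubit n k pauli_X"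
    "majorana n (2 * k) = mat_diag (2 ^ n) (\<lambda>i. \<Prod>j\<leftarrow>[1..<k]. z_sign n j i) * on_qubit n k pauli_Y"
proof -
  have s: "set [1..<k] \<subseteq> {1..n}" using k by auto
  have "(2 * k - 1 + 1) div 2 = k" "(2 * k + 1) div 2 = k" "odd (2 * k - 1)" using k by auto
  then show "majorana n (2 * k - 1) = mat_diag (2 ^ n) (\<lambda>i. \<Prod>j\<leftarrow>[1..<k]. z_sign n j i) * on_qubit n k pauli_X"
    "majorana n (2 * k) = mat_diag (2 ^ n) (\<lambda>i. \<Prod>j\<leftarrow>[1..<k]. z_sign n j i) * on_qubit n k pauli_Y"
    unfolding majorana_def Let_def
    using jordan_wigner_string[OF s on_qubit_carrier[OF k pauli_carrier(1)]]
      jordan_wigner_string[OF s on_qubit_carrier[OF k pauli_carrier(2)]] by simp_all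
qed

lemma sign_diag_unitary:
  assumes "\<And>i. i < d \<Longrightarrow> s i * s i = (1 :: complex)" "\<And>i. i < d \<Longrightarrow> cnj (s i) = s i"
  shows "unitary_mat d (mat_diag d s)"
proof (rule unitaryI)
  have "mat_adjoint (mat_diag d s) = mat_diag d s"
    by (intro eq_matI) (simp_all add: mat_diag_def assms(2))
  moreover have "mat_diag d (\<lambda>i. s i * s i) = 1\<^sub>m d"
    by (rule eq_matI) (simp_all add: mat_diag_def assms(1))
  ultimately show "mat_adjoint (mat_diag d s) * mat_diag d s = 1\<^sub>m d" by simp
qed simp

lemma majorana_unitary:
  assumes "\<mu> \<in> {1..2 * n}"
  shows "unitary_mat (2 ^ n) (majorana n \<mu>)"
proof -
  have U: "unitary_mat (2 ^ n) (mat_diag (2 ^ n) (\<lambda>i. \<Prod>j\<leftarrow>js. z_sign n j i))" for js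
    by (rule sign_diag_unitary[OF prod_list_z_sign_square prod_list_z_sign_real])
  show ?thesis
  proof (cases "even \<mu>")
    case True
    then obtain k where "\<mu> = 2 * k" by (rule evenE)
    then show ?thesis using assms
      by (auto simp: majorana_eq intro!: unitary_mult U on_qubit_unitary pauli_unitary)
  next
    case False
    then obtain k where "\<mu> = 2 * k + 1" by (rule oddE)
    then have "\<mu> = 2 * (k + 1) - 1" "1 \<le> k + 1" "k + 1 \<le> n" using assms by auto
    then show ?thesis
      by (metis majorana_eq(1) unitary_mult U on_qubit_unitary pauli_unitary(1))
  qed
qed

text \<open>The sign string depends only on the qubits before k, whereas X_k changes qubit k alone.
  Hence the two strings cancel around X_k, and X Y = i Z remains.\<close>

lemma majorana_pair:
  assumes k: "1 \<le> k" "k \<le> n"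
  shows "majorana n (2 * k - 1) * majorana n (2 * k) = \<i> \<cdot>\<^sub>m on_qubit n k pauli_Z"
proof -
  let ?s = "\<lambda>i. \<Prod>j\<leftarrow>[1..<k]. z_sign n j i"
  let ?D = "mat_diag (2 ^ n) ?s"
  let ?X = "on_qubit n k pauli_X" and ?Y = "on_qubit n k pauli_Y"
  note D = mat_diag_dim[of "2 ^ n" ?s]
  note X = on_qubit_carrier[OF k pauli_carrier(1)] and Y = on_qubit_carrier[OF k pauli_carrier(2)]
  have "?D * ?X * ?D = ?X"
  proof (rule eq_matI)
    fix i j assume "i < dim_row ?X" "j < dim_col ?X"
    then have ij: "i < 2 ^ n" "j < 2 ^ n" using carrier_matD[OF X] by simp_all
    have s: "?s i = ?s j" if "i div 2 ^ Suc (n - k) = j div 2 ^ Suc (n - k)"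
    proof -
      have "z_sign n l i = z_sign n l j" if l: "l \<in> set [1..<k]" for l
      proof -
        \<comment> \<open>As l < k, the bit of qubit l lies above that of qubit k, so it is
          determined by \<open>i div 2 ^ Suc (n - k)\<close>.\<close>
        have "n - l = Suc (n - k) + (n - l - Suc (n - k))" using l k by auto
        then have "x div 2 ^ (n - l) = x div 2 ^ Suc (n - k) div 2 ^ (n - l - Suc (n - k))" for x :: nat
          by (metis div_mult2_eq power_add)
        then show ?thesis using \<open>i div 2 ^ Suc (n - k) = _\<close> by (simp add: z_sign_def)
      qed
      then show ?thesis by (intro arg_cong[of _ _ prod_list] map_cong) auto
    qed
    have "(?D * ?X * ?D) $$ (i, j) = ?s i * ?X $$ (i, j) * ?s j"
      using ij mult_carrier_mat[OF D X] X
      by (simp add: mat_diag_mult_right[of _ "2 ^ n"] mat_diag_mult_left[of _ _ "2 ^ n"] del: index_mult_mat(1))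
    also have "\<dots> = ?X $$ (i, j)"
      using s prod_list_z_sign_square[where js="[1..<k]" and n=n and i=j] 
      by (simp add: on_qubit_index[OF k pauli_carrier(1) ij] mult_ac)
    finally show "(?D * ?X * ?D) $$ (i, j) = ?X $$ (i, j)" .
  qed (use X in auto)
  moreover have "majorana n (2 * k - 1) * majorana n (2 * k) = (?D * ?X * ?D) * ?Y"
    unfolding majorana_eq[OF k]
    by (simp add: mult_assoc_dim carrier_matD[OF X] carrier_matD[OF Y])
  ultimately show ?thesis
    by (simp add: on_qubit_mult on_qubit_smult pauli_mult(3))
qed

section \<open>Composition of protocols and empirical frequencies\<close>

primrec bind_protocol :: "'a protocol \<Rightarrow> ('a \<Rightarrow> 'b protocol) \<Rightarrow> 'b protocol" where
  "bind_protocol (Output r) f = f r"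
| "bind_protocol (Toss p k) f = Toss p (\<lambda>i. bind_protocol (k i) f)"
| "bind_protocol (Measure Es k) f = Measure Es (\<lambda>i. bind_protocol (k i) f)"

text \<open>The measurement half of \<open>state_learner\<close>, without a condition on the output,
  for stages that return counts rather than states.\<close>

primrec measures_qubits :: "nat \<Rightarrow> 'a protocol \<Rightarrow> bool" where
  "measures_qubits n (Output r) \<longleftrightarrow> True"
| "measures_qubits n (Toss p k) \<longleftrightarrow> (\<forall>i \<in> set_pmf p. measures_qubits n (k i))"
| "measures_qubits n (Measure Es k) \<longleftrightarrow> povm (2 ^ n) Es \<and> (\<forall>i < length Es. measures_qubits n (k i))"

lemma run_bind_protocol: "run \<rho> (bind_protocol p f) = bind_pmf (run \<rho> p) (\<lambda>r. run \<rho> (f r))"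
  by (induction p) (simp_all add: bind_return_pmf bind_assoc_pmf)

lemma state_learner_bind_protocol:
  "measures_qubits n p \<Longrightarrow> (\<And>r. state_learner n (f r)) \<Longrightarrow> state_learner n (bind_protocol p f)"
  by (induction p) auto

lemma measures_qubits_bind_protocol:
  "measures_qubits n p \<Longrightarrow> (\<And>r. measures_qubits n (f r)) \<Longrightarrow> measures_qubits n (bind_protocol p f)"
  by (induction p) auto

lemma uses_at_most_mono: "uses_at_most p N \<Longrightarrow> N \<le> M \<Longrightarrow> uses_at_most p M"
proof (induction p arbitrary: N M)
  case (Measure Es k)
  then show ?case using diff_le_mono[of N M 1] by fastforce
qed auto

lemma uses_at_most_bind_protocol:
  "uses_at_most p N \<Longrightarrow> (\<And>r. uses_at_most (f r) M) \<Longrightarrow> uses_at_most (bind_protocol p f) (N + M)"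
proof (induction p arbitrary: N)
  case (Output r)
  then show ?case using uses_at_most_mono[OF Output.prems(2)] by simp
next
  case (Measure Es k)
  have "uses_at_most (bind_protocol (k i) f) (N - 1 + M)" if "i < length Es" for i
    using Measure.IH[of "k i" "N - 1"] that Measure.prems by simp
  moreover have "N - 1 + M = N + M - 1" "0 < N" using Measure.prems by auto
  ultimately show ?case by simp
qed auto

section \<open>Repeated measurements and their frequencies\<close>

primrec count_first :: "complex mat list \<Rightarrow> nat \<Rightarrow> nat protocol" where
  "count_first Es 0 = Output 0"
| "count_first Es (Suc M) = Measure Es (\<lambda>i. bind_protocol (count_first Es M)
     (\<lambda>c. Output ((if i = 0 then 1 else 0) + c)))"

primrec counts_first :: "nat \<Rightarrow> complex mat list list \<Rightarrow> nat list protocol" where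
  "counts_first M [] = Output []"
| "counts_first M (Es # Ess) = bind_protocol (count_first Es M)
     (\<lambda>c. bind_protocol (counts_first M Ess) (\<lambda>cs. Output (c # cs)))"

lemma uses_at_most_count_first: "uses_at_most (count_first Es M) M"
proof (induction M)
  case (Suc M)
  have "uses_at_most (bind_protocol (count_first Es M) (\<lambda>c. Output (f c))) M" for f :: "nat \<Rightarrow> nat"
    using uses_at_most_bind_protocol[OF Suc, of "\<lambda>c. Output (f c)" 0] by simp
  then show ?case by simp
qed simp

lemma uses_at_most_counts_first: "uses_at_most (counts_first M Ess) (length Ess * M)"
proof (induction Ess)
  case (Cons Es Ess)
  have "uses_at_most (bind_protocol (counts_first M Ess) (\<lambda>cs. Output (c # cs))) (length Ess * M)" for c
    using uses_at_most_bind_protocol[OF Cons, of "\<lambda>cs. Output (c # cs)" 0] by simp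
  from uses_at_most_bind_protocol[OF uses_at_most_count_first[of Es M] this] show ?case by simp
qed simp

lemma measures_qubits_count_first: "povm (2 ^ n) Es \<Longrightarrow> measures_qubits n (count_first Es M)"
  by (induction M) (auto intro!: measures_qubits_bind_protocol)

lemma measures_qubits_counts_first:
  "(\<And>Es. Es \<in> set Ess \<Longrightarrow> povm (2 ^ n) Es) \<Longrightarrow> measures_qubits n (counts_first M Ess)"
  by (induction Ess) (auto intro!: measures_qubits_bind_protocol measures_qubits_count_first)

lemma map_pmf_eq_bernoulli: "map_pmf (\<lambda>i. i = x) q = bernoulli_pmf (pmf q x)"
proof (rule pmf_eqI)
  fix b
  have "(\<lambda>i. i = x) -` {True} = {x}" "(\<lambda>i. i = x) -` {False} = - {x}" by auto
  then show "pmf (map_pmf (\<lambda>i. i = x) q) b = pmf (bernoulli_pmf (pmf q x)) b"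
    by (cases b) (simp_all add: pmf_map pmf_le_1 measure_pmf_single measure_pmf.prob_compl[of "{x}", simplified] Compl_eq_Diff_UNIV)
qed

text \<open>The event that outcome 0 occurs is a Bernoulli variable, so the count is binomial and
  Hoeffding's bound for the binomial distribution applies.\<close>

lemma run_count_first:
  "run \<rho> (count_first Es M) = binomial_pmf M (pmf (outcome_pmf Es \<rho>) 0)"
proof (induction M)
  case (Suc M)
  let ?q = "outcome_pmf Es \<rho>"
  have "run \<rho> (count_first Es (Suc M)) =
      bind_pmf (map_pmf (\<lambda>i. i = 0) ?q) (\<lambda>b. bind_pmf (binomial_pmf M (pmf ?q 0))
        (\<lambda>k. return_pmf ((if b then 1 else 0) + k)))"
    by (simp add: run_bind_protocol Suc bind_map_pmf)
  also have "\<dots> = binomial_pmf (Suc M) (pmf ?q 0)"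
    unfolding map_pmf_eq_bernoulli by (subst binomial_pmf_Suc) (auto simp: pmf_le_1)
  finally show ?case .
qed (simp add: binomial_pmf_0 pmf_le_1)

text \<open>Union bound for two consecutive stages: either the first one ends in B, or the second
  fails with probability at most b from where it starts. It serves both the walk through the list of
  correlations and the final split of \<delta>.\<close>

lemma prob_bind_pmf_le:
  assumes "\<And>x. x \<in> set_pmf p \<Longrightarrow> x \<notin> B \<Longrightarrow> measure_pmf.prob (f x) A \<le> b" and b: "0 \<le> b"
  shows "measure_pmf.prob (bind_pmf p f) A \<le> measure_pmf.prob p B + b"
proof -
  have "emeasure (bind_pmf p f) A = (\<integral>\<^sup>+x. emeasure (f x) A \<partial>p)" by simp
  also have "\<dots> \<le> (\<integral>\<^sup>+x. indicator B x + ennreal b \<partial>p)"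
  proof (intro nn_integral_mono_AE AE_pmfI)
    fix x assume x: "x \<in> set_pmf p"
    show "emeasure (f x) A \<le> indicator B x + ennreal b"
    proof (cases "x \<in> B")
      case True
      have "emeasure (f x) A \<le> 1" by (rule measure_pmf.emeasure_le_1)
      also have "\<dots> \<le> indicator B x + ennreal b" using True by simp
      finally show ?thesis .
    next
      case False
      with assms(1)[OF x] show ?thesis
        by (simp add: measure_pmf.emeasure_eq_measure ennreal_leI)
    qed
  qed
  also have "\<dots> = emeasure p B + ennreal b"
    by (subst nn_integral_add) auto
  also have "\<dots> = ennreal (measure_pmf.prob p B + b)"
    using b by (simp add: measure_pmf.emeasure_eq_measure ennreal_plus)
  finally show ?thesis
    using b by (simp add: measure_pmf.emeasure_eq_measure del: ennreal_plus)
qed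

lemma prob_count_first:
  assumes "0 < M" "0 \<le> \<beta>"
  shows "measure_pmf.prob (run \<rho> (count_first Es M))
    {c. \<beta> \<le> \<bar>real c / real M - pmf (outcome_pmf Es \<rho>) 0\<bar>} \<le> 2 * exp (- 2 * real M * \<beta>\<^sup>2)"
  using binomial_distribution.prob_abs_ge'[of "pmf (outcome_pmf Es \<rho>) 0" M \<beta>] assms
  by (simp add: run_count_first binomial_distribution_def pmf_le_1)

lemma prob_counts_first:
  assumes "0 < M" "0 \<le> \<beta>"
  shows "measure_pmf.prob (run \<rho> (counts_first M Ess))
      {cs. \<not> list_all2 (\<lambda>Es c. \<bar>real c / real M - pmf (outcome_pmf Es \<rho>) 0\<bar> < \<beta>) Ess cs}
    \<le> real (length Ess) * (2 * exp (- 2 * real M * \<beta>\<^sup>2))"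
proof (induction Ess)
  case (Cons Es Ess)
  let ?P = "\<lambda>Es c. \<bar>real c / real M - pmf (outcome_pmf Es \<rho>) 0\<bar> < \<beta>"
  let ?e = "2 * exp (- 2 * real M * \<beta>\<^sup>2)"
  have "measure_pmf.prob (run \<rho> (counts_first M (Es # Ess))) {cs. \<not> list_all2 ?P (Es # Ess) cs}
      \<le> measure_pmf.prob (run \<rho> (count_first Es M)) {c. \<beta> \<le> \<bar>real c / real M - pmf (outcome_pmf Es \<rho>) 0\<bar>}
        + real (length Ess) * ?e"
    unfolding counts_first.simps run_bind_protocol
  proof (rule prob_bind_pmf_le)
    fix c assume "c \<notin> {c. \<beta> \<le> \<bar>real c / real M - pmf (outcome_pmf Es \<rho>) 0\<bar>}"
    then have c: "?P Es c" by simp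
    have "bind_pmf (run \<rho> (counts_first M Ess)) (\<lambda>cs. run \<rho> (Output (c # cs))) =
        map_pmf ((#) c) (run \<rho> (counts_first M Ess))"
      by (simp add: map_pmf_def)
    moreover have "((#) c) -` {cs. \<not> list_all2 ?P (Es # Ess) cs} = {cs. \<not> list_all2 ?P Ess cs}"
      using c by auto
    ultimately show "measure_pmf.prob (bind_pmf (run \<rho> (counts_first M Ess)) (\<lambda>cs. run \<rho> (Output (c # cs))))
        {cs. \<not> list_all2 ?P (Es # Ess) cs} \<le> real (length Ess) * ?e"
      using Cons by simp
  qed simp
  with prob_count_first[OF assms, of \<rho> Es] show ?case by (simp add: algebra_simps)
qed simp

text \<open>Simulation of a small system inside a larger one: h pulls effects back, in the
  Heisenberg picture, and g embeds the results. The tree keeps its shape, so the number of copies is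
  unchanged.\<close>

primrec reinterpret_protocol :: "(complex mat \<Rightarrow> complex mat) \<Rightarrow> ('a \<Rightarrow> 'b) \<Rightarrow> 'a protocol \<Rightarrow> 'b protocol" where
  "reinterpret_protocol h g (Output r) = Output (g r)"
| "reinterpret_protocol h g (Toss p k) = Toss p (\<lambda>i. reinterpret_protocol h g (k i))"
| "reinterpret_protocol h g (Measure Es k) = Measure (map h Es) (\<lambda>i. reinterpret_protocol h g (k i))"

lemma uses_at_most_reinterpret_protocol: "uses_at_most p N \<Longrightarrow> uses_at_most (reinterpret_protocol h g p) N"
  by (induction p arbitrary: N) auto

lemma state_learner_reinterpret_protocol:
  assumes "state_learner t p"
    and "\<And>Es. povm (2 ^ t) Es \<Longrightarrow> povm (2 ^ n) (map h Es)" and "\<And>\<sigma>. qstate t \<sigma> \<Longrightarrow> qstate n (g \<sigma>)"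
  shows "state_learner n (reinterpret_protocol h g p)"
  using assms(1) by (induction p) (auto intro: assms(2,3))

section \<open>Reduced states and their distance to the full state\<close>

lemma trace_foldr_add_mult:
  assumes "\<And>E. E \<in> set Es \<Longrightarrow> E \<in> carrier_mat d d" and R: "R \<in> carrier_mat d d"
  shows "foldr (+) Es (0\<^sub>m d d) \<in> carrier_mat d d"
    "trace_mat (foldr (+) Es (0\<^sub>m d d) * R) = (\<Sum>E\<leftarrow>Es. trace_mat (E * R))"
  using assms(1)
proof (induction Es)
  case Nil
  case 1 show ?case by simp
  case 2 show ?case using R by (simp add: trace_mat_def)
next
  case (Cons E Es)
  case 1 show ?case using Cons 1 by simp
  case 2
  have E: "E \<in> carrier_mat d d" and F: "foldr (+) Es (0\<^sub>m d d) \<in> carrier_mat d d" using Cons 2 by auto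
  show ?case
    using Cons 2 by (simp add: add_mult_distrib_mat[OF E F R]
      trace_add[OF mult_carrier_mat[OF E R] mult_carrier_mat[OF F R]])
qed

text \<open>Discharges the proviso of \<open>embed_pmf\<close>: the weights are nonnegative by
  \<open>trace_psd_mult\<close>, and completeness of the POVM turns their sum into tr R.\<close>

lemma pmf_outcome:
  assumes Es: "povm d Es" and R: "psd_mat d R" "trace_mat R = 1"
  shows "pmf (outcome_pmf Es R) i = (if i < length Es then Re (trace_mat (Es ! i * R)) else 0)"
  unfolding outcome_pmf_def
proof (rule pmf_embed_pmf)
  let ?w = "\<lambda>i. if i < length Es then Re (trace_mat (Es ! i * R)) else 0"
  have E: "E \<in> carrier_mat d d" "psd_mat d E" if "E \<in> set Es" for E
    using Es that by (auto simp: povm_def psd_mat_def)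
  show nn: "0 \<le> ?w i" for i
    using E(2) R by (auto intro!: trace_psd_mult)
  have "1 = Re (trace_mat (foldr (+) Es (0\<^sub>m d d) * R))"
    using Es R psd_matD(1)[OF R(1)] by (simp add: povm_def)
  also have "\<dots> = Re (\<Sum>E\<leftarrow>Es. trace_mat (E * R))"
    using trace_foldr_add_mult(2)[OF E(1) psd_matD(1)[OF R(1)]] by simp
  also have "\<dots> = (\<Sum>i<length Es. ?w i)"
    by (simp add: sum_list_sum_nth lessThan_atLeast0)
  finally have s: "(\<Sum>i<length Es. ?w i) = 1" ..
  have "(\<integral>\<^sup>+i. ennreal (?w i) \<partial>count_space UNIV) = (\<Sum>i<length Es. ennreal (?w i))"
    by (rule nn_integral_count_space') auto
  also have "\<dots> = ennreal (\<Sum>i<length Es. ?w i)"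
    by (rule sum_ennreal) (rule nn)
  finally show "(\<integral>\<^sup>+i. ennreal (?w i) \<partial>count_space UNIV) = 1"
    unfolding s by simp
qed

text \<open>The conditions on protocols constrain only the branches with an index below
  \<open>length Es\<close>; the other ones have probability 0.\<close>

lemma outcome_index_less:
  assumes "povm (2 ^ t) Es" "qstate t \<sigma>" "i \<in> set_pmf (outcome_pmf Es \<sigma>)"
  shows "i < length Es"
  using assms pmf_outcome[of "2 ^ t" Es \<sigma> i] by (auto simp: set_pmf_iff qstate_def split: if_splits)

text \<open>If h is dual to the passage from \<rho> to \<sigma>, each node has the same outcome
  distribution on both sides, hence so has the whole tree.\<close>

lemma run_reinterpret_protocol:
  assumes p: "state_learner t p" and \<sigma>: "qstate t \<sigma>"
    and h: "\<And>E. psd_mat (2 ^ t) E \<Longrightarrow> trace_mat (h E * \<rho>) = trace_mat (E * \<sigma>)"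
  shows "run \<rho> (reinterpret_protocol h g p) = map_pmf g (run \<sigma> p)"
  using p
proof (induction p)
  case (Toss q k)
  then show ?case by (auto simp: map_bind_pmf intro!: bind_pmf_cong)
next
  case (Measure Es k)
  then have Es: "povm (2 ^ t) Es" by simp
  have "outcome_pmf (map h Es) \<rho> = outcome_pmf Es \<sigma>"
    using Es h unfolding outcome_pmf_def by (intro arg_cong[of _ _ embed_pmf]) (auto simp: povm_def)
  moreover have "i < length Es" if "i \<in> set_pmf (outcome_pmf Es \<sigma>)" for i
    using that by (rule outcome_index_less[OF Es \<sigma>])
  ultimately show ?case
    using Measure by (auto simp: map_bind_pmf intro!: bind_pmf_cong)
qed simp

section \<open>Metric properties of the trace distance\<close>

lemma trace_unitary_mult_le:
  fixes A :: "complex mat"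
  assumes A: "A \<in> carrier_mat d d" "mat_adjoint A = A" and W: "unitary_mat d W"
  shows "cmod (trace_mat (W * A)) \<le> trace_norm A"
  using trace_mult_le_trace_norm[OF A one_carrier_mat _ W] A(1) by simp

text \<open>The dual form is evaluated at the unitary that is optimal for A + B.\<close>

lemma trace_norm_triangle:
  assumes A: "A \<in> carrier_mat d d" "mat_adjoint A = A" and B: "B \<in> carrier_mat d d" "mat_adjoint B = B"
  shows "trace_norm (A + B) \<le> trace_norm A + trace_norm B"
proof -
  have AB: "A + B \<in> carrier_mat d d" "mat_adjoint (A + B) = A + B"
    using A B by (simp_all add: adjoint_add[OF A(1) B(1)])
  obtain S where S: "unitary_mat d S" and eq: "trace_norm (A + B) = Re (trace_mat (S * (A + B)))"
    using trace_norm_attained[OF AB] by blast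
  have Sc: "S \<in> carrier_mat d d" using S by (simp add: unitary_mat_def)
  have "trace_mat (S * (A + B)) = trace_mat (S * A) + trace_mat (S * B)"
    using mult_carrier_mat[OF Sc A(1)] mult_carrier_mat[OF Sc B(1)]
    by (simp add: mult_add_distrib_mat[OF Sc A(1) B(1)] trace_add)
  then show ?thesis
    using trace_unitary_mult_le[OF A S] trace_unitary_mult_le[OF B S]
      complex_Re_le_cmod[of "trace_mat (S * A)"] complex_Re_le_cmod[of "trace_mat (S * B)"]
    unfolding eq by simp
qed

lemma trace_dist_triangle:
  assumes A: "A \<in> carrier_mat d d" "mat_adjoint A = A" and B: "B \<in> carrier_mat d d" "mat_adjoint B = B"
    and C: "C \<in> carrier_mat d d" "mat_adjoint C = C"
  shows "trace_dist A C \<le> trace_dist A B + trace_dist B C"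
proof -
  have "A - C = (A - B) + (B - C)" using A(1) B(1) C(1) by (intro eq_matI) auto
  then show ?thesis
    using trace_norm_triangle[OF minus_carrier_mat[OF B(1), of A] _ minus_carrier_mat[OF C(1), of B]] A B C
    by (simp add: trace_dist_def adjoint_minus[of _ d d])
qed

text \<open>Transfers the tomography error from t qubits to n qubits: the unitary optimal for the
  embedded difference is inserted into \<open>trace_mult_le_trace_norm\<close> with V = J.\<close>

lemma trace_dist_isometry_le:
  assumes A: "A \<in> carrier_mat d d" "mat_adjoint A = A" and B: "B \<in> carrier_mat d d" "mat_adjoint B = B"
    and J: "J \<in> carrier_mat m d" "mat_adjoint J * J = 1\<^sub>m d"
  shows "trace_dist (J * A * mat_adjoint J) (J * B * mat_adjoint J) \<le> trace_dist A B"
proof -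
  define C where "C = A - B"
  have C: "C \<in> carrier_mat d d" "mat_adjoint C = C"
    using A B by (simp_all add: C_def adjoint_minus[OF A(1) B(1)] minus_carrier_mat)
  note dims = carrier_matD[OF J(1)] carrier_matD[OF C(1)]
  have JA: "J * A \<in> carrier_mat m d" and JB: "J * B \<in> carrier_mat m d"
    by (rule mult_carrier_mat[OF J(1) A(1)], rule mult_carrier_mat[OF J(1) B(1)])
  have eq: "J * A * mat_adjoint J - J * B * mat_adjoint J = J * C * mat_adjoint J"
    unfolding C_def mult_minus_distrib_mat[OF J(1) A(1) B(1)] minus_mult_distrib_mat[OF JA JB adjoint_carrier[OF J(1)]] ..
  have JC: "J * C * mat_adjoint J \<in> carrier_mat m m" "mat_adjoint (J * C * mat_adjoint J) = J * C * mat_adjoint J"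
    by (rule mult_carrier_mat[OF mult_carrier_mat[OF J(1) C(1)] adjoint_carrier[OF J(1)]])
      (simp add: adjoint_mult' mult_assoc_dim dims C(2))
  obtain S where S: "unitary_mat m S" and e: "trace_norm (J * C * mat_adjoint J) = Re (trace_mat (S * (J * C * mat_adjoint J)))"
    using trace_norm_attained[OF JC] by blast
  have "trace_norm (J * C * mat_adjoint J) \<le> trace_norm C"
    unfolding e by (rule order.trans[OF complex_Re_le_cmod trace_mult_le_trace_norm[OF C J S]])
  then show ?thesis by (simp add: trace_dist_def eq C_def)
qed

text \<open>The ranges of the J_b decompose the m-dimensional space into B copies of the
  d-dimensional one. Copy 0 will hold the compressed states; the others make the pulled-back
  measurements complete.\<close>

locale isometry_family =
  fixes m d B :: nat and J :: "nat \<Rightarrow> complex mat"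
  assumes B: "0 < B"
    and J: "\<And>b. b < B \<Longrightarrow> J b \<in> carrier_mat m d"
    and JJ: "\<And>b. b < B \<Longrightarrow> mat_adjoint (J b) * J b = 1\<^sub>m d"
    and resolution: "msum m m (\<lambda>b. J b * mat_adjoint (J b)) {..<B} = 1\<^sub>m m"
begin

text \<open>For the rotated block isometries used later this is G (E \<otimes> 1)
  G^\<dagger>.\<close>

definition extend :: "complex mat \<Rightarrow> complex mat" where
  "extend E = msum m m (\<lambda>b. J b * E * mat_adjoint (J b)) {..<B}"

text \<open>For the same isometries, the partial trace of G^\<dagger> R G over the last n - t
  qubits.\<close>

definition reduce :: "complex mat \<Rightarrow> complex mat" where
  "reduce R = msum d d (\<lambda>b. mat_adjoint (J b) * R * J b) {..<B}"

lemma up_carrier: "b < B \<Longrightarrow> E \<in> carrier_mat d d \<Longrightarrow> J b * E * mat_adjoint (J b) \<in> carrier_mat m m"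
  by (rule mult_carrier_mat[OF mult_carrier_mat[OF J] adjoint_carrier[OF J]])

lemma down_carrier: "b < B \<Longrightarrow> R \<in> carrier_mat m m \<Longrightarrow> mat_adjoint (J b) * R * J b \<in> carrier_mat d d"
  by (rule mult_carrier_mat[OF mult_carrier_mat[OF adjoint_carrier[OF J]] J])

text \<open>Cyclicity in each summand makes \<open>extend\<close> and \<open>reduce\<close> adjoint
  for the trace pairing: instead of reducing the state, effects may be pulled back.\<close>

lemma trace_extend_mult:
  assumes E: "E \<in> carrier_mat d d" and R: "R \<in> carrier_mat m m"
  shows "trace_mat (extend E * R) = trace_mat (E * reduce R)"
proof -
  have "trace_mat (extend E * R) = (\<Sum>b<B. trace_mat (J b * E * mat_adjoint (J b) * R))"
    unfolding extend_def
    by (subst msum_mult[OF R]) (auto intro: up_carrier E trace_msum mult_carrier_mat[OF up_carrier[OF _ E] R])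
  also have "\<dots> = (\<Sum>b<B. trace_mat (E * (mat_adjoint (J b) * R * J b)))"
  proof (rule sum.cong[OF refl])
    fix b assume "b \<in> {..<B}"
    then have b: "J b \<in> carrier_mat m d" using J by simp
    note dims = carrier_matD[OF b] carrier_matD[OF E]
      carrier_matD[OF R]
    have "J b * E * mat_adjoint (J b) * R = J b * (E * (mat_adjoint (J b) * R))"
      by (simp add: dims mult_assoc_dim)
    also have "trace_mat \<dots> = trace_mat (E * (mat_adjoint (J b) * R) * J b)"
      by (rule trace_mult_comm[OF b mult_carrier_mat[OF E mult_carrier_mat[OF adjoint_carrier[OF b] R]]])
    also have "E * (mat_adjoint (J b) * R) * J b = E * (mat_adjoint (J b) * R * J b)"
      by (simp add: dims mult_assoc_dim)
    finally show "trace_mat (J b * E * mat_adjoint (J b) * R) = trace_mat (E * (mat_adjoint (J b) * R * J b))" .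
  qed
  also have "\<dots> = trace_mat (E * reduce R)"
    unfolding reduce_def
    by (subst mult_msum[OF E]) (auto intro: down_carrier R trace_msum[symmetric] mult_carrier_mat[OF E down_carrier[OF _ R]])
  finally show ?thesis .
qed

lemma extend_carrier [simp]: "extend E \<in> carrier_mat m m"
  by (simp add: extend_def)

lemma extend_one: "extend (1\<^sub>m d) = 1\<^sub>m m"
proof -
  have "extend (1\<^sub>m d) = msum m m (\<lambda>b. J b * mat_adjoint (J b)) {..<B}"
    unfolding extend_def
  proof (rule msum_cong)
    fix b assume "b \<in> {..<B}"
    then have "J b \<in> carrier_mat m d" using J by simp
    then show "J b * 1\<^sub>m d * mat_adjoint (J b) = J b * mat_adjoint (J b)" by simp
  qed
  then show ?thesis by (simp add: resolution)
qed

lemma extend_zero: "extend (0\<^sub>m d d) = 0\<^sub>m m m"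
proof (rule eq_matI)
  fix i j assume ij: "i < dim_row (0\<^sub>m m m :: complex mat)" "j < dim_col (0\<^sub>m m m :: complex mat)"
  have "(J b * 0\<^sub>m d d * mat_adjoint (J b)) $$ (i, j) = 0" if b: "b < B" for b
    unfolding right_mult_zero_mat[OF J[OF b]] left_mult_zero_mat[OF adjoint_carrier[OF J[OF b]]]
    using ij by simp
  then show "extend (0\<^sub>m d d) $$ (i, j) = 0\<^sub>m m m $$ (i, j)"
    using ij by (simp add: extend_def msum_index)
qed (simp_all add: extend_def)

lemma extend_add:
  assumes E: "E \<in> carrier_mat d d" and F: "F \<in> carrier_mat d d"
  shows "extend (E + F) = extend E + extend F"
proof (rule eq_matI)
  fix i j assume "i < dim_row (extend E + extend F)" "j < dim_col (extend E + extend F)"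
  then have ij: "i < m" "j < m" by (simp_all add: extend_def)
  have "(J b * (E + F) * mat_adjoint (J b)) $$ (i, j) =
      (J b * E * mat_adjoint (J b)) $$ (i, j) + (J b * F * mat_adjoint (J b)) $$ (i, j)" if b: "b < B" for b
    unfolding mult_add_distrib_mat[OF J[OF b] E F] 
      add_mult_distrib_mat[OF mult_carrier_mat[OF J[OF b] E] mult_carrier_mat[OF J[OF b] F] adjoint_carrier[OF J[OF b]]]
    using ij up_carrier[OF b F] by (intro index_add_mat) auto
  then show "extend (E + F) $$ (i, j) = (extend E + extend F) $$ (i, j)"
    using ij by (simp add: extend_def msum_index sum.distrib del: index_mult_mat(1))
qed (simp_all add: extend_def)

text \<open>\<open>extend\<close> is additive, positive and unital.\<close>

lemma povm_extend:
  assumes "povm d Es"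
  shows "povm m (map extend Es)"
proof -
  have psd: "psd_mat d E" if "E \<in> set Es" for E using assms that by (simp add: povm_def)
  have "psd_mat m (extend E)" if "E \<in> set Es" for E
    unfolding extend_def using psd[OF that] J by (intro psd_msum psd_conj[of d]) auto
  moreover have "foldr (+) (map extend Es) (0\<^sub>m m m) = extend (foldr (+) Es (0\<^sub>m d d))"
    using psd
  proof (induction Es)
    case (Cons E Es)
    have "E \<in> carrier_mat d d" "\<And>F. F \<in> set Es \<Longrightarrow> F \<in> carrier_mat d d"
      using Cons.prems by (auto simp: psd_mat_def)
    then show ?case
      using Cons trace_foldr_add_mult(1)[of Es d "1\<^sub>m d"] by (simp add: extend_add)
  qed (simp add: extend_zero)
  ultimately show ?thesis using assms by (auto simp: povm_def extend_one)
qed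

lemma psd_reduce: "psd_mat m R \<Longrightarrow> psd_mat d (reduce R)"
  unfolding reduce_def
proof (rule psd_msum)
  fix b assume "psd_mat m R" "b \<in> {..<B}"
  then show "psd_mat d (mat_adjoint (J b) * R * J b)"
    using psd_conj[of m R "mat_adjoint (J b)" d] J by simp
qed simp

lemma trace_reduce: "R \<in> carrier_mat m m \<Longrightarrow> trace_mat (reduce R) = trace_mat R"
  using trace_extend_mult[of "1\<^sub>m d" R] by (simp add: extend_one reduce_def)

text \<open>With P the projection on copy 0 and Q = 1 - P, the difference is P R Q + Q R P + Q R Q
  minus the embedded contribution of the other copies; the block P R P cancels. In trace norm the
  mixed terms are at most sqrt (p (1 - p)) each and the other two at most 1 - p each, and the
  distance is half the total.\<close>

lemma trace_dist_reduce_le: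
  assumes R: "psd_mat m R" "trace_mat R = 1"
  defines "p \<equiv> Re (trace_mat (mat_adjoint (J 0) * R * J 0))"
  shows "trace_dist R (J 0 * reduce R * mat_adjoint (J 0)) \<le> sqrt (p * (1 - p)) + (1 - p)"
    and "p \<le> 1"
proof -
  note Rc = psd_matD(1)[OF R(1)]
  define K where "K = mat_adjoint (J 0) * R * J 0"
  \<comment> \<open>The part of the reduced state that stems from the copies b > 0: positive
    semidefinite and of trace 1 - p.\<close>
  define \<xi> where "\<xi> = msum d d (\<lambda>b. mat_adjoint (J b) * R * J b) {1..<B}"
  define P where "P = J 0 * mat_adjoint (J 0)"
  define Q where "Q = 1\<^sub>m m - P"
  define T where "T X Y = trace_mat (X * R * mat_adjoint Y)" for X Y :: "complex mat"
  note J0 = J[OF B] note J0a = adjoint_carrier[OF J0]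
  have Kc: "K \<in> carrier_mat d d" unfolding K_def by (rule down_carrier[OF B Rc])
  have \<xi>c: "\<xi> \<in> carrier_mat d d" by (simp add: \<xi>_def)
  have "{..<B} = insert 0 {1..<B}" using B by auto
  then have red: "reduce R = K + \<xi>"
    unfolding reduce_def \<xi>_def K_def by (simp only:) (subst msum_insert, auto intro: down_carrier[OF B Rc])
  have "psd_mat d (mat_adjoint (J b) * R * mat_adjoint (mat_adjoint (J b)))" if "b < B" for b
    by (rule psd_conj[OF R(1) adjoint_carrier[OF J[OF that]]])
  then have psd\<xi>: "psd_mat d \<xi>" unfolding \<xi>_def by (intro psd_msum) auto
  have tr\<xi>: "Re (trace_mat \<xi>) = 1 - p"
  proof -
    have "trace_mat (reduce R) = 1" using trace_reduce[OF Rc] R(2) by simp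
    then have "trace_mat K + trace_mat \<xi> = 1" by (simp add: red trace_add[OF Kc \<xi>c])
    then have "Re (trace_mat K + trace_mat \<xi>) = 1" by simp
    then show ?thesis by (simp add: p_def K_def)
  qed
  have Pc: "P \<in> carrier_mat m m" unfolding P_def by (rule mult_carrier_mat[OF J0 J0a])
  have Qc: "Q \<in> carrier_mat m m" unfolding Q_def by (rule minus_carrier_mat[OF Pc])
  note dims = carrier_matD[OF J0] carrier_matD[OF Rc]
    carrier_matD[OF Pc] carrier_matD[OF Qc]
    carrier_matD[OF Kc]
  have Pa: "mat_adjoint P = P" unfolding P_def by (simp add: adjoint_mult' dims)
  have Qa: "mat_adjoint Q = Q" unfolding Q_def by (simp add: adjoint_minus[OF one_carrier_mat Pc] Pa)
  have PQ: "P + Q = 1\<^sub>m m" unfolding Q_def using Pc by (intro eq_matI) auto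
  have "P * P = J 0 * (mat_adjoint (J 0) * J 0) * mat_adjoint (J 0)" unfolding P_def by (simp add: dims mult_assoc_dim)
  then have PP: "P * P = P" unfolding JJ[OF B] P_def using J0 by simp
  have QP: "Q * P = 0\<^sub>m m m"
    unfolding Q_def using minus_mult_distrib_mat[OF one_carrier_mat Pc Pc] PP Pc by simp
  have PQ0: "P * Q = 0\<^sub>m m m"
    unfolding Q_def using mult_minus_distrib_mat[OF Pc one_carrier_mat Pc] PP Pc by simp
  have c: "X * R * mat_adjoint Y \<in> carrier_mat m m" if "X \<in> carrier_mat m m" "Y \<in> carrier_mat m m" for X Y
    by (rule mult_carrier_mat[OF mult_carrier_mat[OF that(1) Rc] adjoint_carrier[OF that(2)]])
  have T_add_left: "T (X + X') Y = T X Y + T X' Y"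
    if X: "X \<in> carrier_mat m m" "X' \<in> carrier_mat m m" "Y \<in> carrier_mat m m" for X X' Y
    unfolding T_def add_mult_distrib_mat[OF X(1,2) Rc]
      add_mult_distrib_mat[OF mult_carrier_mat[OF X(1) Rc] mult_carrier_mat[OF X(2) Rc] adjoint_carrier[OF X(3)]]
    by (rule trace_add[OF c[OF X(1,3)] c[OF X(2,3)]])
  have T_add_right: "T X (Y + Y') = T X Y + T X Y'"
    if X: "X \<in> carrier_mat m m" "Y \<in> carrier_mat m m" "Y' \<in> carrier_mat m m" for X Y Y'
    unfolding T_def adjoint_add[OF X(2,3)]
      mult_add_distrib_mat[OF mult_carrier_mat[OF X(1) Rc] adjoint_carrier[OF X(2)] adjoint_carrier[OF X(3)]]
    by (rule trace_add[OF c[OF X(1,2)] c[OF X(1,3)]])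
  \<comment> \<open>Removes the dual unitary S from the square roots of Cauchy-Schwarz, whose
    factors are then p or 1 - p.\<close>
  have T_unitary: "T (S * X) (S * X) = T X X" if S: "unitary_mat m S" and X: "X \<in> carrier_mat m m" for S X
  proof -
    have Sc: "S \<in> carrier_mat m m" and SS: "mat_adjoint S * S = 1\<^sub>m m" using S by (auto simp: unitary_mat_def)
    note ds = carrier_matD[OF Sc] carrier_matD[OF X]
    have "T (S * X) (S * X) = trace_mat (S * (X * R * mat_adjoint X * mat_adjoint S))"
      unfolding T_def by (simp add: adjoint_mult' mult_assoc_dim ds dims)
    also have "\<dots> = trace_mat (X * R * mat_adjoint X * mat_adjoint S * S)"
      by (rule trace_mult_comm[OF Sc mult_carrier_mat[OF c[OF X X] adjoint_carrier[OF Sc]]])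
    also have "X * R * mat_adjoint X * mat_adjoint S * S = X * R * mat_adjoint X"
      unfolding assoc_mult_mat[OF c[OF X X] adjoint_carrier[OF Sc] Sc] SS by (rule right_mult_one_mat[OF c[OF X X]])
    finally show ?thesis unfolding T_def .
  qed
  have TPP: "Re (T P P) = p"
  proof -
    have "T P P = trace_mat (J 0 * (K * mat_adjoint (J 0)))"
      unfolding T_def Pa unfolding P_def K_def by (simp add: dims mult_assoc_dim)
    also have "\<dots> = trace_mat (K * mat_adjoint (J 0) * J 0)"
      by (rule trace_mult_comm[OF J0 mult_carrier_mat[OF Kc J0a]])
    also have "K * mat_adjoint (J 0) * J 0 = K"
      unfolding assoc_mult_mat[OF Kc J0a J0] JJ[OF B] using Kc by simp
    finally show ?thesis by (simp add: p_def K_def)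
  qed
  \<comment> \<open>By cyclicity the cross terms vanish as long as S does not stand between the
    projections; this yields the weight 1 - p of Q.\<close>
  have TPQ: "T X Y = 0" if XY: "X \<in> carrier_mat m m" "Y \<in> carrier_mat m m" "mat_adjoint Y * X = 0\<^sub>m m m" for X Y
  proof -
    have "T X Y = trace_mat (mat_adjoint Y * (X * R))"
      unfolding T_def by (rule trace_mult_comm[OF mult_carrier_mat[OF XY(1) Rc] adjoint_carrier[OF XY(2)]])
    also have "mat_adjoint Y * (X * R) = 0\<^sub>m m m"
      unfolding assoc_mult_mat[OF adjoint_carrier[OF XY(2)] XY(1) Rc, symmetric] XY(3) using Rc by simp
    finally show ?thesis by (simp add: trace_mat_def)
  qed
  have TQQ: "Re (T Q Q) = 1 - p"
  proof -
    have "1 = T (P + Q) (P + Q)" unfolding PQ T_def using Rc R(2) by simp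
    also have "\<dots> = T P P + T Q Q"
      using TPQ[OF Pc Qc] TPQ[OF Qc Pc]
      by (simp add: T_add_left[OF Pc Qc] T_add_right[OF _ Pc Qc] Pc Qc Pa Qa QP PQ0)
    finally have "1 = Re (T P P + T Q Q)" by simp
    then show ?thesis by (simp add: TPP)
  qed
  define \<Delta> where "\<Delta> = R - J 0 * reduce R * mat_adjoint (J 0)"
  have redc: "reduce R \<in> carrier_mat d d" by (simp add: reduce_def)
  note up = up_carrier[OF B redc]
  have \<Delta>: "\<Delta> \<in> carrier_mat m m" unfolding \<Delta>_def by (rule minus_carrier_mat[OF up])
  have \<Delta>a: "mat_adjoint \<Delta> = \<Delta>"
    unfolding \<Delta>_def adjoint_minus[OF Rc up] psd_matD(2)[OF R(1)] psd_matD(2)[OF psd_conj[OF psd_reduce[OF R(1)] J0]] ..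
  obtain S where S: "unitary_mat m S" and eq: "trace_norm \<Delta> = Re (trace_mat (S * \<Delta>))"
    using trace_norm_attained[OF \<Delta> \<Delta>a] by blast
  have Sc: "S \<in> carrier_mat m m" using S by (simp add: unitary_mat_def)
  note SP = mult_carrier_mat[OF Sc Pc] and SQ = mult_carrier_mat[OF Sc Qc]
  define Y where "Y = J 0 * \<xi> * mat_adjoint (J 0)"
  have Yc: "Y \<in> carrier_mat m m" unfolding Y_def by (rule up_carrier[OF B \<xi>c])
  have "J 0 * reduce R * mat_adjoint (J 0) = J 0 * K * mat_adjoint (J 0) + Y"
    unfolding red Y_def mult_add_distrib_mat[OF J0 Kc \<xi>c]
    by (rule add_mult_distrib_mat[OF mult_carrier_mat[OF J0 Kc] mult_carrier_mat[OF J0 \<xi>c] J0a])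
  also have "J 0 * K * mat_adjoint (J 0) = P * R * P" unfolding P_def K_def by (simp add: dims mult_assoc_dim)
  finally have e1: "J 0 * reduce R * mat_adjoint (J 0) = P * R * P + Y" .
  have PRP: "P * R * P \<in> carrier_mat m m" using c[OF Pc Pc] by (simp add: Pa)
  have "trace_mat (S * \<Delta>) = trace_mat (S * R) - (trace_mat (S * (P * R * P)) + trace_mat (S * Y))"
    unfolding \<Delta>_def e1 mult_minus_distrib_mat[OF Sc Rc add_carrier_mat[OF Yc]] mult_add_distrib_mat[OF Sc PRP Yc]
    unfolding trace_minus[OF mult_carrier_mat[OF Sc Rc] add_carrier_mat[OF mult_carrier_mat[OF Sc Yc]]]
      trace_add[OF mult_carrier_mat[OF Sc PRP] mult_carrier_mat[OF Sc Yc]] ..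
  also have "trace_mat (S * (P * R * P)) = T (S * P) P"
    unfolding T_def Pa by (simp add: dims mult_assoc_dim carrier_matD[OF Sc])
  also have "trace_mat (S * R) = T (S * P + S * Q) (P + Q)"
  proof -
    have "S * P + S * Q = S" unfolding mult_add_distrib_mat[OF Sc Pc Qc, symmetric] PQ using Sc by simp
    then show ?thesis unfolding PQ T_def by (simp add: right_mult_one_mat[OF mult_carrier_mat[OF Sc Rc]])
  qed
  also have "\<dots> = T (S * P) P + T (S * P) Q + (T (S * Q) P + T (S * Q) Q)"
    by (simp add: T_add_left[OF SP SQ] T_add_right[OF _ Pc Qc] add_carrier_mat SP SQ Pc Qc)
  finally have "trace_norm \<Delta> = Re (T (S * P) Q) + Re (T (S * Q) P) + Re (T (S * Q) Q) - Re (trace_mat (S * Y))"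
    unfolding eq by simp
  moreover have bound: "Re (T (S * X) X') \<le> sqrt (Re (T X X) * Re (T X' X'))"
    if X: "X \<in> carrier_mat m m" "X' \<in> carrier_mat m m" for X X'
    using trace_cauchy_schwarz[OF R(1) mult_carrier_mat[OF Sc X(1)] X(2)] T_unitary[OF S X(1)]
      complex_Re_le_cmod[of "T (S * X) X'"] unfolding T_def by simp
  moreover have "- Re (trace_mat (S * Y)) \<le> 1 - p"
  proof -
    have "psd_mat m Y" unfolding Y_def by (rule psd_conj[OF psd\<xi> J0])
    from trace_unitary_psd[OF S this] have "- Re (trace_mat (S * Y)) \<le> Re (trace_mat Y)"
      using abs_Re_le_cmod[of "trace_mat (S * Y)"] by linarith
    also have "trace_mat Y = trace_mat (J 0 * (\<xi> * mat_adjoint (J 0)))"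
      unfolding Y_def assoc_mult_mat[OF J0 \<xi>c J0a] ..
    also have "\<dots> = trace_mat (\<xi> * mat_adjoint (J 0) * J 0)"
      by (rule trace_mult_comm[OF J0 mult_carrier_mat[OF \<xi>c J0a]])
    also have "\<xi> * mat_adjoint (J 0) * J 0 = \<xi>"
      unfolding assoc_mult_mat[OF \<xi>c J0a J0] JJ[OF B] using \<xi>c by simp
    finally show ?thesis by (simp add: tr\<xi>)
  qed
  moreover have "0 \<le> 1 - p" using psd_trace(1)[OF psd\<xi>] tr\<xi> by simp
  ultimately have "trace_norm \<Delta> \<le> 2 * sqrt (p * (1 - p)) + 2 * (1 - p)"
    using bound[OF Pc Qc] bound[OF Qc Pc] bound[OF Qc Qc] by (simp add: TPP TQQ mult.commute)
  then show "trace_dist R (J 0 * reduce R * mat_adjoint (J 0)) \<le> sqrt (p * (1 - p)) + (1 - p)"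
    by (simp add: trace_dist_def \<Delta>_def)
  show "p \<le> 1" using psd_trace(1)[OF psd\<xi>] tr\<xi> by simp
qed

end

section \<open>Compressed states and the rotated Pauli operators\<close>

text \<open>Column j is the basis vector with index j * B + b, so the matrix appends the basis state
  b as a right tensor factor.\<close>

definition block_isometry :: "nat \<Rightarrow> nat \<Rightarrow> nat \<Rightarrow> complex mat" where
  "block_isometry d B b = mat (d * B) d (\<lambda>(i, j). if i div B = j \<and> i mod B = b then 1 else 0)"

lemma block_isometry_carrier [simp]: "block_isometry d B b \<in> carrier_mat (d * B) d"
  by (simp add: block_isometry_def)

lemma block_isometry_dim [simp]: "dim_row (block_isometry d B b) = d * B" "dim_col (block_isometry d B b) = d"
  by (simp_all add: block_isometry_def)

lemma block_isometry_mult_index: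
  assumes M: "M \<in> carrier_mat d k" and ij: "i < d * B" "j < k"
  shows "(block_isometry d B b * M) $$ (i, j) = (if i mod B = b then M $$ (i div B, j) else 0)"
proof -
  have "(block_isometry d B b * M) $$ (i, j) = (\<Sum>l<d. (if i div B = l \<and> i mod B = b then 1 else 0) * M $$ (l, j))"
    unfolding mult_index[OF block_isometry_carrier M ij] using ij by (intro sum.cong) (auto simp: block_isometry_def)
  also have "\<dots> = (\<Sum>l<d. if i div B = l then (if i mod B = b then M $$ (l, j) else 0) else 0)"
    by (intro sum.cong) auto
  also have "\<dots> = (if i mod B = b then M $$ (i div B, j) else 0)"
    using div_less_of_less_mult[OF ij(1)] by (subst sum.delta') auto
  finally show ?thesis .
qed

lemma block_isometry_isometry:
  assumes b: "b < B"
  shows "mat_adjoint (block_isometry d B b) * block_isometry d B b = 1\<^sub>m d"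
proof (rule eq_matI)
  fix i j assume "i < dim_row (1\<^sub>m d :: complex mat)" "j < dim_col (1\<^sub>m d :: complex mat)"
  then have ij: "i < d" "j < d" by auto
  have lt: "x * B + y < d * B" if "x < d" "y < B" for x y
  proof -
    have "x * B + y < Suc x * B" using that by simp
    also have "\<dots> \<le> d * B" using that by (intro mult_le_mono1) simp
    finally show ?thesis .
  qed
  have "(mat_adjoint (block_isometry d B b) * block_isometry d B b) $$ (i, j) =
      (\<Sum>l<d * B. mat_adjoint (block_isometry d B b) $$ (i, l) * block_isometry d B b $$ (l, j))"
    by (rule mult_index[OF adjoint_carrier[OF block_isometry_carrier] block_isometry_carrier ij])
  also have "\<dots> = (\<Sum>x<d. \<Sum>y<B. (if x = i \<and> y = b then 1 else 0) * (if x = j \<and> y = b then 1 else 0))"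
    unfolding sum_mult_split using ij lt
    by (intro sum.cong refl) (auto simp: block_isometry_def)
  also have "\<dots> = (\<Sum>x<d. if x = i then (if x = j then 1 else 0) else 0)"
  proof (rule sum.cong[OF refl])
    fix x
    have "(\<Sum>y<B. (if x = i \<and> y = b then 1 else 0) * (if x = j \<and> y = b then 1 else 0)) =
        (\<Sum>y<B. if y = b then (if x = i \<and> x = j then 1 else 0 :: complex) else 0)"
      by (intro sum.cong) auto
    also have "\<dots> = (if x = i then (if x = j then 1 else 0) else 0)"
      using b by (subst sum.delta) auto
    finally show "(\<Sum>y<B. (if x = i \<and> y = b then 1 else 0) * (if x = j \<and> y = b then 1 else 0)) =
      (if x = i then (if x = j then 1 else 0) else 0 :: complex)" .
  qed
  also have "\<dots> = 1\<^sub>m d $$ (i, j)"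
    using ij by (subst sum.delta) auto
  finally show "(mat_adjoint (block_isometry d B b) * block_isometry d B b) $$ (i, j) = 1\<^sub>m d $$ (i, j)" .
qed simp_all

lemma block_isometry_proj_index:
  assumes ij: "i < d * B" "j < d * B"
  shows "(block_isometry d B b * mat_adjoint (block_isometry d B b)) $$ (i, j) =
    (if i = j \<and> i mod B = b then 1 else 0)"
proof -
  have e: "i = j" if "i div B = j div B" "i mod B = j mod B" using that by (metis div_mult_mod_eq)
  show ?thesis
    unfolding block_isometry_mult_index[OF adjoint_carrier[OF block_isometry_carrier] ij]
    using ij div_less_of_less_mult[OF ij(1)] e by (auto simp: block_isometry_def)
qed

lemma block_isometry_family:
  assumes B: "0 < B"
  shows "isometry_family (d * B) d B (block_isometry d B)"
proof
  show "msum (d * B) (d * B) (\<lambda>b. block_isometry d B b * mat_adjoint (block_isometry d B b)) {..<B} = 1\<^sub>m (d * B)"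
  proof (rule eq_matI)
    fix i j assume "i < dim_row (1\<^sub>m (d * B) :: complex mat)" "j < dim_col (1\<^sub>m (d * B) :: complex mat)"
    then have ij: "i < d * B" "j < d * B" by auto
    have "(\<Sum>b<B. if i = j \<and> i mod B = b then 1 else 0 :: complex) =
       (\<Sum>b<B. if i mod B = b then (if i = j then 1 else 0) else 0)"
      by (intro sum.cong) auto
    also have "\<dots> = (if i = j then 1 else 0)"
      using B by (subst sum.delta') auto
    finally show "msum (d * B) (d * B) (\<lambda>b. block_isometry d B b * mat_adjoint (block_isometry d B b)) {..<B} $$ (i, j)
        = 1\<^sub>m (d * B) $$ (i, j)"
      using ij by (simp add: msum_index block_isometry_proj_index del: index_mult_mat(1))
  qed simp_all
qed (use B block_isometry_isometry in auto)

lemma kron_zero_proj: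
  assumes s: "s \<in> carrier_mat d d"
  shows "s \<otimes>\<^sub>m zero_proj k = block_isometry d (2 ^ k) 0 * s * mat_adjoint (block_isometry d (2 ^ k) 0)"
proof (rule eq_matI)
  let ?B = "2 ^ k :: nat"
  let ?V = "block_isometry d ?B 0"
  have z: "zero_proj k \<in> carrier_mat ?B ?B" by (simp add: zero_proj_def)
  note dims = carrier_matD[OF s] carrier_matD[OF z]
  note Va = adjoint_carrier[OF block_isometry_carrier[of d ?B 0]]
  fix i j assume "i < dim_row (?V * s * mat_adjoint ?V)" "j < dim_col (?V * s * mat_adjoint ?V)"
  then have ij: "i < d * ?B" "j < d * ?B" by simp_all
  have i: "i div ?B < d" and j: "j div ?B < d" using ij by (simp_all add: div_less_of_less_mult)
  have "(?V * s * mat_adjoint ?V) $$ (i, j) = (?V * (s * mat_adjoint ?V)) $$ (i, j)"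
    by (simp add: mult_assoc_dim dims)
  also have "\<dots> = (if i mod ?B = 0 then (s * mat_adjoint ?V) $$ (i div ?B, j) else 0)"
    by (rule block_isometry_mult_index[OF mult_carrier_mat[OF s Va] ij])
  \<comment> \<open>Passing to adjoints lets the rule for left multiplication by the isometry handle
    right multiplication as well.\<close>
  also have "(s * mat_adjoint ?V) $$ (i div ?B, j) = mat_adjoint (?V * mat_adjoint s) $$ (i div ?B, j)"
    by (simp add: adjoint_mult' dims)
  also have "\<dots> = cnj ((?V * mat_adjoint s) $$ (j, i div ?B))"
    using ij i by (intro adjoint_index) (simp_all add: dims)
  also have "(?V * mat_adjoint s) $$ (j, i div ?B) = (if j mod ?B = 0 then mat_adjoint s $$ (j div ?B, i div ?B) else 0)"
    by (rule block_isometry_mult_index[OF adjoint_carrier[OF s] ij(2) i])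
  also have "(if i mod ?B = 0 then cnj (if j mod ?B = 0 then mat_adjoint s $$ (j div ?B, i div ?B) else 0) else 0) =
      (s \<otimes>\<^sub>m zero_proj k) $$ (i, j)"
    using ij i j by (auto simp: kron_index dims zero_proj_def)
  finally show "(s \<otimes>\<^sub>m zero_proj k) $$ (i, j) = (?V * s * mat_adjoint ?V) $$ (i, j)" ..
next
  have z: "zero_proj k \<in> carrier_mat (2 ^ k) (2 ^ k)" by (simp add: zero_proj_def)
  show "dim_row (s \<otimes>\<^sub>m zero_proj k) = dim_row (block_isometry d (2 ^ k) 0 * s * mat_adjoint (block_isometry d (2 ^ k) 0))"
    "dim_col (s \<otimes>\<^sub>m zero_proj k) = dim_col (block_isometry d (2 ^ k) 0 * s * mat_adjoint (block_isometry d (2 ^ k) 0))"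
    using carrier_matD[OF s] carrier_matD[OF z] by simp_all
qed

lemma (in isometry_family) unitary_mult_family:
  assumes G: "unitary_mat m G"
  shows "isometry_family m d B (\<lambda>b. G * J b)"
proof
  have Gc: "G \<in> carrier_mat m m" and GG: "mat_adjoint G * G = 1\<^sub>m m" "G * mat_adjoint G = 1\<^sub>m m"
    using G by (auto simp: unitary_mat_def)
  note Ga = adjoint_carrier[OF Gc]
  note dG = carrier_matD[OF Gc]
  show "G * J b \<in> carrier_mat m d" if "b < B" for b by (rule mult_carrier_mat[OF Gc J[OF that]])
  show "mat_adjoint (G * J b) * (G * J b) = 1\<^sub>m d" if b: "b < B" for b
  proof -
    note dJ = carrier_matD[OF J[OF b]]
    have "mat_adjoint (G * J b) * (G * J b) = mat_adjoint (J b) * (mat_adjoint G * G * J b)"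
      by (simp add: adjoint_mult' mult_assoc_dim dG dJ)
    also have "mat_adjoint G * G * J b = J b" unfolding GG by (rule left_mult_one_mat[OF J[OF b]])
    finally show ?thesis by (simp add: JJ[OF b])
  qed
  have c: "J b * mat_adjoint (J b) \<in> carrier_mat m m" if "b \<in> {..<B}" for b
    by (rule mult_carrier_mat) (use J that in auto)
  have "msum m m (\<lambda>b. G * J b * mat_adjoint (G * J b)) {..<B} =
      msum m m (\<lambda>b. G * (J b * mat_adjoint (J b)) * mat_adjoint G) {..<B}"
  proof (rule msum_cong)
    fix b assume "b \<in> {..<B}"
    then have b: "b < B" by simp
    note dJ = carrier_matD[OF J[OF b]]
    show "G * J b * mat_adjoint (G * J b) = G * (J b * mat_adjoint (J b)) * mat_adjoint G"
      by (simp add: adjoint_mult' mult_assoc_dim dG dJ)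
  qed
  also have "\<dots> = msum m m (\<lambda>b. G * (J b * mat_adjoint (J b))) {..<B} * mat_adjoint G"
    by (rule msum_mult[OF Ga mult_carrier_mat[OF Gc c], symmetric])
  also have "msum m m (\<lambda>b. G * (J b * mat_adjoint (J b))) {..<B} = G * 1\<^sub>m m"
    unfolding resolution[symmetric] by (rule mult_msum[OF Gc c, symmetric])
  also have "G * 1\<^sub>m m * mat_adjoint G = 1\<^sub>m m" using Gc by (simp add: GG)
  finally show "msum m m (\<lambda>b. G * J b * mat_adjoint (G * J b)) {..<B} = 1\<^sub>m m" .
qed (rule B)

text \<open>Conjugation by \<open>frame n t G 0\<close> produces the compressible states belonging
  to G; the frames with b > 0 put other basis states in place of the zeros.\<close>

abbreviation frame :: "nat \<Rightarrow> nat \<Rightarrow> complex mat \<Rightarrow> nat \<Rightarrow> complex mat" where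
  "frame n t G b \<equiv> G * block_isometry (2 ^ t) (2 ^ (n - t)) b"

lemma frame_family:
  assumes "t \<le> n" "unitary_mat (2 ^ n) G"
  shows "isometry_family (2 ^ n) (2 ^ t) (2 ^ (n - t)) (frame n t G)"
proof -
  have n: "2 ^ t * 2 ^ (n - t) = (2 ^ n :: nat)" using assms(1) by (simp flip: power_add)
  show ?thesis
    using isometry_family.unitary_mult_family[OF block_isometry_family[of "2 ^ (n - t)" "2 ^ t"]] assms(2)
    by (simp add: n)
qed

lemma compressed_state_eq:
  assumes "t \<le> n" and G: "G \<in> carrier_mat (2 ^ n) (2 ^ n)" and s: "s \<in> carrier_mat (2 ^ t) (2 ^ t)"
  shows "G * (s \<otimes>\<^sub>m zero_proj (n - t)) * mat_adjoint G = frame n t G 0 * s * mat_adjoint (frame n t G 0)"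
proof -
  have n: "2 ^ t * 2 ^ (n - t) = (2 ^ n :: nat)" using assms(1) by (simp flip: power_add)
  note dims = carrier_matD[OF G] carrier_matD[OF s]
  show ?thesis
    unfolding kron_zero_proj[OF s] by (simp add: mult_assoc_dim adjoint_mult' dims n)
qed

lemma qstate_isometry:
  assumes s: "qstate t s" and J: "J \<in> carrier_mat (2 ^ n) (2 ^ t)" "mat_adjoint J * J = 1\<^sub>m (2 ^ t)"
  shows "qstate n (J * s * mat_adjoint J)"
proof -
  have sp: "psd_mat (2 ^ t) s" and tr: "trace_mat s = 1" using s by (auto simp: qstate_def)
  note sc = psd_matD(1)[OF sp] note Ja = adjoint_carrier[OF J(1)]
  have "trace_mat (J * s * mat_adjoint J) = trace_mat (mat_adjoint J * (J * s))"
    by (rule trace_mult_comm[OF mult_carrier_mat[OF J(1) sc] Ja])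
  also have "mat_adjoint J * (J * s) = s"
    unfolding assoc_mult_mat[OF Ja J(1) sc, symmetric] J(2) by (rule left_mult_one_mat[OF sc])
  finally show ?thesis using psd_conj[OF sp J(1)] tr by (simp add: qstate_def)
qed

text \<open>Read for the last m qubits: if they are not all 0, then one of them is 1. This is the
  combinatorial content of the union bound.\<close>

lemma exists_odd_div:
  assumes "i mod 2 ^ m \<noteq> (0 :: nat)"
  shows "\<exists>l<m. odd (i div 2 ^ l)"
proof (rule ccontr)
  assume "\<not> ?thesis"
  then have "take_bit m i = 0"
    by (intro bit_eqI) (simp add: bit_take_bit_iff, simp add: bit_iff_odd)
  then show False using assms by (simp add: take_bit_eq_mod)
qed

definition rotated_Z :: "nat \<Rightarrow> complex mat \<Rightarrow> nat \<Rightarrow> complex mat" where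
  "rotated_Z n G k = G * on_qubit n k pauli_Z * mat_adjoint G"

lemma unitary_on_qubit_Z:
  assumes "1 \<le> k" "k \<le> n"
  shows "unitary_mat (2 ^ n) (on_qubit n k pauli_Z)"
  unfolding on_qubit_Z[OF assms] by (rule sign_diag_unitary[OF z_sign_square z_sign_real])

text \<open>In the rotated basis all observables involved are diagonal, so the claim is an
  inequality between functions of a basis index, averaged over the diagonal w of G^\<dagger> R
  G.\<close>

lemma one_minus_zero_weight_le:
  assumes t: "t \<le> n" and G: "unitary_mat (2 ^ n) G" and R: "qstate n R"
  shows "1 - Re (trace_mat (mat_adjoint (frame n t G 0) * R * frame n t G 0)) \<le>
    (\<Sum>k=Suc t..n. (1 - Re (trace_mat (rotated_Z n G k * R))) / 2)"
proof -
  let ?N = "2 ^ n :: nat" and ?B = "2 ^ (n - t) :: nat"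
  let ?V = "block_isometry (2 ^ t) ?B 0"
  have n: "2 ^ t * ?B = ?N" using t by (simp flip: power_add)
  have Rp: "psd_mat ?N R" and tr: "trace_mat R = 1" using R by (auto simp: qstate_def)
  note Rc = psd_matD(1)[OF Rp]
  have Gc: "G \<in> carrier_mat ?N ?N" and GG: "G * mat_adjoint G = 1\<^sub>m ?N" using G by (auto simp: unitary_mat_def)
  note Ga = adjoint_carrier[OF Gc]
  have V: "?V \<in> carrier_mat ?N (2 ^ t)" using block_isometry_carrier[of "2 ^ t" ?B 0] by (simp add: n)
  note Va = adjoint_carrier[OF V]
  define R' where "R' = mat_adjoint G * R * G"
  have R': "psd_mat ?N R'" using psd_conj[OF Rp Ga] by (simp add: R'_def)
  note R'c = psd_matD(1)[OF R']
  note dims = carrier_matD[OF Gc] carrier_matD[OF Rc]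
    carrier_matD[OF R'c] carrier_matD[OF V]
  define w where "w i = Re (R' $$ (i, i))" for i
  have w: "0 \<le> w i" if "i < ?N" for i using psd_diag(1)[OF R' that] by (simp add: w_def)
  have diag: "R' $$ (i, i) = of_real (w i)" if "i < ?N" for i
    using psd_diag(2)[OF R' that] by (simp add: w_def complex_eq_iff)
  have trace_R': "trace_mat (mat_adjoint G * (X * G)) = trace_mat X" if X: "X \<in> carrier_mat ?N ?N" for X
  proof -
    have "trace_mat (mat_adjoint G * (X * G)) = trace_mat (X * G * mat_adjoint G)"
      by (rule trace_mult_comm[OF Ga mult_carrier_mat[OF X Gc]])
    also have "X * G * mat_adjoint G = X" unfolding assoc_mult_mat[OF X Gc Ga] GG by (rule right_mult_one_mat[OF X])
    finally show ?thesis .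
  qed
  have "trace_mat R' = 1" using trace_R'[OF Rc] tr by (simp add: R'_def mult_assoc_dim dims)
  then have "of_real (\<Sum>i<?N. w i) = (of_real 1 :: complex)"
    unfolding trace_mat_eq[OF R'c] of_real_sum by (simp add: diag)
  then have sum_w: "(\<Sum>i<?N. w i) = 1" unfolding of_real_eq_iff .
  have p: "Re (trace_mat (mat_adjoint (frame n t G 0) * R * frame n t G 0)) = (\<Sum>i<?N. (if i mod ?B = 0 then 1 else 0) * w i)"
  proof -
    have "mat_adjoint (frame n t G 0) * R * frame n t G 0 = mat_adjoint ?V * (R' * ?V)"
      unfolding R'_def by (simp add: adjoint_mult' mult_assoc_dim dims n)
    also have "trace_mat \<dots> = trace_mat (R' * ?V * mat_adjoint ?V)"
      by (rule trace_mult_comm[OF Va mult_carrier_mat[OF R'c V]])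
    also have "R' * ?V * mat_adjoint ?V = R' * (?V * mat_adjoint ?V)" by (simp add: mult_assoc_dim dims n)
    also have "trace_mat \<dots> = (\<Sum>i<?N. \<Sum>l<?N. R' $$ (i, l) * (?V * mat_adjoint ?V) $$ (l, i))"
      using mult_carrier_mat[OF R'c mult_carrier_mat[OF V Va]]
      by (simp add: trace_mat_eq mult_index[OF R'c mult_carrier_mat[OF V Va]] del: index_mult_mat(1))
    also have "\<dots> = (\<Sum>i<?N. \<Sum>l<?N. if l = i then (if i mod ?B = 0 then R' $$ (i, i) else 0) else 0)"
      by (intro sum.cong refl) (auto simp: block_isometry_proj_index n simp del: index_mult_mat(1))
    also have "\<dots> = (\<Sum>i<?N. of_real ((if i mod ?B = 0 then 1 else 0) * w i))"
      by (intro sum.cong refl) (auto simp: diag)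
    finally show ?thesis by (simp flip: of_real_sum)
  qed
  define z where "z k i = (if even (i div 2 ^ (n - k)) then 1 else - 1 :: real)" for k i :: nat
  have Z: "Re (trace_mat (rotated_Z n G k * R)) = (\<Sum>i<?N. z k i * w i)" if k: "k \<in> {Suc t..n}" for k
  proof -
    have k': "1 \<le> k" "k \<le> n" using k by auto
    let ?Z = "mat_diag ?N (z_sign n k)"
    note Zc = mat_diag_dim[of ?N "z_sign n k"]
    have "rotated_Z n G k * R = G * (?Z * (mat_adjoint G * R))"
      unfolding rotated_Z_def on_qubit_Z[OF k'] by (simp add: mult_assoc_dim dims)
    also have "trace_mat \<dots> = trace_mat (?Z * (mat_adjoint G * R) * G)"
      by (rule trace_mult_comm[OF Gc mult_carrier_mat[OF Zc mult_carrier_mat[OF Ga Rc]]])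
    also have "?Z * (mat_adjoint G * R) * G = ?Z * R'" unfolding R'_def by (simp add: mult_assoc_dim dims)
    also have "trace_mat \<dots> = (\<Sum>i<?N. of_real (z k i * w i))"
      using R'c by (simp add: trace_mat_def mat_diag_mult_left diag z_sign_def z_def del: index_mult_mat(1))
        (intro sum.cong refl, simp)
    finally show ?thesis by (simp flip: of_real_sum)
  qed
  \<comment> \<open>Pointwise union bound: a nonzero block index contains some bit 1, and the term
    of that qubit alone already equals 1.\<close>
  have key: "1 - (if i mod ?B = 0 then 1 else 0) \<le> (\<Sum>k=Suc t..n. (1 - z k i) / 2)" for i
  proof (cases "i mod ?B = 0")
    case True
    then show ?thesis by (auto simp: z_def intro!: sum_nonneg)
  next
    case False
    then obtain l where l: "l < n - t" "odd (i div 2 ^ l)" using exists_odd_div by blast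
    then have "n - l \<in> {Suc t..n}" "n - (n - l) = l" by auto
    then have "(1 - z (n - l) i) / 2 \<le> (\<Sum>k=Suc t..n. (1 - z k i) / 2)"
      by (intro member_le_sum) (auto simp: z_def)
    moreover have "z (n - l) i = - 1" using l \<open>n - (n - l) = l\<close> by (simp add: z_def)
    ultimately show ?thesis using False by simp
  qed
  have "1 - (\<Sum>i<?N. (if i mod ?B = 0 then 1 else 0) * w i) = (\<Sum>i<?N. (1 - (if i mod ?B = 0 then 1 else 0)) * w i)"
    unfolding left_diff_distrib sum_subtractf using sum_w by simp
  also have "\<dots> \<le> (\<Sum>i<?N. (\<Sum>k=Suc t..n. (1 - z k i) / 2) * w i)"
    using key w by (intro sum_mono mult_right_mono) auto
  also have "\<dots> = (\<Sum>k=Suc t..n. (\<Sum>i<?N. (1 - z k i) / 2 * w i))"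
    by (subst sum.swap) (simp add: sum_distrib_right)
  also have "\<dots> = (\<Sum>k=Suc t..n. (1 - (\<Sum>i<?N. z k i * w i)) / 2)"
  proof (rule sum.cong[OF refl])
    fix k
    have "(\<Sum>i<?N. (1 - z k i) / 2 * w i) = ((\<Sum>i<?N. w i) - (\<Sum>i<?N. z k i * w i)) / 2"
      by (simp add: sum_subtractf[symmetric] sum_divide_distrib algebra_simps diff_divide_distrib)
    then show "(\<Sum>i<?N. (1 - z k i) / 2 * w i) = (1 - (\<Sum>i<?N. z k i * w i)) / 2" using sum_w by simp
  qed
  finally show ?thesis unfolding p using Z by simp
qed

text \<open>For k > t the rotated Z_k fixes the compressed state, which thus has expectation value
  1. By duality the value changes by at most the trace norm of the difference, which is twice the
  trace distance.\<close>

lemma rotated_Z_lower_bound: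
  assumes tk: "t < k" "k \<le> n" and G: "unitary_mat (2 ^ n) G" and s: "qstate t s" and R: "qstate n R"
  shows "1 - 2 * trace_dist R (G * (s \<otimes>\<^sub>m zero_proj (n - t)) * mat_adjoint G) \<le>
    Re (trace_mat (rotated_Z n G k * R))"
proof -
  let ?N = "2 ^ n :: nat" and ?B = "2 ^ (n - t) :: nat"
  let ?V = "block_isometry (2 ^ t) ?B 0"
  let ?Z = "on_qubit n k pauli_Z"
  have k: "1 \<le> k" "k \<le> n" using tk by auto
  have n: "2 ^ t * ?B = ?N" using tk by (simp flip: power_add)
  have V: "?V \<in> carrier_mat ?N (2 ^ t)" using block_isometry_carrier[of "2 ^ t" ?B 0] by (simp add: n)
  have Gc: "G \<in> carrier_mat ?N ?N" and GG: "mat_adjoint G * G = 1\<^sub>m ?N" using G by (auto simp: unitary_mat_def)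
  have Rp: "psd_mat ?N R" using R by (simp add: qstate_def)
  have sp: "psd_mat (2 ^ t) s" using s by (simp add: qstate_def)
  note Rc = psd_matD(1)[OF Rp] note sc = psd_matD(1)[OF sp]
  note Zc = on_qubit_carrier[OF k pauli_carrier(3)]
  interpret isometry_family ?N "2 ^ t" ?B "frame n t G"
    by (rule frame_family) (use tk G in auto)
  define S where "S = frame n t G 0 * s * mat_adjoint (frame n t G 0)"
  have Seq: "G * (s \<otimes>\<^sub>m zero_proj (n - t)) * mat_adjoint G = S"
    unfolding S_def using tk by (intro compressed_state_eq Gc sc) auto
  have "qstate n S" unfolding S_def by (rule qstate_isometry[OF s J[OF B] JJ[OF B]])
  then have Sp: "psd_mat ?N S" and Str: "trace_mat S = 1" by (auto simp: qstate_def)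
  note Sc = psd_matD(1)[OF Sp]
  have ZV: "?Z * ?V = ?V"
  proof (rule eq_matI)
    fix i j assume "i < dim_row ?V" "j < dim_col ?V"
    then have ij: "i < ?N" "j < 2 ^ t" by (simp_all add: n)
    have "(?Z * ?V) $$ (i, j) = z_sign n k i * ?V $$ (i, j)"
      unfolding on_qubit_Z[OF k] mat_diag_mult_left[OF V] using ij by simp
    also have "\<dots> = ?V $$ (i, j)"
    proof (cases "i mod ?B = 0")
      case True
      \<comment> \<open>As k > t, qubit k is among the last n - t qubits, so its bit vanishes
        whenever the block index is 0.\<close>
      have "(2 :: nat) ^ Suc (n - k) dvd ?B" by (rule le_imp_power_dvd) (use tk in simp)
      also have "?B dvd i" using True by auto
      finally have "even (i div 2 ^ (n - k))" by (auto simp: dvd_def)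
      then show ?thesis by (simp add: z_sign_def)
    next
      case False
      then show ?thesis using ij by (simp add: block_isometry_def n)
    qed
    finally show "(?Z * ?V) $$ (i, j) = ?V $$ (i, j)" .
  qed (use Zc[THEN carrier_matD(1)] V[THEN carrier_matD(1)] in simp_all)
  note dims = carrier_matD[OF Gc] carrier_matD[OF V]
    carrier_matD[OF Zc] carrier_matD[OF sc]
  have "rotated_Z n G k * S = G * (?Z * (mat_adjoint G * G * ?V)) * s * mat_adjoint (frame n t G 0)"
    unfolding rotated_Z_def S_def by (simp add: mult_assoc_dim adjoint_mult' dims n)
  also have "mat_adjoint G * G * ?V = ?V" unfolding GG by (rule left_mult_one_mat[OF V])
  finally have ZS: "rotated_Z n G k * S = S" unfolding ZV S_def .
  have W: "unitary_mat ?N (rotated_Z n G k)"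
    unfolding rotated_Z_def by (rule unitary_mult[OF unitary_mult[OF G unitary_on_qubit_Z[OF k]] unitary_adjoint[OF G]])
  then have Wc: "rotated_Z n G k \<in> carrier_mat ?N ?N" by (simp add: unitary_mat_def)
  have D: "R - S \<in> carrier_mat ?N ?N" "mat_adjoint (R - S) = R - S"
    by (rule minus_carrier_mat[OF Sc]) (simp add: adjoint_minus[OF Rc Sc] psd_matD(2)[OF Rp] psd_matD(2)[OF Sp])
  have "trace_mat (rotated_Z n G k * (R - S)) = trace_mat (rotated_Z n G k * R) - 1"
    unfolding mult_minus_distrib_mat[OF Wc Rc Sc] ZS trace_minus[OF mult_carrier_mat[OF Wc Rc] Sc] Str ..
  then have "Re (trace_mat (rotated_Z n G k * R)) - 1 = Re (trace_mat (rotated_Z n G k * (R - S)))" by simp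
  then show ?thesis
    using trace_unitary_mult_le[OF D W] abs_Re_le_cmod[of "trace_mat (rotated_Z n G k * (R - S))"]
    unfolding Seq trace_dist_def by simp
qed

section \<open>Gaussian unitaries and correlations\<close>

text \<open>For unitary \<open>A\<close> the two effects are \<open>(1 + H) / 2\<close> and \<open>(1 - H) / 2\<close> with \<open>H = (A + A\<^sup>\<dagger>) / 2\<close>. Measuring the
  Hermitian part makes the anticommutation relations of the Majorana operators unnecessary.\<close>

definition real_part_povm :: "nat \<Rightarrow> complex mat \<Rightarrow> complex mat list" where
  "real_part_povm d A =
     [(1 / 4) \<cdot>\<^sub>m (mat_adjoint (1\<^sub>m d + A) * (1\<^sub>m d + A)), (1 / 4) \<cdot>\<^sub>m (mat_adjoint (1\<^sub>m d - A) * (1\<^sub>m d - A))]"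

text \<open>Scaling by r is conjugation by sqrt r times the identity.\<close>

lemma psd_smult:
  assumes A: "psd_mat d A" and r: "0 \<le> r"
  shows "psd_mat d (of_real r \<cdot>\<^sub>m A)"
proof -
  let ?I = "1\<^sub>m d :: complex mat" and ?s = "of_real (sqrt r) :: complex"
  note Ac = psd_matD(1)[OF A]
  have I: "?I \<in> carrier_mat d d" by simp
  have "mat_adjoint (?s \<cdot>\<^sub>m ?I) = ?s \<cdot>\<^sub>m ?I" by (simp add: adjoint_smult)
  moreover have "(?s \<cdot>\<^sub>m ?I) * A = ?s \<cdot>\<^sub>m A"
    unfolding mult_smult_assoc_mat[OF I Ac] left_mult_one_mat[OF Ac] ..
  moreover have "(?s \<cdot>\<^sub>m A) * (?s \<cdot>\<^sub>m ?I) = (?s * ?s) \<cdot>\<^sub>m A"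
    unfolding mult_smult_distrib[OF smult_carrier_mat[OF Ac] I] right_mult_one_mat[OF smult_carrier_mat[OF Ac]] smult_smult_mat ..
  moreover have "?s * ?s = of_real r" using r by (simp flip: of_real_mult)
  ultimately show ?thesis using psd_conj[OF A smult_carrier_mat[OF I], of ?s] by simp
qed

text \<open>Unitarity cancels the quadratic term. The Gram form on the left shows positivity of the
  effects, the expanded form shows that they add up to 1.\<close>

lemma real_part_povm_expand:
  assumes A: "unitary_mat d A"
  shows "mat_adjoint (1\<^sub>m d + A) * (1\<^sub>m d + A) = 2 \<cdot>\<^sub>m 1\<^sub>m d + (A + mat_adjoint A)"
    "mat_adjoint (1\<^sub>m d - A) * (1\<^sub>m d - A) = 2 \<cdot>\<^sub>m 1\<^sub>m d - (A + mat_adjoint A)"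
proof -
  have Ac: "A \<in> carrier_mat d d" and AA: "mat_adjoint A * A = 1\<^sub>m d" using A by (auto simp: unitary_mat_def)
  note Aa = adjoint_carrier[OF Ac] note I = one_carrier_mat[of d, where ?'a = complex]
  have p: "1\<^sub>m d + A \<in> carrier_mat d d" "1\<^sub>m d - A \<in> carrier_mat d d"
    by (rule add_carrier_mat[OF Ac], rule minus_carrier_mat[OF Ac])
  have "mat_adjoint (1\<^sub>m d + A) * (1\<^sub>m d + A) = (1\<^sub>m d + A) + (mat_adjoint A + 1\<^sub>m d)"
    unfolding adjoint_add[OF I Ac] adjoint_one add_mult_distrib_mat[OF I Aa p(1)]
      mult_add_distrib_mat[OF Aa I Ac] AA left_mult_one_mat[OF p(1)] right_mult_one_mat[OF Aa] ..
  also have "\<dots> = 2 \<cdot>\<^sub>m 1\<^sub>m d + (A + mat_adjoint A)"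
    using carrier_matD[OF Ac] by (intro eq_matI) simp_all
  finally show "mat_adjoint (1\<^sub>m d + A) * (1\<^sub>m d + A) = 2 \<cdot>\<^sub>m 1\<^sub>m d + (A + mat_adjoint A)" .
  have "mat_adjoint (1\<^sub>m d - A) * (1\<^sub>m d - A) = (1\<^sub>m d - A) - (mat_adjoint A - 1\<^sub>m d)"
    unfolding adjoint_minus[OF I Ac] adjoint_one minus_mult_distrib_mat[OF I Aa p(2)]
      mult_minus_distrib_mat[OF Aa I Ac] AA left_mult_one_mat[OF p(2)] right_mult_one_mat[OF Aa] ..
  also have "\<dots> = 2 \<cdot>\<^sub>m 1\<^sub>m d - (A + mat_adjoint A)"
    using carrier_matD[OF Ac] by (intro eq_matI) simp_all
  finally show "mat_adjoint (1\<^sub>m d - A) * (1\<^sub>m d - A) = 2 \<cdot>\<^sub>m 1\<^sub>m d - (A + mat_adjoint A)" .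
qed

lemma povm_real_part:
  assumes A: "unitary_mat d A"
  shows "povm d (real_part_povm d A)"
proof -
  have Ac: "A \<in> carrier_mat d d" using A by (auto simp: unitary_mat_def)
  have "psd_mat d (of_real (1 / 4) \<cdot>\<^sub>m (mat_adjoint (1\<^sub>m d + A) * (1\<^sub>m d + A)))"
    by (intro psd_smult psd_gram[OF add_carrier_mat[OF Ac]]) simp
  moreover have "psd_mat d (of_real (1 / 4) \<cdot>\<^sub>m (mat_adjoint (1\<^sub>m d - A) * (1\<^sub>m d - A)))"
    by (intro psd_smult psd_gram[OF minus_carrier_mat[OF Ac]]) simp
  moreover have "foldr (+) (real_part_povm d A) (0\<^sub>m d d) = 1\<^sub>m d"
    unfolding real_part_povm_def real_part_povm_expand[OF A]
    using carrier_matD[OF Ac] by (intro eq_matI) (simp_all add: field_simps)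
  ultimately show ?thesis by (simp add: povm_def real_part_povm_def)
qed

lemma pmf_real_part_povm:
  assumes A: "unitary_mat d A" and R: "psd_mat d R" "trace_mat R = 1"
  shows "pmf (outcome_pmf (real_part_povm d A) R) 0 = (1 + Re (trace_mat (A * R))) / 2"
proof -
  have Ac: "A \<in> carrier_mat d d" using A by (auto simp: unitary_mat_def)
  note Aa = adjoint_carrier[OF Ac] note Rc = psd_matD(1)[OF R(1)]
  note I = one_carrier_mat[of d, where ?'a = complex]
  have 2: "2 \<cdot>\<^sub>m 1\<^sub>m d \<in> carrier_mat d d" by simp
  have s: "A + mat_adjoint A \<in> carrier_mat d d" by (rule add_carrier_mat[OF Aa])
  have "trace_mat (mat_adjoint A * R) = trace_mat (R * mat_adjoint A)" by (rule trace_mult_comm[OF Aa Rc])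
  also have "R * mat_adjoint A = mat_adjoint (A * R)" by (simp add: adjoint_mult[OF Ac Rc] psd_matD(2)[OF R(1)])
  also have "trace_mat \<dots> = cnj (trace_mat (A * R))" by (rule trace_adjoint[OF mult_carrier_mat[OF Ac Rc]])
  finally have a: "trace_mat (mat_adjoint A * R) = cnj (trace_mat (A * R))" .
  have e: "(2 \<cdot>\<^sub>m 1\<^sub>m d + (A + mat_adjoint A)) * R = 2 \<cdot>\<^sub>m R + (A * R + mat_adjoint A * R)"
    unfolding add_mult_distrib_mat[OF 2 s Rc] add_mult_distrib_mat[OF Ac Aa Rc] mult_smult_assoc_mat[OF I Rc] left_mult_one_mat[OF Rc] ..
  have "trace_mat ((1 / 4) \<cdot>\<^sub>m (2 \<cdot>\<^sub>m 1\<^sub>m d + (A + mat_adjoint A)) * R) =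
      1 / 4 * (2 + (trace_mat (A * R) + cnj (trace_mat (A * R))))"
    unfolding mult_smult_assoc_mat[OF add_carrier_mat[OF s] Rc] e
      trace_smult[OF add_carrier_mat[OF add_carrier_mat[OF mult_carrier_mat[OF Aa Rc]]]]
      trace_add[OF smult_carrier_mat[OF Rc] add_carrier_mat[OF mult_carrier_mat[OF Aa Rc]]]
      trace_add[OF mult_carrier_mat[OF Ac Rc] mult_carrier_mat[OF Aa Rc]] trace_smult[OF Rc] a R(2) by simp
  then have "Re (trace_mat (real_part_povm d A ! 0 * R)) = (1 + Re (trace_mat (A * R))) / 2"
    unfolding real_part_povm_def real_part_povm_expand[OF A] nth_Cons_0 by (simp only:) (simp add: field_simps)
  moreover have "0 < length (real_part_povm d A)" by (simp add: real_part_povm_def)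
  ultimately show ?thesis unfolding pmf_outcome[OF povm_real_part[OF A] R] by simp
qed

text \<open>The phase cancels the one in \<gamma>_(2k-1) \<gamma>_(2k) = i Z_k.\<close>

definition majorana_pair :: "nat \<Rightarrow> nat \<Rightarrow> nat \<Rightarrow> complex mat" where
  "majorana_pair n \<mu> \<nu> = (- \<i>) \<cdot>\<^sub>m (majorana n \<mu> * majorana n \<nu>)"

lemma unitary_smult:
  assumes U: "unitary_mat d U" and c: "cnj c * c = 1"
  shows "unitary_mat d (c \<cdot>\<^sub>m U)"
proof (rule unitaryI)
  have Uc: "U \<in> carrier_mat d d" and UU: "mat_adjoint U * U = 1\<^sub>m d" using U by (auto simp: unitary_mat_def)
  show "c \<cdot>\<^sub>m U \<in> carrier_mat d d" using Uc by simp
  show "mat_adjoint (c \<cdot>\<^sub>m U) * (c \<cdot>\<^sub>m U) = 1\<^sub>m d"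
    unfolding adjoint_smult mult_smult_assoc_mat[OF adjoint_carrier[OF Uc] smult_carrier_mat[OF Uc]]
      mult_smult_distrib[OF adjoint_carrier[OF Uc] Uc] smult_smult_mat UU c
    by (intro eq_matI) simp_all
qed

lemma majorana_pair_unitary:
  assumes "\<mu> \<in> {1..2 * n}" "\<nu> \<in> {1..2 * n}"
  shows "unitary_mat (2 ^ n) (majorana_pair n \<mu> \<nu>)"
  unfolding majorana_pair_def
  by (intro unitary_smult unitary_mult majorana_unitary assms) simp

definition correlation :: "nat \<Rightarrow> complex mat \<Rightarrow> nat \<Rightarrow> nat \<Rightarrow> real" where
  "correlation n R \<mu> \<nu> = Re (trace_mat (majorana_pair n \<mu> \<nu> * R))"

text \<open>Keeps the orthogonal matrix as a parameter: scores are computed from Q, while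
  measurements are rotated by G.\<close>

definition gaussian_pair :: "nat \<Rightarrow> complex mat \<Rightarrow> real mat \<Rightarrow> bool" where
  "gaussian_pair n G Q \<longleftrightarrow> unitary_mat (2 ^ n) G \<and> Q \<in> orthogonal_group (2 * n) \<and>
     (\<forall>\<mu> \<in> {1..2 * n}. mat_adjoint G * majorana n \<mu> * G =
        mat (2 ^ n) (2 ^ n)
          (\<lambda>(i, j). \<Sum>\<nu> = 1..2 * n. complex_of_real (Q $$ (\<mu> - 1, \<nu> - 1)) * majorana n \<nu> $$ (i, j)))"

lemma gaussian_unitary_iff: "gaussian_unitary n G \<longleftrightarrow> (\<exists>Q. gaussian_pair n G Q)"
  unfolding gaussian_unitary_def gaussian_pair_def by blast

text \<open>Serves to show that \<open>compressible_states\<close> is nonempty, so that the infimum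
  in the promise is meaningful.\<close>

lemma gaussian_pair_one: "gaussian_pair n (1\<^sub>m (2 ^ n)) (1\<^sub>m (2 * n))"
  unfolding gaussian_pair_def
proof (intro conjI ballI)
  show "unitary_mat (2 ^ n) (1\<^sub>m (2 ^ n))" by (simp add: unitary_mat_def)
  show "1\<^sub>m (2 * n) \<in> orthogonal_group (2 * n)"
    by (simp add: orthogonal_group_def)
  fix \<mu> assume mu: "\<mu> \<in> {1..2 * n}"
  have g: "majorana n \<mu> \<in> carrier_mat (2 ^ n) (2 ^ n)" using majorana_unitary[OF mu] by (simp add: unitary_mat_def)
  show "mat_adjoint (1\<^sub>m (2 ^ n)) * majorana n \<mu> * 1\<^sub>m (2 ^ n) = mat (2 ^ n) (2 ^ n)
      (\<lambda>(i, j). \<Sum>\<nu> = 1..2 * n. complex_of_real (1\<^sub>m (2 * n) $$ (\<mu> - 1, \<nu> - 1)) * majorana n \<nu> $$ (i, j))"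
    (is "_ = ?M")
  proof (rule eq_matI)
    fix i j assume "i < dim_row ?M" "j < dim_col ?M"
    then have ij: "i < 2 ^ n" "j < 2 ^ n" by auto
    have "?M $$ (i, j) = (\<Sum>\<nu> = 1..2 * n. complex_of_real (1\<^sub>m (2 * n) $$ (\<mu> - 1, \<nu> - 1)) * majorana n \<nu> $$ (i, j))"
      using ij by simp
    also have "\<dots> = (\<Sum>\<nu> = 1..2 * n. if \<nu> = \<mu> then majorana n \<nu> $$ (i, j) else 0)"
    proof (rule sum.cong[OF refl])
      fix \<nu> assume "\<nu> \<in> {1..2 * n}"
      then have "\<mu> - 1 < 2 * n" "\<nu> - 1 < 2 * n" "\<mu> - 1 = \<nu> - 1 \<longleftrightarrow> \<nu> = \<mu>" using mu by auto
      then show "complex_of_real (1\<^sub>m (2 * n) $$ (\<mu> - 1, \<nu> - 1)) * majorana n \<nu> $$ (i, j) =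
          (if \<nu> = \<mu> then majorana n \<nu> $$ (i, j) else 0)"
        by (simp only: index_one_mat(1)) simp
    qed
    also have "\<dots> = majorana n \<mu> $$ (i, j)" using mu by (subst sum.delta) auto
    finally show "(mat_adjoint (1\<^sub>m (2 ^ n)) * majorana n \<mu> * 1\<^sub>m (2 ^ n)) $$ (i, j) = ?M $$ (i, j)"
      using g by simp
  qed (use g in simp_all)
qed

lemma orthogonal_columns:
  assumes Q: "Q \<in> orthogonal_group m" and ab: "a \<in> {1..m}" "b \<in> {1..m}"
  shows "(\<Sum>\<mu> = 1..m. Q $$ (\<mu> - 1, a - 1) * Q $$ (\<mu> - 1, b - 1)) = (if a = b then 1 else 0)"
proof -
  have Qc: "Q \<in> carrier_mat m m" and QQ: "transpose_mat Q * Q = 1\<^sub>m m" using Q by (auto simp: orthogonal_group_def)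
  have Qt: "transpose_mat Q \<in> carrier_mat m m" using Qc by simp
  have i: "a - 1 < m" "b - 1 < m" using ab by auto
  have "(\<Sum>\<mu> = 1..m. Q $$ (\<mu> - 1, a - 1) * Q $$ (\<mu> - 1, b - 1)) = (\<Sum>l<m. Q $$ (l, a - 1) * Q $$ (l, b - 1))"
    by (rule sum.reindex_bij_witness[of _ Suc "\<lambda>l. l - 1"]) auto
  also have "\<dots> = (transpose_mat Q * Q) $$ (a - 1, b - 1)"
    unfolding mult_index[OF Qt Qc i] using Qc i by (auto intro!: sum.cong)
  also have "\<dots> = (if a = b then 1 else 0)" unfolding QQ using i ab by auto
  finally show ?thesis .
qed

text \<open>The definition expands G^\<dagger> \<gamma>_\<mu> G along row \<mu> of Q. Orthonormality
  of the columns inverts this relation, and conjugating back by G leaves column \<nu> of Q as the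
  coefficients.\<close>

lemma gaussian_conj_majorana:
  assumes GQ: "gaussian_pair n G Q" and nu: "\<nu> \<in> {1..2 * n}"
  shows "G * majorana n \<nu> * mat_adjoint G =
    msum (2 ^ n) (2 ^ n) (\<lambda>\<mu>. complex_of_real (Q $$ (\<mu> - 1, \<nu> - 1)) \<cdot>\<^sub>m majorana n \<mu>) {1..2 * n}"
proof -
  let ?N = "2 ^ n :: nat"
  let ?q = "\<lambda>\<mu> \<nu>. complex_of_real (Q $$ (\<mu> - 1, \<nu> - 1))"
  have G: "unitary_mat ?N G" and Q: "Q \<in> orthogonal_group (2 * n)"
    and rel: "\<And>\<mu>. \<mu> \<in> {1..2 * n} \<Longrightarrow> mat_adjoint G * majorana n \<mu> * G =
        mat ?N ?N (\<lambda>(i, j). \<Sum>\<nu> = 1..2 * n. ?q \<mu> \<nu> * majorana n \<nu> $$ (i, j))"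
    using GQ by (auto simp: gaussian_pair_def)
  have Gc: "G \<in> carrier_mat ?N ?N" and GG: "G * mat_adjoint G = 1\<^sub>m ?N" using G by (auto simp: unitary_mat_def)
  note Ga = adjoint_carrier[OF Gc] note dG = carrier_matD[OF Gc]
  have g: "majorana n \<mu> \<in> carrier_mat ?N ?N" if "\<mu> \<in> {1..2 * n}" for \<mu>
    using majorana_unitary[OF that] by (simp add: unitary_mat_def)
  define S where "S \<mu> = mat_adjoint G * majorana n \<mu> * G" for \<mu>
  have Sc: "S \<mu> \<in> carrier_mat ?N ?N" if "\<mu> \<in> {1..2 * n}" for \<mu>
    unfolding S_def by (rule mult_carrier_mat[OF mult_carrier_mat[OF Ga g[OF that]] Gc])
  have qSc: "?q \<mu> \<nu> \<cdot>\<^sub>m S \<mu> \<in> carrier_mat ?N ?N" if "\<mu> \<in> {1..2 * n}" for \<mu>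
    by (rule smult_carrier_mat[OF Sc[OF that]])
  have "majorana n \<nu> = msum ?N ?N (\<lambda>\<mu>. ?q \<mu> \<nu> \<cdot>\<^sub>m S \<mu>) {1..2 * n}" (is "_ = ?M")
  proof (rule eq_matI)
    fix i j assume "i < dim_row ?M" "j < dim_col ?M"
    then have ij: "i < ?N" "j < ?N" by simp_all
    have "?M $$ (i, j) = (\<Sum>\<mu> = 1..2 * n. \<Sum>\<nu>' = 1..2 * n. ?q \<mu> \<nu> * ?q \<mu> \<nu>' * majorana n \<nu>' $$ (i, j))"
      unfolding msum_index[OF ij]
    proof (rule sum.cong[OF refl])
      fix \<mu> assume m: "\<mu> \<in> {1..2 * n}"
      have "(?q \<mu> \<nu> \<cdot>\<^sub>m S \<mu>) $$ (i, j) = ?q \<mu> \<nu> * S \<mu> $$ (i, j)"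
        using carrier_matD[OF Sc[OF m]] ij by (intro index_smult_mat) simp_all
      also have "S \<mu> $$ (i, j) = (\<Sum>\<nu>' = 1..2 * n. ?q \<mu> \<nu>' * majorana n \<nu>' $$ (i, j))"
        unfolding S_def rel[OF m] using ij by simp
      finally show "(?q \<mu> \<nu> \<cdot>\<^sub>m S \<mu>) $$ (i, j) = (\<Sum>\<nu>' = 1..2 * n. ?q \<mu> \<nu> * ?q \<mu> \<nu>' * majorana n \<nu>' $$ (i, j))"
        by (simp add: sum_distrib_left mult.assoc)
    qed
    also have "\<dots> = (\<Sum>\<nu>' = 1..2 * n. (\<Sum>\<mu> = 1..2 * n. ?q \<mu> \<nu> * ?q \<mu> \<nu>') * majorana n \<nu>' $$ (i, j))"
      by (subst sum.swap) (simp add: sum_distrib_right)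
    also have "\<dots> = (\<Sum>\<nu>' = 1..2 * n. if \<nu>' = \<nu> then majorana n \<nu>' $$ (i, j) else 0)"
    proof (rule sum.cong[OF refl])
      fix \<nu>' assume nu': "\<nu>' \<in> {1..2 * n}"
      have "(\<Sum>\<mu> = 1..2 * n. ?q \<mu> \<nu> * ?q \<mu> \<nu>') =
          of_real (\<Sum>\<mu> = 1..2 * n. Q $$ (\<mu> - 1, \<nu> - 1) * Q $$ (\<mu> - 1, \<nu>' - 1))" by simp
      then show "(\<Sum>\<mu> = 1..2 * n. ?q \<mu> \<nu> * ?q \<mu> \<nu>') * majorana n \<nu>' $$ (i, j) =
          (if \<nu>' = \<nu> then majorana n \<nu>' $$ (i, j) else 0)"
        unfolding orthogonal_columns[OF Q nu nu'] by simp
    qed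
    also have "\<dots> = majorana n \<nu> $$ (i, j)" using nu by (subst sum.delta) auto
    finally show "majorana n \<nu> $$ (i, j) = ?M $$ (i, j)" ..
  qed (use carrier_matD[OF g[OF nu]] in simp_all)
  then have "G * majorana n \<nu> * mat_adjoint G = G * ?M * mat_adjoint G" by (rule arg_cong)
  also have "G * ?M = msum ?N ?N (\<lambda>\<mu>. G * (?q \<mu> \<nu> \<cdot>\<^sub>m S \<mu>)) {1..2 * n}"
    by (rule mult_msum[OF Gc qSc])
  also have "\<dots> * mat_adjoint G = msum ?N ?N (\<lambda>\<mu>. G * (?q \<mu> \<nu> \<cdot>\<^sub>m S \<mu>) * mat_adjoint G) {1..2 * n}"
    by (rule msum_mult[OF Ga mult_carrier_mat[OF Gc qSc]])
  also have "\<dots> = msum ?N ?N (\<lambda>\<mu>. ?q \<mu> \<nu> \<cdot>\<^sub>m majorana n \<mu>) {1..2 * n}"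
  proof (rule msum_cong)
    fix \<mu> assume m: "\<mu> \<in> {1..2 * n}"
    note dg = carrier_matD[OF g[OF m]]
    have "G * S \<mu> * mat_adjoint G = (G * mat_adjoint G) * majorana n \<mu> * (G * mat_adjoint G)"
      unfolding S_def by (simp add: mult_assoc_dim dG dg)
    also have "\<dots> = majorana n \<mu>" unfolding GG using g[OF m] by simp
    finally show "G * (?q \<mu> \<nu> \<cdot>\<^sub>m S \<mu>) * mat_adjoint G = ?q \<mu> \<nu> \<cdot>\<^sub>m majorana n \<mu>"
      unfolding mult_smult_distrib[OF Gc Sc[OF m]] mult_smult_assoc_mat[OF mult_carrier_mat[OF Gc Sc[OF m]] Ga] by simp
  qed
  finally show ?thesis .
qed

lemma trace_smult_mult_smult:
  assumes A: "A \<in> carrier_mat d d" and B: "B \<in> carrier_mat d d" and R: "R \<in> carrier_mat d d"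
  shows "trace_mat ((a \<cdot>\<^sub>m A) * (b \<cdot>\<^sub>m (B * R))) = a * b * trace_mat (A * B * R)"
proof -
  note BR = mult_carrier_mat[OF B R]
  have "(a \<cdot>\<^sub>m A) * (b \<cdot>\<^sub>m (B * R)) = a \<cdot>\<^sub>m (A * (b \<cdot>\<^sub>m (B * R)))"
    by (rule mult_smult_assoc_mat[OF A smult_carrier_mat[OF BR]])
  also have "A * (b \<cdot>\<^sub>m (B * R)) = b \<cdot>\<^sub>m (A * (B * R))" by (rule mult_smult_distrib[OF A BR])
  also have "a \<cdot>\<^sub>m (b \<cdot>\<^sub>m (A * (B * R))) = (a * b) \<cdot>\<^sub>m (A * (B * R))" by (rule smult_smult_mat)
  finally show ?thesis
    by (simp only: trace_smult[OF mult_carrier_mat[OF A BR]] assoc_mult_mat[OF A B R])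
qed

text \<open>As i Z_k = \<gamma>_(2k-1) \<gamma>_(2k), the rotated Z_k is up to a phase the product
  of two rotated Majorana operators, hence bilinear in two columns of Q. Their zero-based numbers
  are 2k - 2 and 2k - 1, the former written \<open>2 * k - 1 - 1\<close>.\<close>

lemma rotated_Z_expansion:
  assumes GQ: "gaussian_pair n G Q" and k: "1 \<le> k" "k \<le> n" and R: "R \<in> carrier_mat (2 ^ n) (2 ^ n)"
  shows "Re (trace_mat (rotated_Z n G k * R)) =
    (\<Sum>\<mu> = 1..2 * n. \<Sum>\<nu> = 1..2 * n. Q $$ (\<mu> - 1, 2 * k - 1 - 1) * Q $$ (\<nu> - 1, 2 * k - 1) * correlation n R \<mu> \<nu>)"
proof -
  let ?N = "2 ^ n :: nat"
  let ?q = "\<lambda>\<mu> \<nu>. complex_of_real (Q $$ (\<mu> - 1, \<nu> - 1))"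
  let ?I = "{1..2 * n}"
  let ?a = "2 * k - 1" and ?b = "2 * k"
  have ab: "?a \<in> ?I" "?b \<in> ?I" using k by auto
  have G: "unitary_mat ?N G" using GQ by (simp add: gaussian_pair_def)
  have Gc: "G \<in> carrier_mat ?N ?N" and GG: "mat_adjoint G * G = 1\<^sub>m ?N" using G by (auto simp: unitary_mat_def)
  note Ga = adjoint_carrier[OF Gc] note dG = carrier_matD[OF Gc]
  have g: "majorana n \<mu> \<in> carrier_mat ?N ?N" if "\<mu> \<in> ?I" for \<mu>
    using majorana_unitary[OF that] by (simp add: unitary_mat_def)
  note Zc = on_qubit_carrier[OF k pauli_carrier(3)]
  define X where "X = msum ?N ?N (\<lambda>\<mu>. ?q \<mu> ?a \<cdot>\<^sub>m majorana n \<mu>) ?I"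
  define Y where "Y = msum ?N ?N (\<lambda>\<nu>. ?q \<nu> ?b \<cdot>\<^sub>m majorana n \<nu>) ?I"
  have Xc: "X \<in> carrier_mat ?N ?N" and Yc: "Y \<in> carrier_mat ?N ?N" by (simp_all add: X_def Y_def)
  have qg: "?q \<mu> c \<cdot>\<^sub>m majorana n \<mu> \<in> carrier_mat ?N ?N" if "\<mu> \<in> ?I" for \<mu> c
    by (rule smult_carrier_mat[OF g[OF that]])
  have conj: "(G * A * mat_adjoint G) * (G * B * mat_adjoint G) = G * (A * (mat_adjoint G * G) * B) * mat_adjoint G"
    if "A \<in> carrier_mat ?N ?N" "B \<in> carrier_mat ?N ?N" for A B
    by (simp add: mult_assoc_dim dG that[THEN carrier_matD(1)] that[THEN carrier_matD(2)])
  have "X * Y = G * (majorana n ?a * (mat_adjoint G * G) * majorana n ?b) * mat_adjoint G"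
    unfolding X_def Y_def gaussian_conj_majorana[OF GQ ab(1), symmetric] gaussian_conj_majorana[OF GQ ab(2), symmetric]
    by (rule conj[OF g[OF ab(1)] g[OF ab(2)]])
  also have "majorana n ?a * (mat_adjoint G * G) * majorana n ?b = \<i> \<cdot>\<^sub>m on_qubit n k pauli_Z"
    unfolding GG right_mult_one_mat[OF g[OF ab(1)]] by (rule majorana_pair[OF k])
  also have "G * (\<i> \<cdot>\<^sub>m on_qubit n k pauli_Z) * mat_adjoint G = \<i> \<cdot>\<^sub>m rotated_Z n G k"
    unfolding rotated_Z_def mult_smult_distrib[OF Gc Zc] mult_smult_assoc_mat[OF mult_carrier_mat[OF Gc Zc] Ga] ..
  finally have XY: "X * Y = \<i> \<cdot>\<^sub>m rotated_Z n G k" .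
  have rc: "rotated_Z n G k \<in> carrier_mat ?N ?N"
    unfolding rotated_Z_def by (rule mult_carrier_mat[OF mult_carrier_mat[OF Gc Zc] Ga])
  have "trace_mat (X * Y * R) = \<i> * trace_mat (rotated_Z n G k * R)"
    unfolding XY mult_smult_assoc_mat[OF rc R] by (rule trace_smult[OF mult_carrier_mat[OF rc R]])
  then have "trace_mat (rotated_Z n G k * R) = - \<i> * trace_mat (X * (Y * R))"
    by (simp add: assoc_mult_mat[OF Xc Yc R])
  also have "trace_mat (X * (Y * R)) = (\<Sum>\<mu>\<in>?I. trace_mat ((?q \<mu> ?a \<cdot>\<^sub>m majorana n \<mu>) * (Y * R)))"
    unfolding X_def
  proof -
    have "msum ?N ?N (\<lambda>\<mu>. ?q \<mu> ?a \<cdot>\<^sub>m majorana n \<mu>) ?I * (Y * R) =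
        msum ?N ?N (\<lambda>\<mu>. (?q \<mu> ?a \<cdot>\<^sub>m majorana n \<mu>) * (Y * R)) ?I"
      by (rule msum_mult[OF mult_carrier_mat[OF Yc R] qg])
    also have "trace_mat \<dots> = (\<Sum>\<mu>\<in>?I. trace_mat ((?q \<mu> ?a \<cdot>\<^sub>m majorana n \<mu>) * (Y * R)))"
      by (rule trace_msum[OF mult_carrier_mat[OF qg mult_carrier_mat[OF Yc R]]])
    finally show "trace_mat (msum ?N ?N (\<lambda>\<mu>. ?q \<mu> ?a \<cdot>\<^sub>m majorana n \<mu>) ?I * (Y * R)) =
      (\<Sum>\<mu>\<in>?I. trace_mat ((?q \<mu> ?a \<cdot>\<^sub>m majorana n \<mu>) * (Y * R)))" .
  qed
  also have "\<dots> = (\<Sum>\<mu>\<in>?I. \<Sum>\<nu>\<in>?I. ?q \<mu> ?a * ?q \<nu> ?b * trace_mat (majorana n \<mu> * majorana n \<nu> * R))"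
  proof (rule sum.cong[OF refl])
    fix \<mu> assume m: "\<mu> \<in> ?I"
    let ?F = "\<lambda>\<nu>. ?q \<nu> ?b \<cdot>\<^sub>m (majorana n \<nu> * R)"
    have c: "?F \<nu> \<in> carrier_mat ?N ?N" if "\<nu> \<in> ?I" for \<nu>
      by (rule smult_carrier_mat[OF mult_carrier_mat[OF g[OF that] R]])
    have "Y * R = msum ?N ?N (\<lambda>\<nu>. (?q \<nu> ?b \<cdot>\<^sub>m majorana n \<nu>) * R) ?I"
      unfolding Y_def by (rule msum_mult[OF R qg])
    also have "\<dots> = msum ?N ?N ?F ?I" by (rule msum_cong) (rule mult_smult_assoc_mat[OF g R])
    finally have "(?q \<mu> ?a \<cdot>\<^sub>m majorana n \<mu>) * (Y * R) = (?q \<mu> ?a \<cdot>\<^sub>m majorana n \<mu>) * msum ?N ?N ?F ?I"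
      by (rule arg_cong)
    also have "\<dots> = msum ?N ?N (\<lambda>\<nu>. (?q \<mu> ?a \<cdot>\<^sub>m majorana n \<mu>) * ?F \<nu>) ?I"
      by (rule mult_msum[OF qg[OF m] c])
    finally have e: "(?q \<mu> ?a \<cdot>\<^sub>m majorana n \<mu>) * (Y * R) =
        msum ?N ?N (\<lambda>\<nu>. (?q \<mu> ?a \<cdot>\<^sub>m majorana n \<mu>) * ?F \<nu>) ?I" .
    have "trace_mat ((?q \<mu> ?a \<cdot>\<^sub>m majorana n \<mu>) * (Y * R)) =
        (\<Sum>\<nu>\<in>?I. trace_mat ((?q \<mu> ?a \<cdot>\<^sub>m majorana n \<mu>) * ?F \<nu>))"
      unfolding e by (rule trace_msum[OF mult_carrier_mat[OF qg[OF m] c]])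
    also have "\<dots> = (\<Sum>\<nu>\<in>?I. ?q \<mu> ?a * ?q \<nu> ?b * trace_mat (majorana n \<mu> * majorana n \<nu> * R))"
    proof (rule sum.cong[OF refl])
      fix \<nu> assume nn: "\<nu> \<in> ?I"
      show "trace_mat ((?q \<mu> ?a \<cdot>\<^sub>m majorana n \<mu>) * (?q \<nu> ?b \<cdot>\<^sub>m (majorana n \<nu> * R))) =
          ?q \<mu> ?a * ?q \<nu> ?b * trace_mat (majorana n \<mu> * majorana n \<nu> * R)"
        by (rule trace_smult_mult_smult[OF g[OF m] g[OF nn] R])
    qed
    finally show "trace_mat ((?q \<mu> ?a \<cdot>\<^sub>m majorana n \<mu>) * (Y * R)) =
      (\<Sum>\<nu>\<in>?I. ?q \<mu> ?a * ?q \<nu> ?b * trace_mat (majorana n \<mu> * majorana n \<nu> * R))" .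
  qed
  finally have "trace_mat (rotated_Z n G k * R) =
      (\<Sum>\<mu>\<in>?I. \<Sum>\<nu>\<in>?I. ?q \<mu> ?a * ?q \<nu> ?b * (- \<i> * trace_mat (majorana n \<mu> * majorana n \<nu> * R)))"
    by (simp add: sum_distrib_left mult_ac sum_negf)
  also have "\<dots> = (\<Sum>\<mu>\<in>?I. \<Sum>\<nu>\<in>?I. of_real (Q $$ (\<mu> - 1, ?a - 1) * Q $$ (\<nu> - 1, ?b - 1)) * trace_mat (majorana_pair n \<mu> \<nu> * R))"
  proof (intro sum.cong refl)
    fix \<mu> \<nu> assume m: "\<mu> \<in> ?I" "\<nu> \<in> ?I"
    note gg = mult_carrier_mat[OF g[OF m(1)] g[OF m(2)]]
    have "trace_mat (majorana_pair n \<mu> \<nu> * R) = - \<i> * trace_mat (majorana n \<mu> * majorana n \<nu> * R)"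
      unfolding majorana_pair_def mult_smult_assoc_mat[OF gg R] by (rule trace_smult[OF mult_carrier_mat[OF gg R]])
    then show "?q \<mu> ?a * ?q \<nu> ?b * (- \<i> * trace_mat (majorana n \<mu> * majorana n \<nu> * R)) =
      of_real (Q $$ (\<mu> - 1, ?a - 1) * Q $$ (\<nu> - 1, ?b - 1)) * trace_mat (majorana_pair n \<mu> \<nu> * R)" by simp
  qed
  finally show ?thesis by (simp add: correlation_def)
qed

text \<open>The sum of the expectation values of the rotated \<open>Z\<^sub>k\<close>, \<open>t < k \<le> n\<close>, as a functional of the
  orthogonal matrix and of the (estimated) correlations.\<close>

definition zero_score :: "nat \<Rightarrow> nat \<Rightarrow> real mat \<Rightarrow> (nat \<Rightarrow> nat \<Rightarrow> real) \<Rightarrow> real" where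
  "zero_score n t Q c = (\<Sum>k=Suc t..n. \<Sum>\<mu> = 1..2 * n. \<Sum>\<nu> = 1..2 * n.
     Q $$ (\<mu> - 1, 2 * k - 1 - 1) * Q $$ (\<nu> - 1, 2 * k - 1) * c \<mu> \<nu>)"

lemma zero_score_correlation:
  assumes "gaussian_pair n G Q" "R \<in> carrier_mat (2 ^ n) (2 ^ n)"
  shows "zero_score n t Q (correlation n R) = (\<Sum>k=Suc t..n. Re (trace_mat (rotated_Z n G k * R)))"
  unfolding zero_score_def by (intro sum.cong refl) (simp add: rotated_Z_expansion[OF assms(1) _ _ assms(2)])

text \<open>The coefficient matrix W is a sum of outer products x_k y_k^T of two orthonormal
  families. Applying Cauchy-Schwarz once to all k together saves a factor sqrt (n - t) over separate
  estimates for each k; without this saving the copy count would grow like n^6 instead of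
  n^5.\<close>

lemma zero_score_diff_le:
  assumes Q: "Q \<in> orthogonal_group (2 * n)" and t: "t \<le> n" and a: "0 \<le> \<alpha>"
    and c: "\<And>\<mu> \<nu>. \<mu> \<in> {1..2 * n} \<Longrightarrow> \<nu> \<in> {1..2 * n} \<Longrightarrow> \<bar>c \<mu> \<nu> - c' \<mu> \<nu>\<bar> \<le> \<alpha>"
  shows "\<bar>zero_score n t Q c - zero_score n t Q c'\<bar> \<le> 2 * real n * sqrt (real n - real t) * \<alpha>"
proof -
  let ?I = "{1..2 * n}" and ?K = "{Suc t..n}"
  define x where "x k \<mu> = Q $$ (\<mu> - 1, 2 * k - 1 - 1)" for k \<mu> :: nat
  define y where "y k \<nu> = Q $$ (\<nu> - 1, 2 * k - 1)" for k \<nu> :: nat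
  define W where "W = (\<lambda>(\<mu>, \<nu>). \<Sum>k\<in>?K. x k \<mu> * y k \<nu>)"
  define D where "D = (\<lambda>(\<mu>, \<nu>). c \<mu> \<nu> - c' \<mu> \<nu>)"
  have ox: "(\<Sum>\<mu>\<in>?I. x k \<mu> * x l \<mu>) = (if k = l then 1 else 0)" if "k \<in> ?K" "l \<in> ?K" for k l
  proof -
    have m: "2 * k - 1 \<in> ?I" "2 * l - 1 \<in> ?I" and e: "2 * k - 1 = 2 * l - 1 \<longleftrightarrow> k = l" using that by auto
    show ?thesis unfolding x_def orthogonal_columns[OF Q m] e ..
  qed
  have oy: "(\<Sum>\<mu>\<in>?I. y k \<mu> * y l \<mu>) = (if k = l then 1 else 0)" if "k \<in> ?K" "l \<in> ?K" for k l
  proof -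
    have m: "2 * k \<in> ?I" "2 * l \<in> ?I" and e: "2 * k = 2 * l \<longleftrightarrow> k = l" using that by auto
    show ?thesis unfolding y_def orthogonal_columns[OF Q m] e ..
  qed
  have "zero_score n t Q c - zero_score n t Q c' = (\<Sum>k\<in>?K. \<Sum>\<mu>\<in>?I. \<Sum>\<nu>\<in>?I. x k \<mu> * y k \<nu> * (c \<mu> \<nu> - c' \<mu> \<nu>))"
    unfolding zero_score_def x_def y_def by (simp add: sum_subtractf[symmetric] right_diff_distrib)
  also have "\<dots> = (\<Sum>\<mu>\<in>?I. \<Sum>k\<in>?K. \<Sum>\<nu>\<in>?I. x k \<mu> * y k \<nu> * (c \<mu> \<nu> - c' \<mu> \<nu>))" by (rule sum.swap)
  also have "\<dots> = (\<Sum>\<mu>\<in>?I. \<Sum>\<nu>\<in>?I. \<Sum>k\<in>?K. x k \<mu> * y k \<nu> * (c \<mu> \<nu> - c' \<mu> \<nu>))"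
    by (intro sum.cong refl sum.swap)
  also have "\<dots> = (\<Sum>z\<in>?I \<times> ?I. W z * D z)"
  proof -
    have "(\<Sum>z\<in>?I \<times> ?I. W z * D z) = (\<Sum>\<mu>\<in>?I. \<Sum>\<nu>\<in>?I. W (\<mu>, \<nu>) * D (\<mu>, \<nu>))"
      by (simp add: sum.cartesian_product split_def)
    then show ?thesis by (simp add: W_def D_def sum_distrib_right)
  qed
  finally have e: "zero_score n t Q c - zero_score n t Q c' = (\<Sum>z\<in>?I \<times> ?I. W z * D z)" .
  have "(\<Sum>z\<in>?I \<times> ?I. (W z)\<^sup>2) = (\<Sum>\<mu>\<in>?I. \<Sum>\<nu>\<in>?I. (W (\<mu>, \<nu>))\<^sup>2)"
    by (simp add: sum.cartesian_product split_def)
  also have "\<dots> = (\<Sum>\<mu>\<in>?I. \<Sum>\<nu>\<in>?I. \<Sum>k\<in>?K. \<Sum>l\<in>?K. (x k \<mu> * x l \<mu>) * (y k \<nu> * y l \<nu>))"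
    by (simp add: W_def power2_eq_square sum_product mult_ac)
  also have "\<dots> = (\<Sum>\<mu>\<in>?I. \<Sum>k\<in>?K. \<Sum>\<nu>\<in>?I. \<Sum>l\<in>?K. (x k \<mu> * x l \<mu>) * (y k \<nu> * y l \<nu>))"
    by (intro sum.cong refl sum.swap)
  also have "\<dots> = (\<Sum>\<mu>\<in>?I. \<Sum>k\<in>?K. \<Sum>l\<in>?K. \<Sum>\<nu>\<in>?I. (x k \<mu> * x l \<mu>) * (y k \<nu> * y l \<nu>))"
    by (intro sum.cong refl sum.swap)
  also have "\<dots> = (\<Sum>k\<in>?K. \<Sum>\<mu>\<in>?I. \<Sum>l\<in>?K. \<Sum>\<nu>\<in>?I. (x k \<mu> * x l \<mu>) * (y k \<nu> * y l \<nu>))"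
    by (rule sum.swap)
  also have "\<dots> = (\<Sum>k\<in>?K. \<Sum>l\<in>?K. \<Sum>\<mu>\<in>?I. \<Sum>\<nu>\<in>?I. (x k \<mu> * x l \<mu>) * (y k \<nu> * y l \<nu>))"
    by (intro sum.cong refl sum.swap)
  \<comment> \<open>The reordered fourfold sum factors into inner products of the x_k and of the
    y_k, so only k = l survives.\<close>
  also have "\<dots> = (\<Sum>k\<in>?K. \<Sum>l\<in>?K. (\<Sum>\<mu>\<in>?I. x k \<mu> * x l \<mu>) * (\<Sum>\<nu>\<in>?I. y k \<nu> * y l \<nu>))"
    by (simp add: sum_product)
  also have "\<dots> = (\<Sum>k\<in>?K. \<Sum>l\<in>?K. if k = l then 1 else 0)"
  proof (intro sum.cong refl)
    fix k l assume "k \<in> ?K" "l \<in> ?K"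
    then show "(\<Sum>\<mu>\<in>?I. x k \<mu> * x l \<mu>) * (\<Sum>\<nu>\<in>?I. y k \<nu> * y l \<nu>) = (if k = l then 1 else 0 :: real)"
      unfolding ox[OF \<open>k \<in> ?K\<close> \<open>l \<in> ?K\<close>] oy[OF \<open>k \<in> ?K\<close> \<open>l \<in> ?K\<close>] by simp
  qed
  also have "\<dots> = real n - real t" using t by (simp add: of_nat_diff)
  finally have WW: "(\<Sum>z\<in>?I \<times> ?I. (W z)\<^sup>2) = real n - real t" .
  have "(\<Sum>z\<in>?I \<times> ?I. (D z)\<^sup>2) \<le> (\<Sum>z\<in>?I \<times> ?I. \<alpha>\<^sup>2)"
  proof (rule sum_mono)
    fix z assume "z \<in> ?I \<times> ?I"
    then have "\<bar>D z\<bar> \<le> \<alpha>" using c by (auto simp: D_def)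
    then show "(D z)\<^sup>2 \<le> \<alpha>\<^sup>2" using a by (metis abs_le_square_iff abs_of_nonneg)
  qed
  also have "\<dots> = (2 * real n * \<alpha>)\<^sup>2" by (simp add: power2_eq_square)
  finally have DD: "(\<Sum>z\<in>?I \<times> ?I. (D z)\<^sup>2) \<le> (2 * real n * \<alpha>)\<^sup>2" .
  have "(\<Sum>z\<in>?I \<times> ?I. W z * D z)\<^sup>2 \<le> (\<Sum>z\<in>?I \<times> ?I. (W z)\<^sup>2) * (\<Sum>z\<in>?I \<times> ?I. (D z)\<^sup>2)"
    by (rule Cauchy_Schwarz_ineq_sum)
  also have "\<dots> \<le> (real n - real t) * (2 * real n * \<alpha>)\<^sup>2"
    unfolding WW using DD t by (intro mult_left_mono) auto
  finally have "sqrt ((\<Sum>z\<in>?I \<times> ?I. W z * D z)\<^sup>2) \<le> sqrt ((real n - real t) * (2 * real n * \<alpha>)\<^sup>2)"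
    by (rule real_sqrt_le_mono)
  then show ?thesis unfolding e using a by (simp add: real_sqrt_mult mult_ac)
qed

section \<open>The learner\<close>

text \<open>The distance estimates require Hermitian matrices, so the tomography outputs must be
  states wherever they have positive probability.\<close>

lemma qstate_run:
  assumes p: "state_learner t p" and \<sigma>: "qstate t \<sigma>" and s: "s \<in> set_pmf (run \<sigma> p)"
  shows "qstate t s"
  using p s
proof (induction p)
  case (Measure Es k)
  then obtain i where i: "i \<in> set_pmf (outcome_pmf Es \<sigma>)" "s \<in> set_pmf (run \<sigma> (k i))" by auto
  have "povm (2 ^ t) Es" using Measure.prems by simp
  from outcome_index_less[OF this \<sigma> i(1)] show ?case
    using Measure.IH[of "k i"] Measure.prems i(2) by simp
qed auto

lemma trace_dist_commute:
  assumes A: "A \<in> carrier_mat n m" and B: "B \<in> carrier_mat n m"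
  shows "trace_dist A B = trace_dist B A"
proof -
  let ?C = "B - A"
  have C: "?C \<in> carrier_mat n m" by (rule minus_carrier_mat[OF A])
  have "A - B = (- 1) \<cdot>\<^sub>m ?C" using A B by (intro eq_matI) auto
  moreover have "mat_adjoint ((- 1) \<cdot>\<^sub>m ?C) * ((- 1) \<cdot>\<^sub>m ?C) = (cnj (- 1) * - 1) \<cdot>\<^sub>m (mat_adjoint ?C * ?C)"
    unfolding adjoint_smult mult_smult_assoc_mat[OF adjoint_carrier[OF C] smult_carrier_mat[OF C]]
      mult_smult_distrib[OF adjoint_carrier[OF C] C] smult_smult_mat ..
  moreover have "(cnj (- 1) * - 1) \<cdot>\<^sub>m (mat_adjoint ?C * ?C) = mat_adjoint ?C * ?C"
    by (intro eq_matI) simp_all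
  ultimately show ?thesis by (simp add: trace_dist_def trace_norm_def)
qed

text \<open>Squaring reduces the claim to 2 q^2 - q (1 + 3 \<epsilon> / 2) + 9 \<epsilon>^2 / 16
  \<ge> 0. The left side decreases on the relevant range of q, so the endpoint c = 0.28 \<epsilon>^2
  is the worst case.\<close>

lemma infidelity_bound:
  fixes q \<epsilon> :: real
  assumes q: "0 \<le> q" "q \<le> 28 / 100 * \<epsilon>\<^sup>2" and \<epsilon>: "0 < \<epsilon>" "\<epsilon> \<le> 1"
  shows "\<epsilon> / 4 + (sqrt ((1 - q) * q) + q) \<le> \<epsilon>"
proof -
  define c where "c = 28 / 100 * \<epsilon>\<^sup>2"
  have e2: "\<epsilon>\<^sup>2 \<le> \<epsilon>" using \<epsilon> by (simp add: power2_eq_square mult_left_le)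
  have qc: "q \<le> c" "c \<le> 28 / 100 * \<epsilon>" using q e2 by (auto simp: c_def)
  \<comment> \<open>The endpoint value divided by \<epsilon>^2 has the coefficients 2 * 0.28^2 =
    0.1568, 1.5 * 0.28 = 0.42 and 9/16 - 0.28 = 0.2825. Its value at \<epsilon> = 1 is 0.0193, and
    the rest contains the factor 1 - \<epsilon>.\<close>
  have "0 \<le> (1 - \<epsilon>) * (42 / 100 - 1568 / 10000 * (1 + \<epsilon>))" using \<epsilon> by (intro mult_nonneg_nonneg) auto
  moreover have "1568 / 10000 * \<epsilon>\<^sup>2 - 42 / 100 * \<epsilon> + 2825 / 10000 =
      (1 - \<epsilon>) * (42 / 100 - 1568 / 10000 * (1 + \<epsilon>)) + 193 / 10000"
    by (simp add: field_simps power2_eq_square)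
  ultimately have "0 \<le> 1568 / 10000 * \<epsilon>\<^sup>2 - 42 / 100 * \<epsilon> + 2825 / 10000" by linarith
  then have "0 \<le> \<epsilon>\<^sup>2 * (1568 / 10000 * \<epsilon>\<^sup>2 - 42 / 100 * \<epsilon> + 2825 / 10000)" by simp
  also have "\<dots> = 2 * c\<^sup>2 - c * (1 + 3 / 2 * \<epsilon>) + 9 / 16 * \<epsilon>\<^sup>2"
    by (simp add: c_def field_simps power2_eq_square)
  finally have g: "0 \<le> 2 * c\<^sup>2 - c * (1 + 3 / 2 * \<epsilon>) + 9 / 16 * \<epsilon>\<^sup>2" .
  \<comment> \<open>The difference between the quadratic at q and at c; since q and c are at most
    0.28 \<epsilon>, the second factor is nonnegative.\<close>
  have "0 \<le> (c - q) * ((1 + 3 / 2 * \<epsilon>) - 2 * (q + c))"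
    using qc \<epsilon> by (intro mult_nonneg_nonneg) auto
  moreover have "(3 / 4 * \<epsilon> - q)\<^sup>2 - (1 - q) * q = (2 * c\<^sup>2 - c * (1 + 3 / 2 * \<epsilon>) + 9 / 16 * \<epsilon>\<^sup>2)
      + (c - q) * ((1 + 3 / 2 * \<epsilon>) - 2 * (q + c))"
    by (simp add: field_simps power2_eq_square)
  ultimately have "(1 - q) * q \<le> (3 / 4 * \<epsilon> - q)\<^sup>2" using g by linarith
  moreover have "0 \<le> 3 / 4 * \<epsilon> - q" using qc \<epsilon> by simp
  ultimately have "sqrt ((1 - q) * q) \<le> 3 / 4 * \<epsilon> - q" by (intro real_le_lsqrt)
  then show ?thesis by simp
qed

section \<open>Estimating the correlations from counts\<close>

definition majorana_indices :: "nat \<Rightarrow> (nat \<times> nat) list" where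
  "majorana_indices n = List.product [1..<2 * n + 1] [1..<2 * n + 1]"

definition correlation_povms :: "nat \<Rightarrow> complex mat list list" where
  "correlation_povms n = map (\<lambda>(\<mu>, \<nu>). real_part_povm (2 ^ n) (majorana_pair n \<mu> \<nu>)) (majorana_indices n)"

text \<open>Solves the outcome probability (1 + h) / 2 for h, which doubles the error of the
  frequency. Counts are matched to index pairs by their position in
  \<open>majorana_indices\<close>.\<close>

definition estimate :: "nat \<Rightarrow> nat \<Rightarrow> nat list \<Rightarrow> nat \<Rightarrow> nat \<Rightarrow> real" where
  "estimate n M cs \<mu> \<nu> = 2 * (real (the (map_of (zip (majorana_indices n) cs) (\<mu>, \<nu>))) / real M) - 1"

lemma set_majorana_indices: "set (majorana_indices n) = {1..2 * n} \<times> {1..2 * n}"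
  by (auto simp: majorana_indices_def)

lemma povm_correlation:
  assumes "Es \<in> set (correlation_povms n)"
  shows "povm (2 ^ n) Es"
  using assms by (auto simp: correlation_povms_def set_majorana_indices intro!: povm_real_part majorana_pair_unitary)

lemma length_correlation_povms: "length (correlation_povms n) = 4 * n\<^sup>2"
  by (simp add: correlation_povms_def majorana_indices_def power2_eq_square)

lemma estimate_accurate:
  assumes R: "qstate n R"
    and cs: "list_all2 (\<lambda>Es c. \<bar>real c / real M - pmf (outcome_pmf Es R) 0\<bar> < \<beta>) (correlation_povms n) cs"
    and \<mu>\<nu>: "\<mu> \<in> {1..2 * n}" "\<nu> \<in> {1..2 * n}"
  shows "\<bar>correlation n R \<mu> \<nu> - estimate n M cs \<mu> \<nu>\<bar> \<le> 2 * \<beta>"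
proof -
  have Rp: "psd_mat (2 ^ n) R" "trace_mat R = 1" using R by (auto simp: qstate_def)
  have len: "length (majorana_indices n) = length cs"
    using list_all2_lengthD[OF cs] by (simp add: correlation_povms_def)
  have "(\<mu>, \<nu>) \<in> set (majorana_indices n)" using \<mu>\<nu> by (simp add: set_majorana_indices)
  then obtain i where i: "i < length (majorana_indices n)" "majorana_indices n ! i = (\<mu>, \<nu>)"
    by (metis in_set_conv_nth)
  have "distinct (majorana_indices n)" by (simp add: majorana_indices_def distinct_product)
  from map_of_zip_nth[OF len this, of i] have m: "map_of (zip (majorana_indices n) cs) (\<mu>, \<nu>) = Some (cs ! i)"
    using i len by simp
  have "\<bar>real (cs ! i) / real M - pmf (outcome_pmf (correlation_povms n ! i) R) 0\<bar> < \<beta>"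
    using list_all2_nthD[OF cs, of i] i(1) by (simp add: correlation_povms_def)
  moreover have "correlation_povms n ! i = real_part_povm (2 ^ n) (majorana_pair n \<mu> \<nu>)"
    using i by (simp add: correlation_povms_def)
  ultimately have "\<bar>real (cs ! i) / real M - (1 + correlation n R \<mu> \<nu>) / 2\<bar> < \<beta>"
    by (simp add: pmf_real_part_povm[OF majorana_pair_unitary[OF \<mu>\<nu>] Rp] correlation_def)
  moreover have "\<bar>x - (1 + c) / 2\<bar> < \<beta> \<Longrightarrow> \<bar>c - (2 * x - 1)\<bar> \<le> 2 * \<beta>" for x c
    by (auto simp: abs_less_iff abs_le_iff field_simps)
  ultimately show ?thesis unfolding estimate_def m option.sel by blast
qed

text \<open>A function of the estimates, not of the unknown state. The identity is the default when
  no candidate passes the threshold; it keeps the protocol legitimate on branches where the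
  estimation failed.\<close>

definition select_gaussian :: "real \<Rightarrow> nat \<Rightarrow> nat \<Rightarrow> (nat \<Rightarrow> nat \<Rightarrow> real) \<Rightarrow> complex mat" where
  "select_gaussian \<theta> n t c =
     (if \<exists>G Q. gaussian_pair n G Q \<and> \<theta> \<le> zero_score n t Q c
      then SOME G. \<exists>Q. gaussian_pair n G Q \<and> \<theta> \<le> zero_score n t Q c else 1\<^sub>m (2 ^ n))"

lemma select_gaussian:
  assumes "gaussian_pair n G Q" "\<theta> \<le> zero_score n t Q c"
  shows "\<exists>Q. gaussian_pair n (select_gaussian \<theta> n t c) Q \<and> \<theta> \<le> zero_score n t Q c"
proof -
  have ex: "\<exists>G Q. gaussian_pair n G Q \<and> \<theta> \<le> zero_score n t Q c" using assms by blast
  from someI_ex[OF this] show ?thesis using ex by (simp add: select_gaussian_def)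
qed

lemma select_gaussian_unitary: "unitary_mat (2 ^ n) (select_gaussian \<theta> n t c)"
proof (cases "\<exists>G Q. gaussian_pair n G Q \<and> \<theta> \<le> zero_score n t Q c")
  case True
  then obtain G Q where "gaussian_pair n G Q" "\<theta> \<le> zero_score n t Q c" by blast
  from select_gaussian[OF this] show ?thesis by (auto simp: gaussian_pair_def)
next
  case False
  then have "select_gaussian \<theta> n t c = 1\<^sub>m (2 ^ n)" unfolding select_gaussian_def by (rule if_not_P)
  then show ?thesis by (simp add: unitary_mat_def)
qed

text \<open>Tomography of the reduced state on copies of the full one: an effect E is measured as G
  (E \<otimes> 1) G^\<dagger>, and a result s is returned as the compressible state G (s \<otimes>
  |0><0|) G^\<dagger>.\<close>

definition compressed_tomography :: "nat \<Rightarrow> nat \<Rightarrow> complex mat \<Rightarrow> complex mat protocol \<Rightarrow> complex mat protocol" where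
  "compressed_tomography n t G p =
     reinterpret_protocol (isometry_family.extend (2 ^ n) (2 ^ (n - t)) (frame n t G))
       (\<lambda>s. frame n t G 0 * s * mat_adjoint (frame n t G 0)) p"

lemma state_learner_compressed_tomography:
  assumes "t \<le> n" and G: "unitary_mat (2 ^ n) G" and "state_learner t p"
  shows "state_learner n (compressed_tomography n t G p)"
proof -
  interpret isometry_family "2 ^ n" "2 ^ t" "2 ^ (n - t)" "frame n t G" by (rule frame_family) fact+
  show ?thesis
    unfolding compressed_tomography_def using assms(3)
    by (rule state_learner_reinterpret_protocol) (auto intro: povm_extend qstate_isometry J[OF B] JJ[OF B])
qed

text \<open>Triangle inequality through the embedded exact reduced state:
  \<open>trace_dist_reduce_le\<close> and \<open>infidelity_bound\<close> leave \<epsilon> / 4, and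
  embedding does not enlarge the tomography error.\<close>

lemma compressed_tomography_accurate:
  assumes t: "t < n" and \<epsilon>: "0 < \<epsilon>" "\<epsilon> \<le> 1" and GQ: "gaussian_pair n G Q" and R: "qstate n R"
    and score: "real n - real t - 56 / 100 * \<epsilon>\<^sup>2 \<le> zero_score n t Q (correlation n R)"
    and p: "state_learner t p" "\<And>\<sigma>. qstate t \<sigma> \<Longrightarrow> learns_within p \<sigma> (\<epsilon> / 4) \<delta>"
  shows "1 - \<delta> \<le> measure_pmf.prob (run R (compressed_tomography n t G p)) {\<rho>'. trace_dist \<rho>' R \<le> \<epsilon>}"
proof -
  have G: "unitary_mat (2 ^ n) G" using GQ by (simp add: gaussian_pair_def)
  interpret isometry_family "2 ^ n" "2 ^ t" "2 ^ (n - t)" "frame n t G"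
    by (rule frame_family) (use t G in auto)
  have Rp: "psd_mat (2 ^ n) R" and Rtr: "trace_mat R = 1" using R by (auto simp: qstate_def)
  note Rc = psd_matD(1)[OF Rp]
  let ?J = "frame n t G 0"
  define \<sigma> where "\<sigma> = reduce R"
  have \<sigma>: "qstate t \<sigma>" using psd_reduce[OF Rp] trace_reduce[OF Rc] Rtr by (simp add: qstate_def \<sigma>_def)
  then have \<sigma>p: "psd_mat (2 ^ t) \<sigma>" by (simp add: qstate_def)
  define q where "q = 1 - Re (trace_mat (mat_adjoint ?J * R * ?J))"
  have "q \<le> (\<Sum>k=Suc t..n. (1 - Re (trace_mat (rotated_Z n G k * R))) / 2)"
    unfolding q_def by (rule one_minus_zero_weight_le) (use t G R in auto)
  also have "\<dots> = (real n - real t - zero_score n t Q (correlation n R)) / 2"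
    unfolding zero_score_correlation[OF GQ Rc] using t
    by (simp add: sum_subtractf of_nat_diff flip: sum_divide_distrib)
  finally have q: "q \<le> 28 / 100 * \<epsilon>\<^sup>2" using score by simp
  have "trace_dist R (?J * \<sigma> * mat_adjoint ?J) \<le> sqrt ((1 - q) * q) + q"
    using trace_dist_reduce_le(1)[OF Rp Rtr] by (simp add: q_def \<sigma>_def)
  moreover have "0 \<le> q" using trace_dist_reduce_le(2)[OF Rp Rtr] by (simp add: q_def)
  ultimately have dist: "\<epsilon> / 4 + trace_dist (?J * \<sigma> * mat_adjoint ?J) R \<le> \<epsilon>"
    using infidelity_bound[OF _ q \<epsilon>] trace_dist_commute[OF Rc up_carrier[OF B psd_matD(1)[OF \<sigma>p]]] by simp
  have h: "trace_mat (extend E * R) = trace_mat (E * \<sigma>)" if "psd_mat (2 ^ t) E" for E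
    unfolding \<sigma>_def by (rule trace_extend_mult[OF psd_matD(1)[OF that] Rc])
  have "1 - \<delta> \<le> measure_pmf.prob (run \<sigma> p) {s. trace_dist s \<sigma> \<le> \<epsilon> / 4}"
    using p(2)[OF \<sigma>] by (simp add: learns_within_def)
  also have "\<dots> \<le> measure_pmf.prob (run \<sigma> p) {s. trace_dist (?J * s * mat_adjoint ?J) R \<le> \<epsilon>}"
  proof (rule measure_pmf.finite_measure_mono_AE)
    show "AE s in measure_pmf (run \<sigma> p). s \<in> {s. trace_dist s \<sigma> \<le> \<epsilon> / 4} \<longrightarrow>
        s \<in> {s. trace_dist (?J * s * mat_adjoint ?J) R \<le> \<epsilon>}"
    proof (rule AE_pmfI, rule impI)
      fix s assume s: "s \<in> set_pmf (run \<sigma> p)" "s \<in> {s. trace_dist s \<sigma> \<le> \<epsilon> / 4}"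
      have sp: "psd_mat (2 ^ t) s" using qstate_run[OF p(1) \<sigma> s(1)] by (simp add: qstate_def)
      have "trace_dist (?J * s * mat_adjoint ?J) R \<le>
          trace_dist (?J * s * mat_adjoint ?J) (?J * \<sigma> * mat_adjoint ?J) + trace_dist (?J * \<sigma> * mat_adjoint ?J) R"
        by (rule trace_dist_triangle[OF psd_matD[OF psd_conj[OF sp J[OF B]]] psd_matD[OF psd_conj[OF \<sigma>p J[OF B]]] psd_matD[OF Rp]])
      also have "trace_dist (?J * s * mat_adjoint ?J) (?J * \<sigma> * mat_adjoint ?J) \<le> trace_dist s \<sigma>"
        by (rule trace_dist_isometry_le[OF psd_matD[OF sp] psd_matD[OF \<sigma>p] J[OF B] JJ[OF B]])
      finally show "s \<in> {s. trace_dist (?J * s * mat_adjoint ?J) R \<le> \<epsilon>}" using dist s(2) by simp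
    qed
  qed simp
  also have "\<dots> = measure_pmf.prob (run R (compressed_tomography n t G p)) {\<rho>'. trace_dist \<rho>' R \<le> \<epsilon>}"
  proof -
    have "run R (compressed_tomography n t G p) = map_pmf (\<lambda>s. ?J * s * mat_adjoint ?J) (run \<sigma> p)"
      unfolding compressed_tomography_def by (rule run_reinterpret_protocol[OF p(1) \<sigma> h])
    then show ?thesis by (simp add: vimage_def)
  qed
  finally show ?thesis .
qed

text \<open>The slack \<kappa> stands in for a minimiser. A real infimum can be approached by
  members only of a nonempty set bounded below, so both properties are established before a state
  within \<tau> + \<kappa> is picked.\<close>

lemma near_compressible_score:
  assumes t: "t < n" and R: "qstate n R" and \<kappa>: "0 < \<kappa>"
    and near: "(INF \<sigma> \<in> compressible_states n t. trace_dist R \<sigma>) \<le> \<tau>"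
  shows "\<exists>G Q. gaussian_pair n G Q \<and>
    (real n - real t) * (1 - 2 * (\<tau> + \<kappa>)) \<le> zero_score n t Q (correlation n R)"
proof -
  have Rp: "psd_mat (2 ^ n) R" using R by (simp add: qstate_def)
  note Rc = psd_matD(1)[OF Rp]
  have tn: "t \<le> n" using t by simp
  have nn: "0 \<le> trace_dist R S" if S_in: "S \<in> compressible_states n t" for S
  proof -
    obtain G s where G: "gaussian_unitary n G" and s: "qstate t s"
      and S: "S = G * (s \<otimes>\<^sub>m zero_proj (n - t)) * mat_adjoint G"
      using S_in by (auto simp: compressible_states_def)
    have U: "unitary_mat (2 ^ n) G" and Gc: "G \<in> carrier_mat (2 ^ n) (2 ^ n)"
      using G by (auto simp: gaussian_unitary_def unitary_mat_def)
    interpret isometry_family "2 ^ n" "2 ^ t" "2 ^ (n - t)" "frame n t G" by (rule frame_family[OF tn U])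
    have sp: "psd_mat (2 ^ t) s" using s by (simp add: qstate_def)
    have "psd_mat (2 ^ n) S"
      unfolding S compressed_state_eq[OF tn Gc psd_matD(1)[OF sp]] by (rule psd_conj[OF sp J[OF B]])
    note Sp = psd_matD[OF this]
    have "0 \<le> trace_norm (R - S)"
      by (rule trace_norm_nonneg[OF minus_carrier_mat[OF Sp(1)]])
        (simp add: adjoint_minus[OF Rc Sp(1)] Sp(2) psd_matD(2)[OF Rp])
    then show ?thesis by (simp add: trace_dist_def)
  qed
  have zp: "qstate t (zero_proj t)"
  proof -
    have c: "zero_proj t \<in> carrier_mat (2 ^ t) (2 ^ t)" by (simp add: zero_proj_def)
    have a: "mat_adjoint (zero_proj t) = zero_proj t" by (intro eq_matI) (auto simp: zero_proj_def)
    have "zero_proj t * zero_proj t = zero_proj t"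
    proof (rule eq_matI)
      fix i j assume "i < dim_row (zero_proj t)" "j < dim_col (zero_proj t)"
      then have ij: "i < 2 ^ t" "j < 2 ^ t" by (simp_all add: zero_proj_def)
      have "(zero_proj t * zero_proj t) $$ (i, j) = (\<Sum>l<(2 :: nat) ^ t. if l = 0 then (if i = 0 \<and> j = 0 then 1 else 0) else 0)"
        unfolding mult_index[OF c c ij] using ij by (intro sum.cong) (auto simp: zero_proj_def)
      also have "\<dots> = zero_proj t $$ (i, j)" using ij by (subst sum.delta) (auto simp: zero_proj_def)
      finally show "(zero_proj t * zero_proj t) $$ (i, j) = zero_proj t $$ (i, j)" .
    qed (simp_all add: zero_proj_def)
    then have "psd_mat (2 ^ t) (zero_proj t)" using psd_gram[OF c] by (simp add: a)
    moreover have "trace_mat (zero_proj t) = (\<Sum>l<(2 :: nat) ^ t. if l = 0 then 1 else 0)"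
      unfolding trace_mat_eq[OF c] by (intro sum.cong) (auto simp: zero_proj_def)
    then have "trace_mat (zero_proj t) = 1" by (subst (asm) sum.delta) auto
    ultimately show ?thesis by (simp add: qstate_def)
  qed
  have "gaussian_unitary n (1\<^sub>m (2 ^ n))" using gaussian_pair_one gaussian_unitary_iff by blast
  then have ne: "compressible_states n t \<noteq> {}" using zp by (auto simp: compressible_states_def)
  have bdd: "bdd_below (trace_dist R ` compressible_states n t)" using nn by (intro bdd_belowI2[of _ 0])
  have "(INF \<sigma> \<in> compressible_states n t. trace_dist R \<sigma>) < \<tau> + \<kappa>" using near \<kappa> by simp
  then obtain S where "S \<in> compressible_states n t" and d: "trace_dist R S < \<tau> + \<kappa>"
    using cINF_less_iff[OF ne bdd] by blast
  then obtain G s where G: "gaussian_unitary n G" and s: "qstate t s"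
    and S: "S = G * (s \<otimes>\<^sub>m zero_proj (n - t)) * mat_adjoint G"
    by (auto simp: compressible_states_def)
  obtain Q where GQ: "gaussian_pair n G Q" using G gaussian_unitary_iff by blast
  have U: "unitary_mat (2 ^ n) G" using GQ by (simp add: gaussian_pair_def)
  have "(real n - real t) * (1 - 2 * (\<tau> + \<kappa>)) = (\<Sum>k=Suc t..n. 1 - 2 * (\<tau> + \<kappa>))"
    using t by (simp add: of_nat_diff)
  also have "\<dots> \<le> (\<Sum>k=Suc t..n. Re (trace_mat (rotated_Z n G k * R)))"
  proof (rule sum_mono)
    fix k assume "k \<in> {Suc t..n}"
    then have "t < k" "k \<le> n" by auto
    from rotated_Z_lower_bound[OF this U s R] d
    show "1 - 2 * (\<tau> + \<kappa>) \<le> Re (trace_mat (rotated_Z n G k * R))" unfolding S by simp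
  qed
  also have "\<dots> = zero_score n t Q (correlation n R)" unfolding zero_score_correlation[OF GQ Rc] ..
  finally show ?thesis using GQ by blast
qed

section \<open>The complete learner, its accuracy and its copy count\<close>

definition learner :: "nat \<Rightarrow> real \<Rightarrow> nat \<Rightarrow> nat \<Rightarrow> complex mat protocol \<Rightarrow> complex mat protocol" where
  "learner M \<theta> n t p = bind_protocol (counts_first M (correlation_povms n))
     (\<lambda>cs. compressed_tomography n t (select_gaussian \<theta> n t (estimate n M cs)) p)"

lemma state_learner_learner:
  assumes "t \<le> n" "state_learner t p"
  shows "state_learner n (learner M \<theta> n t p)"
  unfolding learner_def
  by (intro state_learner_bind_protocol measures_qubits_counts_first povm_correlation
      state_learner_compressed_tomography select_gaussian_unitary assms)

lemma uses_at_most_learner: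
  assumes "uses_at_most p N"
  shows "uses_at_most (learner M \<theta> n t p) (4 * n\<^sup>2 * M + N)"
  unfolding learner_def
  by (rule uses_at_most_bind_protocol[OF uses_at_most_counts_first[of M "correlation_povms n", unfolded length_correlation_povms]])
    (simp add: compressed_tomography_def uses_at_most_reinterpret_protocol[OF assms])

text \<open>The failure probability is split evenly between inaccurate correlations and the
  tomography that follows accurate ones.\<close>

lemma learner_accurate:
  assumes t: "1 \<le> t" "t < n" and \<epsilon>: "0 < \<epsilon>" "\<epsilon> \<le> 1" and \<delta>: "0 < \<delta>" and R: "qstate n R"
    and near: "(INF \<sigma> \<in> compressible_states n t. trace_dist R \<sigma>) \<le> \<epsilon>\<^sup>2 / (4 * (real n - real t))"
    and M: "20000 * (real n ^ 3 / \<epsilon> ^ 4) * ln (16 * (real n)\<^sup>2 / \<delta>) \<le> real M" "0 < M"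
    and p: "state_learner t p" "\<And>\<sigma>. qstate t \<sigma> \<Longrightarrow> learns_within p \<sigma> (\<epsilon> / 4) (\<delta> / 2)"
  shows "learns_within (learner M (real n - real t - 54 / 100 * \<epsilon>\<^sup>2) n t p) R \<epsilon> \<delta>"
proof -
  \<comment> \<open>Accuracy for the correlations, chosen such that 2 n sqrt n \<alpha> = 0.02
    \<epsilon>^2; by \<open>zero_score_diff_le\<close> this bounds the score error for all
    orthogonal Q at once.\<close>
  define \<alpha> where "\<alpha> = \<epsilon>\<^sup>2 / (100 * (real n * sqrt (real n)))"
  let ?\<theta> = "real n - real t - 54 / 100 * \<epsilon>\<^sup>2"
  have n: "0 < real n" using t by simp
  have nt: "0 < real n - real t" using t by simp
  have \<alpha>: "0 < \<alpha>" using n \<epsilon> by (simp add: \<alpha>_def)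
  have err: "2 * real n * sqrt (real n - real t) * \<alpha> \<le> 2 / 100 * \<epsilon>\<^sup>2"
  proof -
    have "sqrt (real n - real t) \<le> sqrt (real n)" by simp
    then have "2 * real n * sqrt (real n - real t) * \<alpha> \<le> 2 * real n * sqrt (real n) * \<alpha>"
      using n \<alpha> by (intro mult_right_mono mult_left_mono) auto
    also have "\<dots> = 2 / 100 * \<epsilon>\<^sup>2" using n by (simp add: \<alpha>_def)
    finally show ?thesis .
  qed
  have \<alpha>2: "\<alpha>\<^sup>2 = \<epsilon> ^ 4 / (10000 * real n ^ 3)"
  proof -
    have "\<alpha>\<^sup>2 = (\<epsilon>\<^sup>2)\<^sup>2 / (10000 * ((real n)\<^sup>2 * (sqrt (real n))\<^sup>2))"
      by (simp add: \<alpha>_def power_divide power_mult_distrib)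
    also have "\<dots> = \<epsilon> ^ 4 / (10000 * real n ^ 3)"
      using n by (simp add: power2_eq_square power3_eq_cube power4_eq_xxxx mult.assoc)
    finally show ?thesis .
  qed
  \<comment> \<open>Frequencies need accuracy \<alpha> / 2, because a correlation is twice a
    probability minus 1.\<close>
  let ?B = "{cs. \<not> list_all2 (\<lambda>Es c. \<bar>real c / real M - pmf (outcome_pmf Es R) 0\<bar> < \<alpha> / 2) (correlation_povms n) cs}"
  have "measure_pmf.prob (run R (counts_first M (correlation_povms n))) ?B
      \<le> real (4 * n\<^sup>2) * (2 * exp (- 2 * real M * (\<alpha> / 2)\<^sup>2))"
    using prob_counts_first[OF M(2), of "\<alpha> / 2" R "correlation_povms n"] \<alpha> by (simp add: length_correlation_povms)
  also have "\<dots> \<le> \<delta> / 2"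
  proof -
    \<comment> \<open>Hoeffding's exponent is M \<alpha>^2 / 2, and 2 / \<alpha>^2 = 20000 n^3 /
      \<epsilon>^4. The 16 makes 4 n^2 entries, each with the prefactor 2 of the two-sided bound,
      fail with total probability at most \<delta> / 2.\<close>
    have "ln (16 * (real n)\<^sup>2 / \<delta>) = 20000 * (real n ^ 3 / \<epsilon> ^ 4) * ln (16 * (real n)\<^sup>2 / \<delta>) * (\<alpha>\<^sup>2 / 2)"
      unfolding \<alpha>2 using n \<epsilon> by simp
    also have "\<dots> \<le> real M * (\<alpha>\<^sup>2 / 2)" by (rule mult_right_mono[OF M(1)]) simp
    finally have "- 2 * real M * (\<alpha> / 2)\<^sup>2 \<le> - ln (16 * (real n)\<^sup>2 / \<delta>)"
      by (simp add: power2_eq_square mult_ac)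
    then have "exp (- 2 * real M * (\<alpha> / 2)\<^sup>2) \<le> exp (- ln (16 * (real n)\<^sup>2 / \<delta>))" by simp
    also have "\<dots> = \<delta> / (16 * (real n)\<^sup>2)" using n \<delta> by (simp add: exp_minus)
    finally have "real (4 * n\<^sup>2) * (2 * exp (- 2 * real M * (\<alpha> / 2)\<^sup>2)) \<le> real (4 * n\<^sup>2) * (2 * (\<delta> / (16 * (real n)\<^sup>2)))"
      by (intro mult_left_mono) auto
    also have "\<dots> = \<delta> / 2" using n by simp
    finally show ?thesis .
  qed
  finally have fail: "measure_pmf.prob (run R (counts_first M (correlation_povms n))) ?B \<le> \<delta> / 2" .
  have Rc: "R \<in> carrier_mat (2 ^ n) (2 ^ n)" using R by (auto simp: qstate_def psd_mat_def)
  let ?bad = "{\<rho>'. \<not> trace_dist \<rho>' R \<le> \<epsilon>}"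
  have "measure_pmf.prob (run R (learner M ?\<theta> n t p)) ?bad
      \<le> measure_pmf.prob (run R (counts_first M (correlation_povms n))) ?B + \<delta> / 2"
    unfolding learner_def run_bind_protocol
  proof (rule prob_bind_pmf_le)
    fix cs assume "cs \<notin> ?B"
    then have good: "list_all2 (\<lambda>Es c. \<bar>real c / real M - pmf (outcome_pmf Es R) 0\<bar> < \<alpha> / 2) (correlation_povms n) cs" by simp
    let ?c = "estimate n M cs"
    have acc: "\<bar>correlation n R \<mu> \<nu> - ?c \<mu> \<nu>\<bar> \<le> \<alpha>" if "\<mu> \<in> {1..2 * n}" "\<nu> \<in> {1..2 * n}" for \<mu> \<nu>
      using estimate_accurate[OF R good that] by simp
    have close: "\<bar>zero_score n t Q (correlation n R) - zero_score n t Q ?c\<bar> \<le> 2 / 100 * \<epsilon>\<^sup>2"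
      if "gaussian_pair n G Q" for G Q
      using zero_score_diff_le[of Q n t \<alpha> "correlation n R" ?c] that t \<alpha> acc err by (force simp: gaussian_pair_def)
    \<comment> \<open>With slack \<epsilon>^2 / (100 (n - t)) the loss 2 (n - t) (\<tau> + \<kappa>)
      is 0.50 \<epsilon>^2 + 0.02 \<epsilon>^2.\<close>
    obtain G0 Q0 where GQ0: "gaussian_pair n G0 Q0"
      and "(real n - real t) * (1 - 2 * (\<epsilon>\<^sup>2 / (4 * (real n - real t)) + \<epsilon>\<^sup>2 / (100 * (real n - real t))))
        \<le> zero_score n t Q0 (correlation n R)"
      using near_compressible_score[OF t(2) R _ near, of "\<epsilon>\<^sup>2 / (100 * (real n - real t))"] \<epsilon> nt by auto
    moreover have "(real n - real t) * (1 - 2 * (\<epsilon>\<^sup>2 / (4 * (real n - real t)) + \<epsilon>\<^sup>2 / (100 * (real n - real t)))) =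
        real n - real t - 52 / 100 * \<epsilon>\<^sup>2"
    proof -
      have "x * (1 - 2 * (y / (4 * x) + y / (100 * x))) = x - 52 / 100 * y" if "0 < x" for x y :: real
        using that by (simp add: field_simps)
      from this[OF nt] show ?thesis .
    qed
    ultimately have "real n - real t - 52 / 100 * \<epsilon>\<^sup>2 \<le> zero_score n t Q0 (correlation n R)" by simp
    then have "?\<theta> \<le> zero_score n t Q0 ?c" using abs_le_D1[OF close[OF GQ0]] by simp
    from select_gaussian[OF GQ0 this] obtain Q where GQ: "gaussian_pair n (select_gaussian ?\<theta> n t ?c) Q"
      and "?\<theta> \<le> zero_score n t Q ?c" by blast
    then have "real n - real t - 56 / 100 * \<epsilon>\<^sup>2 \<le> zero_score n t Q (correlation n R)"
      using abs_le_D2[OF close[OF GQ]] by simp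
    from compressed_tomography_accurate[OF t(2) \<epsilon> GQ R this p]
    show "measure_pmf.prob (run R (compressed_tomography n t (select_gaussian ?\<theta> n t ?c) p)) ?bad \<le> \<delta> / 2"
      using measure_pmf.prob_compl[of "{\<rho>'. trace_dist \<rho>' R \<le> \<epsilon>}" "run R (compressed_tomography n t (select_gaussian ?\<theta> n t ?c) p)"]
      by (simp add: Collect_neg_eq Compl_eq_Diff_UNIV)
  qed (use \<delta> in simp)
  then have "measure_pmf.prob (run R (learner M ?\<theta> n t p)) ?bad \<le> \<delta>" using fail by simp
  then show ?thesis
    using measure_pmf.prob_compl[of "{\<rho>'. trace_dist \<rho>' R \<le> \<epsilon>}" "run R (learner M ?\<theta> n t p)"]
    by (simp add: learns_within_def Collect_neg_eq Compl_eq_Diff_UNIV)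
qed

theorem theorem58:
  shows "\<exists>C > 0. \<forall>tom N\<^sub>t\<^sub>o\<^sub>m. tomography_routine tom N\<^sub>t\<^sub>o\<^sub>m \<longrightarrow>
    (\<forall>(n::nat) (t::nat) (\<epsilon>::real) (\<delta>::real).
       1 \<le> t \<and> t < n \<and> 0 < \<epsilon> \<and> \<epsilon> \<le> 1 \<and> 0 < \<delta> \<and> \<delta> \<le> 1 \<longrightarrow>
       (\<exists>(N::nat) A.
          real N \<le> C * (real n ^ 5 / \<epsilon> ^ 4 * ln (real n ^ 2 / \<delta>)) + real (N\<^sub>t\<^sub>o\<^sub>m t (\<epsilon> / 4) (\<delta> / 2)) \<and>
          state_learner n A \<and> uses_at_most A N \<and>
          (\<forall>\<rho>. qstate n \<rho> \<and>
               (INF \<sigma> \<in> compressible_states n t. trace_dist \<rho> \<sigma>) \<le> \<epsilon> ^ 2 / (4 * (real n - real t))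
             \<longrightarrow> learns_within A \<rho> \<epsilon> \<delta>)))"
proof (intro exI[of _ "240004 :: real"] conjI allI impI)
  fix tom :: "nat \<Rightarrow> real \<Rightarrow> real \<Rightarrow> complex mat protocol" and N\<^sub>t\<^sub>o\<^sub>m and n t :: nat and \<epsilon> \<delta> :: real
  assume tom: "tomography_routine tom N\<^sub>t\<^sub>o\<^sub>m"
  assume "1 \<le> t \<and> t < n \<and> 0 < \<epsilon> \<and> \<epsilon> \<le> 1 \<and> 0 < \<delta> \<and> \<delta> \<le> 1"
  then have t: "1 \<le> t" "t < n" and \<epsilon>: "0 < \<epsilon>" "\<epsilon> \<le> 1" and \<delta>: "0 < \<delta>" "\<delta> \<le> 1" by auto
  let ?p = "tom t (\<epsilon> / 4) (\<delta> / 2)" and ?N' = "N\<^sub>t\<^sub>o\<^sub>m t (\<epsilon> / 4) (\<delta> / 2)"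
  have "\<epsilon> / 4 \<in> {0<..1}" "\<delta> / 2 \<in> {0<..1}" using \<epsilon> \<delta> by auto
  with tom t have p: "state_learner t ?p" "uses_at_most ?p ?N'"
    "\<And>\<sigma>. qstate t \<sigma> \<Longrightarrow> learns_within ?p \<sigma> (\<epsilon> / 4) (\<delta> / 2)"
    unfolding tomography_routine_def by blast+
  define a where "a = real n ^ 3 / \<epsilon> ^ 4"
  define L where "L = ln (real n ^ 2 / \<delta>)"
  \<comment> \<open>60000 is 20000 times the factor 3 from the comparison of logarithms below.
    Rounding up costs at most 1 \<le> a * L, whence 60001, and the 4 n^2 correlations give the
    constant 4 * 60001 = 240004.\<close>
  define M where "M = nat \<lceil>60000 * a * L\<rceil>"
  have n2: "2 \<le> real n" using t by simp
  have "1 \<le> real n ^ 3" "\<epsilon> ^ 4 \<le> 1" "0 < \<epsilon> ^ 4" using n2 \<epsilon> by (simp_all add: power_le_one)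
  then have a: "1 \<le> a" unfolding a_def by (simp add: le_divide_eq)
  have nd: "4 \<le> real n ^ 2 / \<delta>"
  proof -
    have "(2 :: real) ^ 2 \<le> real n ^ 2" using n2 by (intro power_mono) auto
    also have "real n ^ 2 \<le> real n ^ 2 / \<delta>" using \<delta> by (simp add: le_divide_eq mult_left_le)
    finally show ?thesis by simp
  qed
  \<comment> \<open>Follows from e \<le> 4; together with \<open>1 \<le> a\<close> it lets the
    rounding term be absorbed into a * L.\<close>
  have L: "1 \<le> L"
  proof -
    have "exp 1 \<le> (4 :: real)" using exp_le by simp
    then have "exp 1 \<le> real n ^ 2 / \<delta>" using nd by simp
    then show ?thesis unfolding L_def using nd by (subst ln_ge_iff) auto
  qed
  have aL: "1 \<le> a * L" using mult_mono[OF a L] a by simp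
  \<comment> \<open>From n \<ge> 2 and \<delta> \<le> 1 the number x = n^2 / \<delta> is at least 4,
    so 16 x \<le> x^3: the factor 16 inside the logarithm becomes a factor 3 outside.\<close>
  have "ln (16 * (real n)\<^sup>2 / \<delta>) \<le> 3 * L"
  proof -
    have "16 \<le> (real n ^ 2 / \<delta>) ^ 2" using power_mono[OF nd, of 2] by simp
    then have "16 * (real n ^ 2 / \<delta>) \<le> (real n ^ 2 / \<delta>) ^ 2 * (real n ^ 2 / \<delta>)"
      using nd by (intro mult_right_mono) auto
    also have "\<dots> = (real n ^ 2 / \<delta>) ^ 3" by (simp add: power3_eq_cube power2_eq_square)
    finally have "16 * (real n)\<^sup>2 / \<delta> \<le> (real n ^ 2 / \<delta>) ^ 3" by simp
    then have "ln (16 * (real n)\<^sup>2 / \<delta>) \<le> ln ((real n ^ 2 / \<delta>) ^ 3)"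
      using n2 \<delta> by (intro ln_mono) auto
    then show ?thesis using nd by (simp add: L_def ln_realpow)
  qed
  then have "20000 * a * ln (16 * (real n)\<^sup>2 / \<delta>) \<le> 20000 * a * (3 * L)"
    using a by (intro mult_left_mono) auto
  also have "\<dots> \<le> real M" unfolding M_def by linarith
  finally have M: "20000 * (real n ^ 3 / \<epsilon> ^ 4) * ln (16 * (real n)\<^sup>2 / \<delta>) \<le> real M" by (simp add: a_def)
  have "0 < 60000 * a * L" using a L by simp
  then have M_pos: "0 < M" unfolding M_def by (metis zero_less_nat_eq zero_less_ceiling)
  have "real M \<le> 60000 * a * L + 1" unfolding M_def using aL by linarith
  then have "real M \<le> 60001 * (a * L)" using aL by simp
  then have "4 * (real n)\<^sup>2 * real M \<le> 4 * (real n)\<^sup>2 * (60001 * (a * L))" by (intro mult_left_mono) auto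
  also have "\<dots> = 240004 * (real n ^ 5 / \<epsilon> ^ 4 * ln (real n ^ 2 / \<delta>))"
    by (simp add: a_def L_def power2_eq_square power3_eq_cube eval_nat_numeral)
  finally have N: "real (4 * n\<^sup>2 * M + ?N') \<le> 240004 * (real n ^ 5 / \<epsilon> ^ 4 * ln (real n ^ 2 / \<delta>)) + real ?N'" by simp
  let ?A = "learner M (real n - real t - 54 / 100 * \<epsilon>\<^sup>2) n t ?p"
  show "\<exists>(N::nat) A.
          real N \<le> 240004 * (real n ^ 5 / \<epsilon> ^ 4 * ln (real n ^ 2 / \<delta>)) + real ?N' \<and>
          state_learner n A \<and> uses_at_most A N \<and>
          (\<forall>\<rho>. qstate n \<rho> \<and>
               (INF \<sigma> \<in> compressible_states n t. trace_dist \<rho> \<sigma>) \<le> \<epsilon> ^ 2 / (4 * (real n - real t))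
             \<longrightarrow> learns_within A \<rho> \<epsilon> \<delta>)"
    by (intro exI[of _ "4 * n\<^sup>2 * M + ?N'"] exI[of _ ?A] conjI allI impI N
        state_learner_learner uses_at_most_learner p)
      (use t \<epsilon> \<delta> M M_pos p learner_accurate in auto)
qed simp

end
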